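(* Let $\phi$ and $z$ be fixed constants. In the generalized Server Cloud Scheduling model with $z$ identical server machines, $k$ cloud contexts, communication delays depending on the direction and on the machine contexts, and an arbitrary cost function $\mathrm{cost}:\mathcal{J}\times\{c_1,\dots,c_k\}\to\mathbb{N}_0$, there is an FPTAS for budget-restrained makespan minimization (given a budget $b$, minimize the makespan among valid schedules with cost at most $b$) on task graphs whose maximum cardinality source and sink dividing cut is at most $\phi$.
   Context: Generalized Server Cloud Scheduling: the input is a directed acyclic task graph $G=(\mathcal{J},E)$ with one source $s$ and one sink $t$ (which must be processed on server machines: $p_s(s)=p_s(t)=0$, and their cloud processing times are $\infty$). There are $z$ identical server machines $s_1,\dots,s_z$ and $k$ cloud contexts $c_1,\dots,c_k$, each consisting of unboundedly many machines. Job $j$ has processing time $p_s(j)\in\mathbb{N}_0$ on any server machine and $p_{c_i}(j)\in\mathbb{N}_0$ on a machine of cloud context $c_i$. For each edge $(i,j)$ and machine types $m_1,m_2\in\{s,c_1,\dots,c_k\}$ there is a delay $c_{m_1,m_2}(i,j)\in\mathbb{N}_0$ (not necessarily symmetric), with $c_{m,m}(i,j)=0$. A schedule is a pair $(C,\eta)$ with completion times $C:\mathcal{J}\to\mathbb{N}_0$ and assignment $\eta:\mathcal{J}\to\{s_1,\dots,s_z\}\cup\{c_1,\dots,c_k\}$; write $p_{\eta(j)}(j)$ for the processing time of $j$ at its assigned location and use type $s$ for any server machine in delays. It is valid if (a) no two distinct jobs assigned to the same server machine overlap in time: $C(i)\le C(j)-p_s(j)$ or $C(i)-p_s(i)\ge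 C(j)$; (b) for every edge $(i,j)$: $C(i)+c_{\eta(i),\eta(j)}(i,j)\le C(j)-p_{\eta(j)}(j)$. The makespan is $C(t)$ and the cost is $\sum_{j:\eta(j)\in\{c_1,\dots,c_k\}}\mathrm{cost}(j,\eta(j))$. Maximum cardinality source and sink dividing cut: let $\mathcal{S}$ be the family of all sets $A\subseteq\mathcal{J}$ with $s\in A$ such that there is no edge $(j,k)\in E$ with $j\notin A$ and $k\in A$; then $\phi(G)=\max_{A\in\mathcal{S}}|\{(j,k)\in E: j\in A,\ k\notin A\}|$. *)

theory Defs
  imports Complex_Main
begin

datatype instr =
    IConst nat nat
  | IAdd nat nat nat
  | ISub nat nat nat
  | ILoad nat nat
  | IStore nat nat
  | IJz nat nat

type_synonym conf = "nat \<times> (nat \<Rightarrow> nat)"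

fun step :: "instr list \<Rightarrow> conf \<Rightarrow> conf" where
  "step P (pc, r) =
    (if length P \<le> pc then (pc, r) else
     (case P ! pc of
        IConst a v \<Rightarrow> (Suc pc, r(a := v))
      | IAdd a b c \<Rightarrow> (Suc pc, r(a := r b + r c))
      | ISub a b c \<Rightarrow> (Suc pc, r(a := r b - r c))
      | ILoad a b \<Rightarrow> (Suc pc, r(a := r (r b)))
      | IStore a b \<Rightarrow> (Suc pc, r(r a := r b))
      | IJz a l \<Rightarrow> (if r a = 0 then l else Suc pc, r)))"

text \<open>Input list xs: register 0 holds its length, registers 1..length xs its entries.
  The machine halts when the program counter leaves the program; the output is read
  in the same format.\<close>

definition init_conf :: "nat list \<Rightarrow> conf" where
  "init_conf xs = (0, \<lambda>i. if i = 0 then length xs else if i \<le> length xs then xs ! (i - 1) else 0)"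

definition output_of :: "(nat \<Rightarrow> nat) \<Rightarrow> nat list" where
  "output_of r = map (\<lambda>i. r (Suc i)) [0..<r 0]"

definition runs_within :: "instr list \<Rightarrow> nat list \<Rightarrow> nat \<Rightarrow> nat list \<Rightarrow> bool" where
  "runs_within P xs T ys \<longleftrightarrow>
     (\<exists>t\<le>T. length P \<le> fst ((step P ^^ t) (init_conf xs))
            \<and> output_of (snd ((step P ^^ t) (init_conf xs))) = ys)"

definition bitlen :: "nat \<Rightarrow> nat" where
  "bitlen x = (LEAST m. x < 2 ^ m)"

definition enc_size :: "nat list \<Rightarrow> nat" where
  "enc_size xs = length xs + sum_list (map bitlen xs)"

text \<open>Jobs are 0..<n. Machine types: None = server, Some i = cloud context i (i < k).\<close>

record inst =
  nj   :: nat
  src  :: nat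
  snk  :: nat
  edges :: "(nat \<times> nat) set"
  nz   :: nat
  nk   :: nat
  ps   :: "nat \<Rightarrow> nat"
  pcl  :: "nat \<Rightarrow> nat \<Rightarrow> nat"          (* pcl c j = p_{c}(j) *)
  dly  :: "nat option \<Rightarrow> nat option \<Rightarrow> nat \<Rightarrow> nat \<Rightarrow> nat"  (* dly m1 m2 i j = c_{m1,m2}(i,j) *)
  cst  :: "nat \<Rightarrow> nat \<Rightarrow> nat"          (* cst j c = cost(j, c) *)
  bud  :: nat

definition wf_inst :: "inst \<Rightarrow> bool" where
  "wf_inst I \<longleftrightarrow>
     src I < nj I \<and> snk I < nj I \<and> 1 \<le> nz I \<and>
     edges I \<subseteq> {0..<nj I} \<times> {0..<nj I} \<and> acyclic (edges I) \<and>
     (\<forall>j<nj I. (\<not>(\<exists>i. (i, j) \<in> edges I)) \<longleftrightarrow> j = src I) \<and>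
     (\<forall>j<nj I. (\<not>(\<exists>i. (j, i) \<in> edges I)) \<longleftrightarrow> j = snk I) \<and>
     ps I (src I) = 0 \<and> ps I (snk I) = 0 \<and>
     (\<forall>m i j. dly I m m i j = 0)"

definition dividing_sets :: "inst \<Rightarrow> nat set set" where
  "dividing_sets I = {A. A \<subseteq> {0..<nj I} \<and> src I \<in> A \<and>
        \<not> (\<exists>(j, k) \<in> edges I. j \<notin> A \<and> k \<in> A)}"

definition cut_phi :: "inst \<Rightarrow> nat" where
  "cut_phi I = Max ((\<lambda>A. card {(j, k) \<in> edges I. j \<in> A \<and> k \<notin> A}) ` dividing_sets I)"

text \<open>Standard encoding of an instance as a list of naturals (values that the model
  treats as irrelevant -- delays on non-edges, cloud times/costs of s and t -- are encoded as 0).\<close>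

definition mtypes :: "inst \<Rightarrow> nat option list" where
  "mtypes I = None # map Some [0..<nk I]"

definition enc :: "inst \<Rightarrow> nat list" where
  "enc I =
     [nj I, src I, snk I, nz I, nk I, bud I]
   @ [if (i, j) \<in> edges I then 1 else 0. i \<leftarrow> [0..<nj I], j \<leftarrow> [0..<nj I]]
   @ map (ps I) [0..<nj I]
   @ [if j = src I \<or> j = snk I then 0 else pcl I c j. c \<leftarrow> [0..<nk I], j \<leftarrow> [0..<nj I]]
   @ [if (i, j) \<in> edges I then dly I m1 m2 i j else 0.
        m1 \<leftarrow> mtypes I, m2 \<leftarrow> mtypes I, i \<leftarrow> [0..<nj I], j \<leftarrow> [0..<nj I]]
   @ [if j = src I \<or> j = snk I then 0 else cst I j c. j \<leftarrow> [0..<nj I], c \<leftarrow> [0..<nk I]]"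

datatype loc = Server nat | Cloud nat

fun ltype :: "loc \<Rightarrow> nat option" where
  "ltype (Server _) = None"
| "ltype (Cloud c) = Some c"

fun is_server :: "loc \<Rightarrow> bool" where
  "is_server (Server _) = True"
| "is_server (Cloud _) = False"

definition ptime :: "inst \<Rightarrow> (nat \<Rightarrow> loc) \<Rightarrow> nat \<Rightarrow> nat" where
  "ptime I \<eta> j = (case \<eta> j of Server _ \<Rightarrow> ps I j | Cloud c \<Rightarrow> pcl I c j)"

definition valid_sched :: "inst \<Rightarrow> (nat \<Rightarrow> nat) \<Rightarrow> (nat \<Rightarrow> loc) \<Rightarrow> bool" where
  "valid_sched I C \<eta> \<longleftrightarrow>
     (\<forall>j<nj I. case \<eta> j of Server m \<Rightarrow> m < nz I | Cloud c \<Rightarrow> c < nk I) \<and>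
     is_server (\<eta> (src I)) \<and> is_server (\<eta> (snk I)) \<and>
     (\<forall>i<nj I. \<forall>j<nj I. i \<noteq> j \<and> \<eta> i = \<eta> j \<and> is_server (\<eta> i) \<longrightarrow>
         int (C i) \<le> int (C j) - int (ps I j) \<or> int (C i) - int (ps I i) \<ge> int (C j)) \<and>
     (\<forall>(i, j) \<in> edges I.
         int (C i) + int (dly I (ltype (\<eta> i)) (ltype (\<eta> j)) i j) \<le> int (C j) - int (ptime I \<eta> j))"

definition sched_cost :: "inst \<Rightarrow> (nat \<Rightarrow> loc) \<Rightarrow> nat" where
  "sched_cost I \<eta> = (\<Sum>j\<in>{j. j < nj I \<and> \<not> is_server (\<eta> j)}.
                        (case \<eta> j of Cloud c \<Rightarrow> cst I j c | Server _ \<Rightarrow> 0))"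

definition makespan :: "inst \<Rightarrow> (nat \<Rightarrow> nat) \<Rightarrow> nat" where
  "makespan I C = C (snk I)"

text \<open>Decoding of a machine output: [C 0, code 0, C 1, code 1, ...], where code 2m is server m
  and code 2c+1 is cloud context c.\<close>

definition loc_of_code :: "nat \<Rightarrow> loc" where
  "loc_of_code x = (if even x then Server (x div 2) else Cloud (x div 2))"

definition dec_sched :: "nat list \<Rightarrow> (nat \<Rightarrow> nat) \<times> (nat \<Rightarrow> loc)" where
  "dec_sched ys = ((\<lambda>j. ys ! (2 * j)), (\<lambda>j. loc_of_code (ys ! (2 * j + 1))))"

end

theory Submission
  imports Defs
begin

text \<open>
  Schedule the jobs one at a time in an order compatible with start times, so that every prefix of
  jobs is a dividing set, and keep as a state only the types and completion times of the jobs that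
  still have an unscheduled successor together with the times at which the servers become free.  A
  dividing set is determined by its at most \<open>\<phi>\<close> crossing edges, hence after rounding all times
  down to multiples of \<open>\<delta>\<close>, and with at most \<open>M\<close> such multiples below the horizon, only
  polynomially many rounded states (keys) remain; of the states with equal key a cheapest one is
  kept.  Every round of this pruning delays the stored schedule by at most \<open>\<delta> - 1\<close>, so a
  schedule of makespan \<open>T\<close> within the budget is found whenever the horizon is at least
  \<open>T + n * (\<delta> - 1)\<close>.  Trying \<open>\<delta> = 1, 2, 4, ...\<close> and for each \<open>\<delta>\<close> the horizons
  \<open>0, \<delta>, ..., M * \<delta>\<close>, the first success is optimal if \<open>\<delta> = 1\<close>; otherwise the failure of
  \<open>\<delta> div 2\<close> at its largest horizon shows that the optimum is at least \<open>(n + 1) * e * \<delta>\<close>, which makes the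
  total error \<open>(n + 1) * (\<delta> - 1)\<close> relatively small.

  For the running time, the algorithm is a program in a small functional language whose only loop
  runs a number of times fixed by the input size, so that every program is polynomial by its syntax
  alone.  Loops over lists are truncated at \<open>W\<close>, a fixed power of that number, and
  polynomial bounds on the lists are needed only to see that nothing is cut off.
\<close>

section \<open>A functional language compiled to the random access machine\<close>

text \<open>Rounding serves only to compare states. Stored times stay exact, each job starting as
  early as its history permits, so every stored history is feasible for every \<delta> and only
  optimality can suffer. The loss is additive and has to be small against an optimum T that is not
  known in advance. Doubling \<delta> finds the scale: with g = \<delta> div 2, failure of g at
  horizon M * g means M * g < T + n * (g - 1), and M = 2 * (n + 1) * e + (n + 1) is chosen so that T
  \<ge> (n + 1) * e * \<delta> follows. Running all jobs on one server is always feasible, so the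
  bit length of the sum of the input bounds the number of doublings; hence it enters the iteration
  number N besides the input length and e. Large numbers are only added, subtracted, compared, or
  multiplied by small ones, so addition and subtraction suffice as machine arithmetic. The obstacle
  on the machine side is the input format, which leaves no low register free to work with.\<close>

datatype val = VN nat | VP val val

datatype fn = FId | FComp fn fn | FPair fn fn | FFst | FSnd | FConst nat
  | FAdd fn fn | FSub fn fn | FIf fn fn fn | FIter fn

text \<open>A relation, because projections and arithmetic have no value on arguments of the wrong
  shape. The loop rule takes the whole sequence \<open>X\<close> of intermediate values, so an
  induction gets one hypothesis per iteration.\<close>

inductive ev :: "nat \<Rightarrow> fn \<Rightarrow> val \<Rightarrow> val \<Rightarrow> bool" for N where
  ev_Id: "ev N FId v v"
| ev_Comp: "ev N f u v \<Longrightarrow> ev N g v w \<Longrightarrow> ev N (FComp f g) u w"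
| ev_Pair: "ev N f u v \<Longrightarrow> ev N g u w \<Longrightarrow> ev N (FPair f g) u (VP v w)"
| ev_Fst: "ev N FFst (VP v w) v"
| ev_Snd: "ev N FSnd (VP v w) w"
| ev_Const: "ev N (FConst n) u (VN n)"
| ev_Add: "ev N f u (VN a) \<Longrightarrow> ev N g u (VN b) \<Longrightarrow> ev N (FAdd f g) u (VN (a + b))"
| ev_Sub: "ev N f u (VN a) \<Longrightarrow> ev N g u (VN b) \<Longrightarrow> ev N (FSub f g) u (VN (a - b))"
| ev_If0: "ev N c u (VN 0) \<Longrightarrow> ev N g u w \<Longrightarrow> ev N (FIf c f g) u w"
| ev_If1: "ev N c u v \<Longrightarrow> v \<noteq> VN 0 \<Longrightarrow> ev N f u w \<Longrightarrow> ev N (FIf c f g) u w"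
| ev_Iter: "(\<And>i. i < N \<Longrightarrow> ev N f (X i) (X (Suc i))) \<Longrightarrow> ev N (FIter f) (X 0) (X N)"

text \<open>\<open>compile p t f\<close> is code for address \<open>p\<close> that replaces the argument of \<open>f\<close> in register \<open>t\<close> by its value,
  using only registers from \<open>t\<close> on.  Registers 0, 1, 2, 3 hold the constants 0 and 1, the first free heap
  cell and the iteration number \<open>N\<close>.\<close>

fun compile :: "nat \<Rightarrow> nat \<Rightarrow> fn \<Rightarrow> instr list" where
  "compile p t FId = []"
| "compile p t (FComp f g) = compile p t f @ compile (p + length (compile p t f)) t g"
| "compile p t (FPair f g) =
    (let a = compile (Suc p) (t+1) f; b = compile (p + 2 + length a) (t+2) g in
     IAdd (t+1) t 0 # a @ IAdd (t+2) t 0 # b @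
     [IStore 2 (t+1), IAdd 2 2 1, IStore 2 (t+2), ISub t 2 1, IAdd 2 2 1])"
| "compile p t FFst = [ILoad t t]"
| "compile p t FSnd = [IAdd t t 1, ILoad t t]"
| "compile p t (FConst n) = [IConst t n]"
| "compile p t (FAdd f g) =
    (let a = compile (Suc p) (t+1) f; b = compile (p + 2 + length a) (t+2) g in
     IAdd (t+1) t 0 # a @ IAdd (t+2) t 0 # b @ [IAdd t (t+1) (t+2)])"
| "compile p t (FSub f g) =
    (let a = compile (Suc p) (t+1) f; b = compile (p + 2 + length a) (t+2) g in
     IAdd (t+1) t 0 # a @ IAdd (t+2) t 0 # b @ [ISub t (t+1) (t+2)])"
| "compile p t (FIf c f g) =
    (let a = compile (Suc p) (t+1) c; b = compile (p + 2 + length a) t f;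
         q = p + 3 + length a + length b; d = compile q t g in
     IAdd (t+1) t 0 # a @ IJz (t+1) q # b @ IJz 0 (q + length d) # d)"
| "compile p t (FIter f) =
    (let a = compile (p + 3) (t+1) f in
     IAdd (t+1) t 0 # IAdd t 3 0 # IJz t (p + 5 + length a) # a @
     [ISub t t 1, IJz 0 (p + 2), IAdd t (t+1) 0])"

text \<open>Bound on the registers used from \<open>t\<close> on. Only some constant is needed, to
  place the heap above them, so sums replace maxima.\<close>

fun regs :: "fn \<Rightarrow> nat" where
  "regs (FComp f g) = regs f + regs g"
| "regs (FPair f g) = 3 + regs f + regs g"
| "regs (FAdd f g) = 3 + regs f + regs g"
| "regs (FSub f g) = 3 + regs f + regs g"
| "regs (FIf c f g) = 2 + regs c + regs f + regs g"
| "regs (FIter f) = 2 + regs f"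
| "regs _ = 1"

fun time :: "nat \<Rightarrow> fn \<Rightarrow> nat" where
  "time N (FComp f g) = time N f + time N g"
| "time N (FPair f g) = 7 + time N f + time N g"
| "time N (FAdd f g) = 3 + time N f + time N g"
| "time N (FSub f g) = 3 + time N f + time N g"
| "time N (FIf c f g) = 3 + time N c + time N f + time N g"
| "time N (FIter f) = 4 + N * (3 + time N f)"
| "time N FId = 0"
| "time N FFst = 1"
| "time N FSnd = 2"
| "time N (FConst n) = 1"

text \<open>The nesting depth of loops is fixed by the program; each level raises the degree by one,
  and all other constructors only add.\<close>

lemma time_poly: "\<exists>A d. \<forall>N. time N f \<le> A * Suc N ^ d"
proof -
  have two: "\<exists>A d. \<forall>N. k + F N + G N \<le> A * Suc N ^ d"
    if "\<exists>A d. \<forall>N. F N \<le> A * Suc N ^ d" "\<exists>A d. \<forall>N. G N \<le> A * Suc N ^ d" for F G :: "nat \<Rightarrow> nat" and k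
  proof -
    obtain A d B e where a: "\<And>N. F N \<le> A * Suc N ^ d" and b: "\<And>N. G N \<le> B * Suc N ^ e"
      using \<open>\<exists>A d. \<forall>N. F N \<le> A * Suc N ^ d\<close> \<open>\<exists>A d. \<forall>N. G N \<le> A * Suc N ^ d\<close> by blast
    have "k + F N + G N \<le> (k + A + B) * Suc N ^ (d + e)" for N
    proof -
      have p: "Suc N ^ i \<ge> 1" for i by simp
      have "A * Suc N ^ d \<le> A * Suc N ^ (d + e)" "B * Suc N ^ e \<le> B * Suc N ^ (d + e)"
        by (intro mult_left_mono power_increasing; simp)+
      moreover have "k \<le> k * Suc N ^ (d + e)" using p[of "d+e"] by (metis mult.right_neutral mult_le_mono2)
      ultimately have "k + F N + G N \<le> k * Suc N ^ (d + e) + A * Suc N ^ (d + e) + B * Suc N ^ (d + e)"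
        using a[of N] b[of N] by linarith
      then show ?thesis by (simp only: distrib_right)
    qed
    then show ?thesis by blast
  qed
  have const: "\<exists>A d. \<forall>N. (k::nat) \<le> A * Suc N ^ d" for k
    by (rule exI[of _ k], rule exI[of _ 0]) simp
  show ?thesis
  proof (induction f)
    case (FComp f g) then show ?case using two[of "\<lambda>N. time N f" "\<lambda>N. time N g" 0] by simp
  next
    case (FPair f g) then show ?case using two[of "\<lambda>N. time N f" "\<lambda>N. time N g" 7] by simp
  next
    case (FAdd f g) then show ?case using two[of "\<lambda>N. time N f" "\<lambda>N. time N g" 3] by simp
  next
    case (FSub f g) then show ?case using two[of "\<lambda>N. time N f" "\<lambda>N. time N g" 3] by simp
  next
    case (FIf c f g)
    then show ?case using two[of "\<lambda>N. 3 + time N c + time N f" "\<lambda>N. time N g" 0]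
      two[of "\<lambda>N. time N c" "\<lambda>N. time N f" 3] by simp
  next
    case (FIter f)
    then obtain A d where a: "\<And>N. time N f \<le> A * Suc N ^ d" by blast
    have "4 + N * (3 + time N f) \<le> (7 + A) * Suc N ^ Suc d" for N
    proof -
      have "Suc N ^ d \<ge> 1" by simp
      then have "3 + time N f \<le> 3 * Suc N ^ d + A * Suc N ^ d" using a[of N] by linarith
      then have "3 + time N f \<le> (3 + A) * Suc N ^ d" by (simp only: distrib_right)
      then have "N * (3 + time N f) \<le> Suc N * ((3 + A) * Suc N ^ d)" by (intro mult_le_mono) auto
      moreover have "(4::nat) \<le> 4 * Suc N ^ Suc d" by (simp del: power_Suc)
      ultimately show ?thesis by (simp add: algebra_simps)
    qed
    then show ?case by (intro exI[of _ "7+A"] exI[of _ "Suc d"]) simp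
  qed (simp_all only: time.simps const)
qed

section \<open>Machine executions and the heap representation of values\<close>

definition code_at :: "instr list \<Rightarrow> nat \<Rightarrow> instr list \<Rightarrow> bool" where
  "code_at P p c \<longleftrightarrow> (\<forall>i < length c. p + i < length P \<and> P ! (p + i) = c ! i)"

lemma code_at_Nil [simp]: "code_at P p []" by (simp add: code_at_def)

lemma code_at_Cons [simp]:
  "code_at P p (x # c) \<longleftrightarrow> p < length P \<and> P ! p = x \<and> code_at P (Suc p) c"
  unfolding code_at_def by (auto simp: nth_Cons All_less_Suc2)

lemma code_at_append [simp]:
  "code_at P p (c @ d) \<longleftrightarrow> code_at P p c \<and> code_at P (p + length c) d"
  by (induction c arbitrary: p) auto

definition reach :: "instr list \<Rightarrow> nat \<Rightarrow> conf \<Rightarrow> conf \<Rightarrow> bool" where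
  "reach P k c c' \<longleftrightarrow> (\<exists>j\<le>k. (step P ^^ j) c = c')"

lemma reach_refl: "reach P k c c"
  unfolding reach_def by (rule exI[of _ 0]) simp

lemma reach_trans: "reach P k a b \<Longrightarrow> reach P l b c \<Longrightarrow> reach P (k + l) a c"
proof -
  assume "reach P k a b" "reach P l b c"
  then obtain i j where "i \<le> k" "j \<le> l" "(step P ^^ i) a = b" "(step P ^^ j) b = c"
    unfolding reach_def by blast
  then show ?thesis unfolding reach_def
    by (intro exI[of _ "j + i"]) (simp add: funpow_add)
qed

lemma reach_mono: "reach P k a b \<Longrightarrow> k \<le> l \<Longrightarrow> reach P l a b"
  unfolding reach_def using le_trans by blast

lemma reach_Suc: "step P a = b \<Longrightarrow> reach P k b c \<Longrightarrow> reach P (Suc k) a c"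
proof -
  assume "step P a = b" "reach P k b c"
  then obtain j where "j \<le> k" "(step P ^^ j) b = c" unfolding reach_def by blast
  with \<open>step P a = b\<close> show ?thesis unfolding reach_def
    by (intro exI[of _ "Suc j"]) (simp add: funpow_swap1)
qed

definition good :: "nat \<Rightarrow> nat \<Rightarrow> (nat \<Rightarrow> nat) \<Rightarrow> bool" where
  "good H N r \<longleftrightarrow> r 0 = 0 \<and> r 1 = 1 \<and> r 3 = N \<and> H \<le> r 2"

text \<open>Frame condition of compiled code. A cell below the heap pointer is never written again,
  so pointers may be copied freely and all values built so far stay represented; register 2 is
  exempt because allocation advances it.\<close>

definition hext :: "nat \<Rightarrow> nat \<Rightarrow> (nat \<Rightarrow> nat) \<Rightarrow> (nat \<Rightarrow> nat) \<Rightarrow> bool" where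
  "hext H t r r' \<longleftrightarrow> (\<forall>i<t. i \<noteq> 2 \<longrightarrow> r' i = r i) \<and> r 2 \<le> r' 2 \<and>
     (\<forall>i. H \<le> i \<and> i < r 2 \<longrightarrow> r' i = r i)"

text \<open>Heap cells lie at addresses from \<open>H\<close> on, so a pointer to a pair is never 0 and can be tested
  against the empty list, which is represented by 0.\<close>

fun rep :: "nat \<Rightarrow> (nat \<Rightarrow> nat) \<Rightarrow> val \<Rightarrow> nat \<Rightarrow> bool" where
  "rep H r (VN n) x \<longleftrightarrow> x = n"
| "rep H r (VP u w) x \<longleftrightarrow> H \<le> x \<and> Suc x < r 2 \<and> rep H r u (r x) \<and> rep H r w (r (Suc x))"

lemma rep_hext: "hext H t r r' \<Longrightarrow> rep H r v x \<Longrightarrow> rep H r' v x"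
  by (induction v arbitrary: x) (auto simp: hext_def)

lemma hext_refl: "hext H t r r" by (simp add: hext_def)

lemma hext_trans: "hext H t r r' \<Longrightarrow> hext H t' r' r'' \<Longrightarrow> t \<le> t' \<Longrightarrow> hext H t r r''"
  by (auto simp: hext_def)

lemma hext_upd: "t \<le> a \<Longrightarrow> 4 \<le> t \<Longrightarrow> a < H \<Longrightarrow> hext H t r (r(a := x))"
  by (auto simp: hext_def)

lemma good_hext: "good H N r \<Longrightarrow> hext H t r r' \<Longrightarrow> 4 \<le> t \<Longrightarrow> good H N r'"
  by (auto simp: good_def hext_def)

lemma regs_pos: "0 < regs f" by (induction f) auto

definition corr :: "instr list \<Rightarrow> nat \<Rightarrow> nat \<Rightarrow> nat \<Rightarrow> nat \<Rightarrow> (nat \<Rightarrow> nat) \<Rightarrow> nat \<Rightarrow> val \<Rightarrow> bool" where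
  "corr P H k p t r q w \<longleftrightarrow> (\<exists>r'. reach P k (p, r) (q, r') \<and> hext H t r r' \<and> rep H r' w (r' t))"

text \<open>The part shared by pairing, addition and subtraction. Each argument is computed from a
  fresh copy of the input in \<open>t\<close>, and the second uses only registers from
  \<open>t+2\<close> on, so the first result survives in \<open>t+1\<close>.\<close>

lemma two_args:
  assumes cf: "\<And>p t r. code_at P p (compile p t f) \<Longrightarrow> 4 \<le> t \<Longrightarrow> t + regs f \<le> H \<Longrightarrow> good H N r \<Longrightarrow>
      rep H r u (r t) \<Longrightarrow> corr P H (time N f) p t r (p + length (compile p t f)) v"
    and cg: "\<And>p t r. code_at P p (compile p t g) \<Longrightarrow> 4 \<le> t \<Longrightarrow> t + regs g \<le> H \<Longrightarrow> good H N r \<Longrightarrow>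
      rep H r u (r t) \<Longrightarrow> corr P H (time N g) p t r (p + length (compile p t g)) w"
    and a: "a = compile (Suc p) (t+1) f" and b: "b = compile (p + 2 + length a) (t+2) g"
    and code: "code_at P p (IAdd (t+1) t 0 # a @ IAdd (t+2) t 0 # b)"
    and t: "4 \<le> t" "t + regs f + regs g + 2 \<le> H" and r: "good H N r" "rep H r u (r t)"
  shows "\<exists>r'. reach P (2 + time N f + time N g) (p, r) (p + 2 + length a + length b, r') \<and>
     hext H t r r' \<and> rep H r' v (r' (t+1)) \<and> rep H r' w (r' (t+2))"
proof -
  have tH: "t + 4 \<le> H" using t regs_pos[of f] regs_pos[of g] by linarith
  let ?r1 = "r(t+1 := r t)"
  have s1: "step P (p, r) = (Suc p, ?r1)" using code r(1) by (simp add: good_def)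
  have h1: "hext H t r ?r1" using t tH by (intro hext_upd) auto
  have g1: "good H N ?r1" using good_hext[OF r(1) h1] t by simp
  have "corr P H (time N f) (Suc p) (t+1) ?r1 (Suc p + length (compile (Suc p) (t+1) f)) v"
    using code t rep_hext[OF h1 r(2)] g1 by (intro cf) (auto simp: a)
  then obtain r2 where r2: "reach P (time N f) (Suc p, ?r1) (Suc p + length a, r2)"
    "hext H (t+1) ?r1 r2" "rep H r2 v (r2 (t+1))" unfolding corr_def a by blast
  have r2t: "r2 t = r t" using r2(2) t by (auto simp: hext_def)
  have h2: "hext H t r r2" using hext_trans[OF h1 r2(2)] by simp
  have g2: "good H N r2" using good_hext[OF r(1) h2] t by simp
  let ?r3 = "r2(t+2 := r t)"
  have s3: "step P (Suc p + length a, r2) = (p + 2 + length a, ?r3)"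
    using code g2 r2t by (simp add: good_def)
  have h3: "hext H (t+2) r2 ?r3" using t tH by (intro hext_upd) auto
  have h3': "hext H t r ?r3" using hext_trans[OF h2 h3] by simp
  have g3: "good H N ?r3" using good_hext[OF g2 h3] t by simp
  have "corr P H (time N g) (p + 2 + length a) (t+2) ?r3 (p + 2 + length a + length (compile (p + 2 + length a) (t+2) g)) w"
    using code t rep_hext[OF h3' r(2)] g3 by (intro cg) (auto simp: b)
  then obtain r4 where r4: "reach P (time N g) (p + 2 + length a, ?r3) (p + 2 + length a + length b, r4)"
    "hext H (t+2) ?r3 r4" "rep H r4 w (r4 (t+2))" unfolding corr_def b by blast
  have "hext H t r r4" using hext_trans[OF h3' r4(2)] by simp
  moreover have "r4 (t+1) = r2 (t+1)" using r4(2) t by (auto simp: hext_def)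
  moreover have "rep H r4 v (r2 (t+1))" using rep_hext[OF hext_trans[OF h3 r4(2)] r2(3)] by simp
  moreover have "reach P (Suc (time N f + Suc (time N g))) (p, r) (p + 2 + length a + length b, r4)"
    by (rule reach_Suc[OF s1 reach_trans[OF r2(1) reach_Suc[OF s3 r4(1)]]])
  ultimately show ?thesis using r4(3) by (intro exI[of _ r4]) (simp add: add_ac)
qed

lemma binop_correct:
  assumes cf: "\<And>p t r. code_at P p (compile p t f) \<Longrightarrow> 4 \<le> t \<Longrightarrow> t + regs f \<le> H \<Longrightarrow> good H N r \<Longrightarrow>
      rep H r u (r t) \<Longrightarrow> corr P H (time N f) p t r (p + length (compile p t f)) (VN m)"
    and cg: "\<And>p t r. code_at P p (compile p t g) \<Longrightarrow> 4 \<le> t \<Longrightarrow> t + regs g \<le> H \<Longrightarrow> good H N r \<Longrightarrow>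
      rep H r u (r t) \<Longrightarrow> corr P H (time N g) p t r (p + length (compile p t g)) (VN n)"
    and a: "a = compile (Suc p) (t+1) f" and b: "b = compile (p + 2 + length a) (t+2) g"
    and code: "code_at P p (IAdd (t+1) t 0 # a @ IAdd (t+2) t 0 # b @ [i])"
    and i: "\<And>q s. code_at P q [i] \<Longrightarrow> step P (q, s) = (Suc q, s(t := bop (s (t+1)) (s (t+2))))"
    and t: "4 \<le> t" "t + regs f + regs g + 3 \<le> H" and r: "good H N r" "rep H r u (r t)"
  shows "corr P H (3 + time N f + time N g) p t r (Suc (p + 2 + length a + length b)) (VN (bop m n))"
proof -
  have "\<exists>r'. reach P (2 + time N f + time N g) (p, r) (p + 2 + length a + length b, r') \<and>
     hext H t r r' \<and> rep H r' (VN m) (r' (t+1)) \<and> rep H r' (VN n) (r' (t+2))"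
    using code t by (intro two_args[OF cf cg a b _ _ _ r]) auto
  then obtain r2 where r2: "reach P (2 + time N f + time N g) (p, r) (p + 2 + length a + length b, r2)"
     "hext H t r r2" "r2 (t+1) = m" "r2 (t+2) = n" by auto
  define q where "q = p + 2 + length a + length b"
  have "code_at P q [i]" using code by (simp add: q_def)
  from i[OF this, of r2] have "step P (q, r2) = (Suc q, r2(t := bop m n))" using r2(3,4) by simp
  then have "reach P 1 (q, r2) (Suc q, r2(t := bop m n))"
    unfolding One_nat_def by (rule reach_Suc[OF _ reach_refl])
  then have "reach P (3 + time N f + time N g) (p, r) (Suc q, r2(t := bop m n))"
    by (rule reach_mono[OF reach_trans[OF r2(1)[folded q_def]]]) simp
  moreover have "hext H t r2 (r2(t := bop m n))" using t by (intro hext_upd) auto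
  ultimately show ?thesis unfolding corr_def q_def
    using hext_trans[OF r2(2)] by (intro exI[of _ "r2(t := bop m n)"]) auto
qed

text \<open>The induction is on the evaluation, not on \<open>f\<close>, and leaves \<open>r\<close>
  arbitrary: each iteration of a loop then has its own hypothesis, applicable to whatever heap the
  earlier iterations left.\<close>

lemma compile_correct:
  assumes "ev N f u w"
  shows "code_at P p (compile p t f) \<Longrightarrow> 4 \<le> t \<Longrightarrow> t + regs f \<le> H \<Longrightarrow> good H N r \<Longrightarrow>
      rep H r u (r t) \<Longrightarrow> corr P H (time N f) p t r (p + length (compile p t f)) w"
  using assms
proof (induction arbitrary: p t r rule: ev.induct)
  case (ev_Id v)
  then show ?case by (auto simp: corr_def intro: reach_refl hext_refl)
next
  case (ev_Comp f u v g w)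
  have "corr P H (time N f) p t r (p + length (compile p t f)) v"
    using ev_Comp.prems by (intro ev_Comp.IH) auto
  then obtain r2 where r2: "reach P (time N f) (p, r) (p + length (compile p t f), r2)"
    "hext H t r r2" "rep H r2 v (r2 t)" unfolding corr_def by blast
  have "corr P H (time N g) (p + length (compile p t f)) t r2
     (p + length (compile p t f) + length (compile (p + length (compile p t f)) t g)) w"
    using ev_Comp.prems r2 good_hext[OF _ r2(2)] by (intro ev_Comp.IH(2)) auto
  then obtain r3 where r3: "reach P (time N g) (p + length (compile p t f), r2)
      (p + length (compile p t (FComp f g)), r3)"
    "hext H t r2 r3" "rep H r3 w (r3 t)" unfolding corr_def by (auto simp: add.assoc)
  show ?case unfolding corr_def
    using reach_trans[OF r2(1) r3(1)] hext_trans[OF r2(2) r3(2)] r3(3) by auto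
next
  case (ev_Pair f u v g w)
  define a where "a = compile (Suc p) (t+1) f"
  define b where "b = compile (p + 2 + length a) (t+2) g"
  have code: "code_at P p (IAdd (t+1) t 0 # a @ IAdd (t+2) t 0 # b @
     [IStore 2 (t+1), IAdd 2 2 1, IStore 2 (t+2), ISub t 2 1, IAdd 2 2 1])"
    using ev_Pair.prems(1) by (simp add: a_def b_def Let_def)
  have "\<exists>r'. reach P (2 + time N f + time N g) (p, r) (p + 2 + length a + length b, r') \<and>
     hext H t r r' \<and> rep H r' v (r' (t+1)) \<and> rep H r' w (r' (t+2))"
    using ev_Pair.prems code
    by (intro two_args[OF ev_Pair.IH a_def b_def]) auto
  then obtain r2 where r2: "reach P (2 + time N f + time N g) (p, r) (p + 2 + length a + length b, r2)"
     "hext H t r r2" "rep H r2 v (r2 (t+1))" "rep H r2 w (r2 (t+2))" by blast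
  have g2: "good H N r2" using good_hext[OF ev_Pair.prems(4) r2(2)] ev_Pair.prems by simp
  define q where "q = p + 2 + length a + length b"
  define h where "h = r2 2"
  have hH: "H \<le> h" using g2 by (simp add: h_def good_def)
  define r3 where "r3 = r2(h := r2 (t+1))"
  define r4 where "r4 = r3(2 := Suc h)"
  define r5 where "r5 = r4(Suc h := r2 (t+2))"
  define r6 where "r6 = r5(t := h)"
  define r7 where "r7 = r6(2 := Suc (Suc h))"
  \<comment> \<open>The new cells at \<open>h\<close> and \<open>Suc h\<close> lie above the working
    registers \<open>t\<close> to \<open>t+2\<close>.\<close>
  have th: "t + 3 < h" "4 \<le> t" "t + 3 < H" using ev_Pair.prems hH regs_pos[of f] regs_pos[of g] by auto
  have sts: "step P (q, r2) = (q+1, r3)" "step P (q+1, r3) = (q+2, r4)" "step P (q+2, r4) = (q+3, r5)"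
    "step P (q+3, r5) = (q+4, r6)" "step P (q+4, r6) = (q+5, r7)"
    using code g2 th by (auto simp: q_def h_def r3_def r4_def r5_def r6_def r7_def good_def numeral_eq_Suc)
  have "reach P 5 (q, r2) (q+5, r7)"
    unfolding numeral_eq_Suc pred_numeral_simps BitM.simps by (intro reach_Suc[OF sts(1)] reach_Suc[OF sts(2)] reach_Suc[OF sts(3)] reach_Suc[OF sts(4)])
      (use reach_Suc[OF sts(5) reach_refl] in \<open>simp add: numeral_eq_Suc\<close>)
  then have "reach P (time N (FPair f g)) (p, r) (q + 5, r7)"
    by (rule reach_mono[OF reach_trans[OF r2(1)[folded q_def]]]) simp
  moreover have h7: "hext H t r2 r7" using th hH
    by (auto simp: hext_def r3_def r4_def r5_def r6_def r7_def h_def)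
  moreover have "rep H r7 (VP v w) (r7 t)"
    using rep_hext[OF h7 r2(3)] rep_hext[OF h7 r2(4)] th hH
    by (auto simp: r3_def r4_def r5_def r6_def r7_def)
  ultimately show ?case unfolding corr_def
    using hext_trans[OF r2(2) h7]
    by (intro exI[of _ r7]) (simp add: q_def a_def b_def Let_def add_ac numeral_eq_Suc)
next
  case (ev_Fst v w)
  have "reach P 1 (p, r) (Suc p, r(t := r (r t)))"
    using ev_Fst.prems unfolding One_nat_def by (intro reach_Suc[OF _ reach_refl]) simp
  then show ?case unfolding corr_def
    using ev_Fst.prems hext_upd[of t t H r "r (r t)"] rep_hext[of H t r "r(t := r (r t))" v "r (r t)"]
    by (intro exI[of _ "r(t := r (r t))"]) auto
next
  case (ev_Snd v w)
  define r1 where "r1 = r(t := Suc (r t))"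
  define r2 where "r2 = r1(t := r (Suc (r t)))"
  have "t < r t" using ev_Snd.prems by auto
  then have "reach P 2 (p, r) (p + 2, r2)"
    using ev_Snd.prems unfolding numeral_2_eq_2
    by (intro reach_Suc[of P "(p, r)" "(Suc p, r1)"] reach_Suc[of P "(Suc p, r1)" "(p + 2, r2)"] reach_refl)
       (auto simp: r1_def r2_def good_def reach_refl)
  moreover have "hext H t r r2" using ev_Snd.prems 
    by (auto simp: hext_def r1_def r2_def)
  ultimately show ?case unfolding corr_def
    using ev_Snd.prems rep_hext[of H t r r2 w "r (Suc (r t))"]
    by (intro exI[of _ r2]) (auto simp: r1_def r2_def)
next
  case (ev_Const n u)
  have "reach P 1 (p, r) (Suc p, r(t := n))"
    using ev_Const.prems unfolding One_nat_def by (intro reach_Suc[OF _ reach_refl]) simp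
  then show ?case unfolding corr_def
    using ev_Const.prems hext_upd[of t t H r n]
    by (intro exI[of _ "r(t := n)"]) auto
next
  case (ev_Add f u m g n)
  define a where "a = compile (Suc p) (t+1) f"
  define b where "b = compile (p + 2 + length a) (t+2) g"
  have c: "compile p t (FAdd f g) = IAdd (t+1) t 0 # a @ IAdd (t+2) t 0 # b @ [IAdd t (t+1) (t+2)]"
    by (simp add: a_def b_def Let_def)
  have "corr P H (3 + time N f + time N g) p t r (Suc (p + 2 + length a + length b)) (VN (m + n))"
    by (rule binop_correct[OF ev_Add.IH a_def b_def ev_Add.prems(1)[unfolded c] _ _ _ ev_Add.prems(4,5), where bop = "(+)"])
      (use ev_Add.prems(2,3) in auto)
  then show ?case unfolding c by (simp add: add_ac)
next
  case (ev_Sub f u m g n)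
  define a where "a = compile (Suc p) (t+1) f"
  define b where "b = compile (p + 2 + length a) (t+2) g"
  have c: "compile p t (FSub f g) = IAdd (t+1) t 0 # a @ IAdd (t+2) t 0 # b @ [ISub t (t+1) (t+2)]"
    by (simp add: a_def b_def Let_def)
  have "corr P H (3 + time N f + time N g) p t r (Suc (p + 2 + length a + length b)) (VN (m - n))"
    by (rule binop_correct[OF ev_Sub.IH a_def b_def ev_Sub.prems(1)[unfolded c] _ _ _ ev_Sub.prems(4,5), where bop = "(-)"])
      (use ev_Sub.prems(2,3) in auto)
  then show ?case unfolding c by (simp add: add_ac)
next
  case (ev_If0 c u g w f)
  define a where "a = compile (Suc p) (t+1) c"
  define b where "b = compile (p + 2 + length a) t f"
  define q where "q = p + 3 + length a + length b"
  define d where "d = compile q t g"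
  have code: "code_at P p (IAdd (t+1) t 0 # a @ IJz (t+1) q # b @ IJz 0 (q + length d) # d)"
    using ev_If0.prems(1) by (simp add: a_def b_def d_def q_def Let_def)
  define r1 where "r1 = r(t+1 := r t)"
  have r1t: "r1 (t+1) = r t" by (simp add: r1_def)
  have s1: "step P (p, r) = (Suc p, r1)" using code ev_If0.prems by (simp add: good_def r1_def)
  have h1: "hext H t r r1" unfolding r1_def using ev_If0.prems by (intro hext_upd) auto
  have "corr P H (time N c) (Suc p) (t+1) r1 (Suc p + length (compile (Suc p) (t+1) c)) (VN 0)"
    using code ev_If0.prems rep_hext[OF h1] good_hext[OF _ h1] r1t by (intro ev_If0.IH) (auto simp: a_def)
  then obtain r2 where r2: "reach P (time N c) (Suc p, r1) (Suc p + length a, r2)"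
    "hext H (t+1) r1 r2" "r2 (t+1) = 0" unfolding corr_def a_def by auto
  have r2t: "r2 t = r t" using r2(2) ev_If0.prems by (auto simp: hext_def r1_def)
  have h2: "hext H t r r2" using hext_trans[OF h1 r2(2)] by simp
  have s2: "step P (Suc p + length a, r2) = (q, r2)" using code r2(3) by simp
  have qe: "q = Suc (Suc (Suc (p + length a + length b)))" by (simp add: q_def)
  have "code_at P q d" using code qe by simp
  then have cg: "code_at P q (compile q t g)" by (simp add: d_def)
  have "corr P H (time N g) q t r2 (q + length (compile q t g)) w"
    by (rule ev_If0.IH(2)[OF cg]) (use ev_If0.prems rep_hext[OF h2] good_hext[OF _ h2] r2t in simp_all)
  then obtain r3 where r3: "reach P (time N g) (q, r2) (q + length d, r3)"
    "hext H t r2 r3" "rep H r3 w (r3 t)" unfolding corr_def d_def by blast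
  have "reach P (Suc (time N c + Suc (time N g))) (p, r) (q + length d, r3)"
    by (rule reach_Suc[OF s1 reach_trans[OF r2(1) reach_Suc[OF s2 r3(1)]]])
  then have "reach P (time N (FIf c f g)) (p, r) (q + length d, r3)" by (rule reach_mono) simp
  moreover have "p + length (compile p t (FIf c f g)) = q + length d"
    unfolding compile.simps Let_def a_def[symmetric] b_def[symmetric] q_def[symmetric] d_def[symmetric]
    by (simp add: q_def)
  ultimately show ?case unfolding corr_def using r3 hext_trans[OF h2 r3(2)]
    by (intro exI[of _ r3]) simp
next
  case (ev_If1 c u v f w g)
  define a where "a = compile (Suc p) (t+1) c"
  define b where "b = compile (p + 2 + length a) t f"
  define q where "q = p + 3 + length a + length b"
  define d where "d = compile q t g"
  have code: "code_at P p (IAdd (t+1) t 0 # a @ IJz (t+1) q # b @ IJz 0 (q + length d) # d)"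
    using ev_If1.prems(1) by (simp add: a_def b_def d_def q_def Let_def)
  define r1 where "r1 = r(t+1 := r t)"
  have r1t: "r1 (t+1) = r t" by (simp add: r1_def)
  have s1: "step P (p, r) = (Suc p, r1)" using code ev_If1.prems by (simp add: good_def r1_def)
  have h1: "hext H t r r1" unfolding r1_def using ev_If1.prems by (intro hext_upd) auto
  have "corr P H (time N c) (Suc p) (t+1) r1 (Suc p + length (compile (Suc p) (t+1) c)) v"
    using code ev_If1.prems rep_hext[OF h1] good_hext[OF _ h1] r1t by (intro ev_If1.IH) (auto simp: a_def)
  then obtain r2 where r2: "reach P (time N c) (Suc p, r1) (Suc p + length a, r2)"
    "hext H (t+1) r1 r2" "rep H r2 v (r2 (t+1))" unfolding corr_def a_def by auto
  have nz: "r2 (t+1) \<noteq> 0" using r2(3) ev_If1.hyps ev_If1.prems by (cases v) auto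
  have r2t: "r2 t = r t" using r2(2) ev_If1.prems by (auto simp: hext_def r1_def)
  have h2: "hext H t r r2" using hext_trans[OF h1 r2(2)] by simp
  have s2: "step P (Suc p + length a, r2) = (p + 2 + length a, r2)" using code nz by simp
  have cf: "code_at P (p + 2 + length a) (compile (p + 2 + length a) t f)" using code by (simp add: b_def)
  have "corr P H (time N f) (p + 2 + length a) t r2 (p + 2 + length a + length (compile (p + 2 + length a) t f)) w"
    by (rule ev_If1.IH(2)[OF cf]) (use ev_If1.prems rep_hext[OF h2] good_hext[OF _ h2] r2t in simp_all)
  then obtain r3 where r3: "reach P (time N f) (p + 2 + length a, r2) (p + 2 + length a + length b, r3)"
    "hext H t r2 r3" "rep H r3 w (r3 t)" unfolding corr_def b_def by blast
  have h3: "hext H t r r3" by (rule hext_trans[OF h2 r3(2)]) simp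
  have "r3 0 = 0" using good_hext[OF _ h3] ev_If1.prems by (simp add: good_def)
  then have s3: "step P (p + 2 + length a + length b, r3) = (q + length d, r3)"
    using code by (simp add: add_ac)
  have "reach P (Suc (time N c + Suc (time N f + 1))) (p, r) (q + length d, r3)"
    unfolding One_nat_def
    by (rule reach_Suc[OF s1 reach_trans[OF r2(1) reach_Suc[OF s2 reach_trans[OF r3(1) reach_Suc[OF s3 reach_refl]]]]])
  then have "reach P (time N (FIf c f g)) (p, r) (q + length d, r3)" by (rule reach_mono) simp
  moreover have "p + length (compile p t (FIf c f g)) = q + length d"
    unfolding compile.simps Let_def a_def[symmetric] b_def[symmetric] q_def[symmetric] d_def[symmetric]
    by (simp add: q_def)
  ultimately show ?case unfolding corr_def using r3 h3
    by (intro exI[of _ r3]) simp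
next
  case (ev_Iter f X)
  define a where "a = compile (p + 3) (t+1) f"
  have code: "code_at P p (IAdd (t+1) t 0 # IAdd t 3 0 # IJz t (p + 5 + length a) # a @
     [ISub t t 1, IJz 0 (p + 2), IAdd t (t+1) 0])"
    using ev_Iter.prems(1) by (simp add: a_def Let_def)
  define r1 where "r1 = r(t+1 := r t)"
  define r2 where "r2 = r1(t := N)"
  have s1: "step P (p, r) = (Suc p, r1)" using code ev_Iter.prems by (simp add: good_def r1_def)
  have s2: "step P (Suc p, r1) = (p + 2, r2)" using code ev_Iter.prems by (simp add: good_def r1_def r2_def)
  have h2: "hext H t r r2" using ev_Iter.prems by (auto simp: hext_def r1_def r2_def)
  \<comment> \<open>Register \<open>t\<close> counts down and \<open>t+1\<close> carries the current
    value; test, decrement and jump cost 3 steps per round.\<close>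
  have loop: "i \<le> N \<Longrightarrow> \<exists>r'. reach P (i * (3 + time N f)) (p + 2, r2) (p + 2, r') \<and> hext H t r r' \<and>
     rep H r' (X i) (r' (t+1)) \<and> r' t = N - i" for i
  proof (induction i)
    case 0
    have "r2 (t+1) = r t" "r2 t = N" by (simp_all add: r1_def r2_def)
    then show ?case using h2 rep_hext[OF h2 ev_Iter.prems(5)]
      by (intro exI[of _ r2]) (simp add: reach_refl)
  next
    case (Suc i)
    then obtain r' where r': "reach P (i * (3 + time N f)) (p + 2, r2) (p + 2, r')" "hext H t r r'"
     "rep H r' (X i) (r' (t+1))" "r' t = N - i" by auto
    have g': "good H N r'" using good_hext[OF _ r'(2)] ev_Iter.prems by auto
    have sa: "step P (p + 2, r') = (p + 3, r')" using code r'(4) Suc.prems by (simp add: numeral_3_eq_3)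
    have "corr P H (time N f) (p + 3) (t+1) r' (p + 3 + length (compile (p + 3) (t+1) f)) (X (Suc i))"
      using code ev_Iter.prems r' g' Suc.prems
      by (intro ev_Iter.IH) (auto simp: a_def numeral_3_eq_3)
    then obtain r3 where r3: "reach P (time N f) (p + 3, r') (p + 3 + length a, r3)"
      "hext H (t+1) r' r3" "rep H r3 (X (Suc i)) (r3 (t+1))" unfolding corr_def a_def by blast
    have h3: "hext H t r r3" using hext_trans[OF r'(2) r3(2)] by simp
    have g3: "good H N r3" using good_hext[OF _ h3] ev_Iter.prems by auto
    have r3t: "r3 t = N - i" using r3(2) r'(4) ev_Iter.prems by (auto simp: hext_def)
    define r4 where "r4 = r3(t := N - Suc i)"
    have sb: "step P (p + 3 + length a, r3) = (p + 4 + length a, r4)"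
      using code g3 r3t by (simp add: good_def r4_def numeral_eq_Suc)
    have sc: "step P (p + 4 + length a, r4) = (p + 2, r4)"
      using code g3 ev_Iter.prems(2) by (simp add: good_def r4_def numeral_eq_Suc)
    have h4: "hext H t r3 r4" unfolding r4_def using ev_Iter.prems by (intro hext_upd) auto
    have "reach P (i * (3 + time N f) + Suc (time N f + Suc (Suc 0))) (p + 2, r2) (p + 2, r4)"
      by (rule reach_trans[OF r'(1) reach_Suc[OF sa reach_trans[OF r3(1) reach_Suc[OF sb reach_Suc[OF sc reach_refl]]]]])
    then have "reach P (Suc i * (3 + time N f)) (p + 2, r2) (p + 2, r4)" by (rule reach_mono) simp
    moreover have "r4 (t+1) = r3 (t+1)" "r4 t = N - Suc i" by (simp_all add: r4_def)
    ultimately show ?case using hext_trans[OF h3 h4] rep_hext[OF h4 r3(3)]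
      by (intro exI[of _ r4]) simp
  qed
  from loop[of N] obtain r3 where r3: "reach P (N * (3 + time N f)) (p + 2, r2) (p + 2, r3)" "hext H t r r3"
     "rep H r3 (X N) (r3 (t+1))" "r3 t = 0" by auto
  have g3: "good H N r3" using good_hext[OF _ r3(2)] ev_Iter.prems by auto
  define r4 where "r4 = r3(t := r3 (t + 1))"
  have r4t: "r4 t = r3 (t + 1)" by (simp add: r4_def)
  have sd: "step P (p + 2, r3) = (p + 5 + length a, r3)" using code r3(4) by simp
  have se: "step P (p + 5 + length a, r3) = (p + 6 + length a, r4)"
    using code g3 by (simp add: good_def r4_def numeral_eq_Suc)
  have h4: "hext H t r3 r4" unfolding r4_def using ev_Iter.prems by (intro hext_upd) auto
  have "reach P (Suc (Suc (N * (3 + time N f) + Suc (Suc 0)))) (p, r) (p + 6 + length a, r4)"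
    by (rule reach_Suc[OF s1 reach_Suc[OF s2 reach_trans[OF r3(1) reach_Suc[OF sd reach_Suc[OF se reach_refl]]]]])
  then have "reach P (time N (FIter f)) (p, r) (p + 6 + length a, r4)" by (rule reach_mono) simp
  moreover have "p + length (compile p t (FIter f)) = p + 6 + length a"
    unfolding compile.simps Let_def a_def[symmetric] by simp
  ultimately show ?case unfolding corr_def using hext_trans[OF r3(2) h4] rep_hext[OF h4 r3(3)]
    by (intro exI[of _ r4]) (simp add: r4t add.assoc)
qed

section \<open>Data types as values\<close>

class valued = fixes tov :: "'a \<Rightarrow> val"

instantiation nat :: valued begin
definition tov_nat :: "nat \<Rightarrow> val" where "tov_nat n = VN n"
instance ..
end

instantiation bool :: valued begin
definition tov_bool :: "bool \<Rightarrow> val" where "tov_bool b = VN (if b then 1 else 0)"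
instance ..
end

instantiation prod :: (valued, valued) valued begin
definition tov_prod :: "'a \<times> 'b \<Rightarrow> val" where "tov_prod p = VP (tov (fst p)) (tov (snd p))"
instance ..
end

instantiation list :: (valued) valued begin
primrec tov_list :: "'a list \<Rightarrow> val" where
  "tov_list [] = VN 0"
| "tov_list (x # xs) = VP (tov x) (tov_list xs)"
instance ..
end

section \<open>Straight-line code and loading the input\<close>

fun instr_effect :: "instr \<Rightarrow> (nat \<Rightarrow> nat) \<Rightarrow> nat \<Rightarrow> nat" where
  "instr_effect (IConst a v) r = r(a := v)"
| "instr_effect (IAdd a b c) r = r(a := r b + r c)"
| "instr_effect (ISub a b c) r = r(a := r b - r c)"
| "instr_effect (ILoad a b) r = r(a := r (r b))"
| "instr_effect (IStore a b) r = r(r a := r b)"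
| "instr_effect (IJz a l) r = r"

fun is_jump :: "instr \<Rightarrow> bool" where
  "is_jump (IJz a l) = True"
| "is_jump _ = False"

lemma reach_straight:
  "code_at P p c \<Longrightarrow> \<forall>i\<in>set c. \<not> is_jump i \<Longrightarrow>
   reach P (length c) (p, r) (p + length c, fold instr_effect c r)"
proof (induction c arbitrary: p r)
  case Nil then show ?case by (simp add: reach_refl)
next
  case (Cons i c)
  have "step P (p, r) = (Suc p, instr_effect i r)" using Cons.prems by (cases i) auto
  moreover have "reach P (length c) (Suc p, instr_effect i r) (Suc p + length c, fold instr_effect c (instr_effect i r))"
    using Cons.IH[of "Suc p" "instr_effect i r"] Cons.prems by simp
  ultimately show ?case using reach_Suc by fastforce
qed

lemma reach_straightI:
  "code_at P p c \<Longrightarrow> fold instr_effect c r = r' \<Longrightarrow> \<forall>i\<in>set c. \<not> is_jump i \<Longrightarrow> k = length c \<Longrightarrow> q = p + length c \<Longrightarrow>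
   reach P k (p, r) (q, r')"
  using reach_straight by blast

lemma reach_jz: "code_at P p [IJz a l] \<Longrightarrow> reach P 1 (p, r) (if r a = 0 then l else Suc p, r)"
  using reach_Suc[OF _ reach_refl, of P "(p, r)" "(if r a = 0 then l else Suc p, r)" 0] by auto

lemma reach_jz0: "code_at P p [IJz a l] \<Longrightarrow> r a = 0 \<Longrightarrow> reach P 1 (p, r) (l, r)"
  using reach_jz[of P p a l r] by simp

lemma reach_jz1: "code_at P p [IJz a l] \<Longrightarrow> r a \<noteq> 0 \<Longrightarrow> q = Suc p \<Longrightarrow> reach P 1 (p, r) (q, r)"
  using reach_jz[of P p a l r] by simp

text \<open>The input occupies all low registers, but register 4 holds the constant \<open>z\<close> and may be
  overwritten.  This gives one free register, with which registers 1 to 9 are saved behind the input;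
  the input then appears rotated by 9.\<close>

definition save_block :: "nat \<Rightarrow> nat \<Rightarrow> instr list" where
  "save_block z B = [IConst 4 1, IAdd 0 0 4, IStore 0 1, IAdd 0 0 4, IStore 0 2, IAdd 0 0 4, IStore 0 3,
     IAdd 0 0 4, IConst 4 z, IStore 0 4, IConst 4 1, IAdd 0 0 4, IStore 0 5, IAdd 0 0 4, IStore 0 6,
     IAdd 0 0 4, IStore 0 7, IAdd 0 0 4, IStore 0 8, IAdd 0 0 4, IStore 0 9,
     IConst 1 1, IConst 6 9, ISub 3 0 6, ILoad 5 3, IAdd 3 3 5, IConst 5 (B + 1), IAdd 2 0 5,
     IConst 4 0, IConst 7 0, IConst 8 0]"

text \<open>Register 0 walks down the saved input, so consing onto the list in register 4 keeps the
  order. Register 7 accumulates the sum whose bit length enters \<open>N\<close>.\<close>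

definition push_body :: "instr list" where
  "push_body = [ILoad 5 0, IAdd 7 7 5, IStore 2 5, IAdd 2 2 1, IStore 2 4, ISub 4 2 1, IAdd 2 2 1, ISub 0 0 1]"

text \<open>\<open>IJz 8\<close> serves as an unconditional jump: register 8 is 0, whereas register
  0 is still the read position. The loop at 31 ends when that position is 9, just below the rotated
  input. The loop at 44 doubles register 5 until it exceeds the sum and increments register 3 each
  time, which adds the bit length to \<open>N\<close>.\<close>

definition prologue :: "nat \<Rightarrow> nat \<Rightarrow> instr list" where
  "prologue z B = save_block z B @ [ISub 5 0 6] @ [IJz 5 42] @ push_body @ [IJz 8 31] @
     [IConst 5 1, IAdd 7 7 1] @ [ISub 9 7 5] @ [IJz 9 49] @ [IAdd 5 5 5, IAdd 3 3 1] @ [IJz 8 44] @ [IConst 0 0]"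

text \<open>The output is written from its end to its beginning, since its first entries overwrite the
  registers in use; therefore the compiled program delivers it reversed, with the length placed
  before the first entry.\<close>

definition epilogue :: "nat \<Rightarrow> instr list" where
  "epilogue p = [ILoad 3 4, IAdd 4 4 1, ILoad 2 4, IConst 5 5] @ [ISub 4 3 5, IJz 4 (p + 12)] @
     [ILoad 4 2, IStore 3 4, IAdd 2 2 1, ILoad 2 2, ISub 3 3 1] @ [IJz 0 (p + 4)] @
     [IAdd 0 2 0, ILoad 5 0, IAdd 0 0 1, ILoad 0 0, ILoad 4 0, IAdd 0 0 1, ILoad 0 0,
      ILoad 3 0, IAdd 0 0 1, ILoad 0 0, ILoad 2 0, IAdd 0 0 1, ILoad 0 0,
      IAdd 1 0 1, ILoad 1 1, ILoad 1 1, ILoad 0 0]"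

lemma length_prologue: "length (prologue z B) = 50"
  by (simp add: prologue_def save_block_def push_body_def)

lemma save_block_effect:
  assumes L: "10 \<le> length xs" and z: "xs ! 3 = z"
    and r: "r = fold instr_effect (save_block z B) (snd (init_conf xs))"
  defines "ys \<equiv> drop 9 xs @ take 9 xs"
  shows "r 0 = length xs + 9" "r 1 = 1" "r 2 = length xs + 10 + B" "r 3 = length xs + last xs"
    "r 4 = 0" "r 6 = 9" "r 7 = 0" "r 8 = 0"
    "\<forall>a. 10 \<le> a \<and> a < length xs + 10 \<longrightarrow> r a = ys ! (a - 10)"
proof -
  define L where "L = length xs"
  define m where "m = snd (init_conf xs)"
  have L10: "10 \<le> L" using L by (simp add: L_def)
  have m0: "m 0 = L" by (simp add: m_def init_conf_def L_def)
  have mi: "m i = xs ! (i - 1)" if "1 \<le> i" "i \<le> L" for i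
    using that by (simp add: m_def init_conf_def L_def)
  have "xs \<noteq> []" using L by auto
  then have last: "m L = last xs" using mi[of L] L10 by (simp add: last_conv_nth L_def)
  define J where "J k r \<longleftrightarrow> r 0 = L + k \<and> r 4 = 1 \<and> (\<forall>i. 1 \<le> i \<and> i \<le> k \<longrightarrow> r (L + i) = xs ! (i - 1)) \<and>
     (\<forall>i. i \<noteq> 0 \<and> i \<noteq> 4 \<and> i \<le> L \<longrightarrow> r i = xs ! (i - 1))" for k and r :: "nat \<Rightarrow> nat"
  have J0: "J 0 (fold instr_effect [IConst 4 1] m)" using mi m0 by (auto simp: J_def)
  have JS: "J (Suc k) (fold instr_effect [IAdd 0 0 4, IStore 0 (Suc k)] r)" if "J k r" "k < 9" "k \<noteq> 3" for k r
    using that L10 by (auto simp: J_def le_Suc_eq)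
  \<comment> \<open>Register 4 has been overwritten by the increment 1; its entry is known to be
    \<open>z\<close> and is supplied as a constant.\<close>
  have J4: "J 4 (fold instr_effect [IAdd 0 0 4, IConst 4 z, IStore 0 4, IConst 4 1] r)" if "J 3 r" for r
  proof -
    have "i \<le> 3 \<or> i = 4" if "i \<le> 4" for i :: nat using that by linarith
    then show ?thesis using that L10 z by (auto simp: J_def)
  qed
  \<comment> \<open>As L \<ge> 10, cell L still holds its input entry, so \<open>ILoad 5 3\<close>
    fetches the last input number and register 3 becomes L plus that number.\<close>
  define c2 where "c2 = [IConst 1 1, IConst 6 9, ISub 3 0 6, ILoad 5 3, IAdd 3 3 5, IConst 5 (B + 1), IAdd 2 0 5,
     IConst 4 0, IConst 7 0, IConst 8 0]"
  define r1 where "r1 = fold instr_effect [IAdd 0 0 4, IStore 0 9] (fold instr_effect [IAdd 0 0 4, IStore 0 8]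
     (fold instr_effect [IAdd 0 0 4, IStore 0 7] (fold instr_effect [IAdd 0 0 4, IStore 0 6]
     (fold instr_effect [IAdd 0 0 4, IStore 0 5] (fold instr_effect [IAdd 0 0 4, IConst 4 z, IStore 0 4, IConst 4 1]
     (fold instr_effect [IAdd 0 0 4, IStore 0 3] (fold instr_effect [IAdd 0 0 4, IStore 0 2]
     (fold instr_effect [IAdd 0 0 4, IStore 0 1] (fold instr_effect [IConst 4 1] m)))))))))"
  have rr: "r = fold instr_effect c2 r1"
    unfolding r r1_def c2_def save_block_def m_def by (simp only: fold_simps)
  have "J 9 r1" unfolding r1_def
    using JS[of 0] JS[of 1] JS[of 2] J4 JS[of 4] JS[of 5] JS[of 6] JS[of 7] JS[of 8] J0
    by (simp add: numeral_eq_Suc del: fold_simps instr_effect.simps)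
  then have r10: "r1 0 = L + 9" and r1i: "\<And>i. 1 \<le> i \<Longrightarrow> i \<le> 9 \<Longrightarrow> r1 (L + i) = xs ! (i - 1)"
    and r1l: "\<And>i. 10 \<le> i \<Longrightarrow> i \<le> L \<Longrightarrow> r1 i = xs ! (i - 1)" by (auto simp: J_def)
  have r1L: "r1 L = last xs" using r1l[of L] mi[of L] last L10 by simp
  have re: "r = r1(1 := 1, 6 := 9, 3 := L + last xs, 5 := B + 1, 2 := L + 10 + B, 4 := 0, 7 := 0, 8 := 0)"
    unfolding rr c2_def using L10 r1L r10 by (auto simp: fun_eq_iff)
  show "r 0 = length xs + 9" "r 1 = 1" "r 2 = length xs + 10 + B" "r 3 = length xs + last xs"
    "r 4 = 0" "r 6 = 9" "r 7 = 0" "r 8 = 0" using r10 by (simp_all add: re L_def)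
  show "\<forall>a. 10 \<le> a \<and> a < length xs + 10 \<longrightarrow> r a = ys ! (a - 10)"
  proof (intro allI impI)
    fix a assume a: "10 \<le> a \<and> a < length xs + 10"
    have ra: "r a = r1 a" using a by (simp add: re)
    show "r a = ys ! (a - 10)"
    proof (cases "a \<le> L")
      case True
      moreover have "ys ! (a - 10) = xs ! (a - 1)" using a True L10
        by (simp add: ys_def nth_append L_def)
      ultimately show ?thesis using ra r1l[of a] a by simp
    next
      case False
      define i where "i = a - L"
      have i: "a = L + i" "1 \<le> i" "i \<le> 9" using False a by (auto simp: i_def L_def)
      have "ys ! (a - 10) = xs ! (i - 1)" using i L10 by (auto simp: ys_def nth_append L_def)
      then show ?thesis using ra r1i[of i] i by simp
    qed
  qed
qed

lemma bitlen_gt: "x < 2 ^ bitlen x"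
  unfolding bitlen_def by (rule LeastI[of _ x]) (rule less_exp)

lemma bitlen_le: "x < 2 ^ m \<Longrightarrow> bitlen x \<le> m"
  unfolding bitlen_def by (rule Least_le)

lemma not_bitlen: "i < bitlen x \<Longrightarrow> 2 ^ i \<le> x"
  unfolding bitlen_def using not_less_Least by fastforce

lemma prologue_correct:
  fixes xs :: "nat list"
  assumes L: "10 \<le> length xs" and z: "xs ! 3 = z" and code: "code_at P 0 (prologue z B)"
  defines "ys \<equiv> drop 9 xs @ take 9 xs" and "H \<equiv> length xs + 10 + B"
    and "N \<equiv> length xs + last xs + bitlen (sum_list xs)"
  shows "\<exists>r. reach P (36 + 16 * N) (init_conf xs) (50, r) \<and> good H N r \<and> rep H r (tov ys) (r 4)"
proof -
  define L where "L = length xs"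
  have len: "length ys = L" using L by (simp add: ys_def L_def)
  have sum: "sum_list ys = sum_list xs"
    unfolding ys_def sum_list_append by (metis add.commute append_take_drop_id sum_list_append)
  have lens: "length (save_block z B) = 31" "length push_body = 8"
    by (simp_all add: save_block_def push_body_def)
  have code0: "code_at P 0 (save_block z B)" and code1: "code_at P 31 [ISub 5 0 6]" "code_at P 32 [IJz 5 42]"
    "code_at P 33 push_body" "code_at P 41 [IJz 8 31]" and code2: "code_at P 42 [IConst 5 1, IAdd 7 7 1]"
    "code_at P 44 [ISub 9 7 5]" "code_at P 45 [IJz 9 49]" "code_at P 46 [IAdd 5 5 5, IAdd 3 3 1]"
    "code_at P 48 [IJz 8 44]" "code_at P 49 [IConst 0 0]"
    using code unfolding prologue_def code_at_append by (simp_all add: lens del: code_at_Cons)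
  define r0 where "r0 = fold instr_effect (save_block z B) (snd (init_conf xs))"
  note eff = save_block_effect[OF L z r0_def, folded ys_def L_def H_def]
  have nj: "\<forall>i\<in>set (save_block z B). \<not> is_jump i" by (simp add: save_block_def)
  have "reach P (length (save_block z B)) (0, snd (init_conf xs)) (0 + length (save_block z B), r0)"
    unfolding r0_def by (rule reach_straight[OF code0 nj])
  moreover have "(0, snd (init_conf xs)) = init_conf xs" by (simp add: init_conf_def)
  ultimately have start: "reach P 31 (init_conf xs) (31, r0)" by (simp add: lens)
  have loop1: "i \<le> L \<Longrightarrow> \<exists>r. reach P (i * 11) (31, r0) (31, r) \<and> r 0 = L + 9 - i \<and> r 1 = 1 \<and> r 2 = H + 2 * i \<and>
     r 3 = L + last xs \<and> r 6 = 9 \<and> r 7 = sum_list (drop (L - i) ys) \<and> r 8 = 0 \<and>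
     rep H r (tov (drop (L - i) ys)) (r 4) \<and> (\<forall>a. 10 \<le> a \<and> a < L + 10 \<longrightarrow> r a = ys ! (a - 10))" for i
  proof (induction i)
    case 0
    then show ?case using eff len by (intro exI[of _ r0]) (simp add: reach_refl)
  next
    case (Suc i)
    then obtain r where r: "reach P (i * 11) (31, r0) (31, r)" "r 0 = L + 9 - i" "r 1 = 1" "r 2 = H + 2 * i"
     "r 3 = L + last xs" "r 6 = 9" "r 7 = sum_list (drop (L - i) ys)" "r 8 = 0"
     "rep H r (tov (drop (L - i) ys)) (r 4)" "\<forall>a. 10 \<le> a \<and> a < L + 10 \<longrightarrow> r a = ys ! (a - 10)" by auto
    define x where "x = ys ! (L - Suc i)"
    have dr: "drop (L - Suc i) ys = x # drop (L - i) ys"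
      using Suc.prems len by (simp add: x_def Suc_diff_Suc Cons_nth_drop_Suc[symmetric])
    have "L + 9 - i - 10 = L - Suc i" by simp
    moreover have "10 \<le> L + 9 - i" "L + 9 - i < L + 10" using Suc.prems by linarith+
    ultimately have rx: "r (L + 9 - i) = x" using r(10)[rule_format, of "L + 9 - i"] by (simp add: x_def)
    define r1 where "r1 = r(5 := L - i)"
    have e1: "reach P 1 (31, r) (32, r1)" using reach_straight[OF code1(1), of r] r(2,6) Suc.prems
      by (simp add: r1_def)
    have e2: "reach P 1 (32, r1) (33, r1)" using reach_jz[OF code1(2), of r1] Suc.prems by (simp add: r1_def)
    define r2 where "r2 = r(5 := x, 7 := r 7 + x, H + 2*i := x, Suc (H + 2*i) := r 4, 4 := H + 2*i,
         2 := H + 2 * Suc i, 0 := L + 8 - i)"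
    have H10: "20 \<le> H" "L + 10 \<le> H" using L by (auto simp: H_def L_def)
    define h where "h = H + 2*i"
    define b where "b = L + 9 - i"
    have ne: "h \<noteq> 0" "h \<noteq> 1" "h \<noteq> 2" "h \<noteq> 4" "h \<noteq> 5" "h \<noteq> 7" "Suc h \<noteq> 2" "Suc h \<noteq> 4"  "Suc h \<noteq> 5" "Suc h \<noteq> 7" "b \<noteq> 5"
      "Suc h \<noteq> 1"
      using H10 Suc.prems by (auto simp: h_def b_def)
    have vals: "r 0 = b" "r 1 = 1" "r 2 = h" "r b = x" using r(2,3,4) rx by (auto simp: h_def b_def)
    have "fold instr_effect push_body r1 = r(5 := x, 7 := r 7 + x, h := x, 2 := Suc h, Suc h := r 4, 4 := h,
         2 := Suc (Suc h), 0 := b - 1)"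
      unfolding push_body_def r1_def using ne vals by (simp add: fun_upd_twist[of 5])
    also have "\<dots> = r2" unfolding r2_def h_def[symmetric] using ne
      by (rule_tac ext) (simp add: h_def b_def add.commute)
    finally have "fold instr_effect push_body r1 = r2" .
    then have e3: "reach P 8 (33, r1) (41, r2)"
      by (rule reach_straightI[OF code1(3)]) (simp_all add: push_body_def)
    have r2v: "r2 8 = 0" using r(8) H10 by (simp add: r2_def)
    have e4: "reach P 1 (41, r2) (31, r2)" using reach_jz[OF code1(4), of r2] r2v by simp
    have "reach P (i * 11 + (1 + (1 + (8 + 1)))) (31, r0) (31, r2)"
      by (rule reach_trans[OF r(1) reach_trans[OF e1 reach_trans[OF e2 reach_trans[OF e3 e4]]]])
    then have e: "reach P (Suc i * 11) (31, r0) (31, r2)" by (simp add: add.commute)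
    have hx: "hext H 0 r r2" using H10 r(4) by (auto simp: hext_def r2_def)
    have rp: "rep H r2 (tov (drop (L - i) ys)) (r 4)" by (rule rep_hext[OF hx r(9)])
    have "rep H r2 (tov (drop (L - Suc i) ys)) (r2 4)" unfolding dr using rp H10
      by (auto simp: r2_def tov_nat_def)
    moreover have "r2 0 = L + 9 - Suc i" using Suc.prems by (simp add: r2_def)
    moreover have "r2 7 = sum_list (drop (L - Suc i) ys)" unfolding dr using r(7) H10 by (simp add: r2_def)
    moreover have "r2 1 = 1" "r2 2 = H + 2 * Suc i" "r2 3 = L + last xs" "r2 6 = 9" "r2 8 = 0"
      using r H10 by (auto simp: r2_def)
    moreover have "r2 a = ys ! (a - 10)" if "10 \<le> a \<and> a < L + 10" for a
      using r(10) H10 that by (auto simp: r2_def)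
    ultimately show ?case using e by blast
  qed
  from loop1[of L] obtain r where r: "reach P (L * 11) (31, r0) (31, r)" "r 0 = 9" "r 1 = 1" "r 2 = H + 2 * L"
     "r 3 = L + last xs" "r 6 = 9" "r 7 = sum_list xs" "r 8 = 0" "rep H r (tov ys) (r 4)"
    by (auto simp: sum)
  define S where "S = sum_list xs"
  have H10: "20 \<le> H" using L by (auto simp: H_def)
  define r1 where "r1 = r(5 := 0)"
  have f1: "reach P 1 (31, r) (32, r1)" using reach_straight[OF code1(1), of r] r(2,6) by (simp add: r1_def)
  have f2: "reach P 1 (32, r1) (42, r1)" using reach_jz[OF code1(2), of r1] by (simp add: r1_def)
  define r2 where "r2 = r1(5 := 1, 7 := S + 1)"
  have f3: "reach P 2 (42, r1) (44, r2)" using reach_straight[OF code2(1), of r1] r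
    by (simp add: r2_def r1_def S_def numeral_2_eq_2)
  have loop2: "i \<le> bitlen S \<Longrightarrow> \<exists>q. reach P (i * 5) (44, r2) (44, r2(3 := L + last xs + i, 5 := 2 ^ i, 9 := q))" for i
  proof (induction i)
    case 0
    have "r2 = r2(3 := L + last xs + 0, 5 := 2 ^ 0, 9 := r2 9)" using r by (auto simp: fun_eq_iff r2_def r1_def)
    then show ?case by (metis reach_refl)
  next
    case (Suc i)
    then obtain q where q: "reach P (i * 5) (44, r2) (44, r2(3 := L + last xs + i, 5 := 2 ^ i, 9 := q))"
      using Suc_leD by blast
    let ?r = "r2(3 := L + last xs + i, 5 := 2 ^ i, 9 := q)"
    let ?r1 = "r2(3 := L + last xs + i, 5 := 2 ^ i, 9 := S + 1 - 2 ^ i)"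
    let ?r2 = "r2(3 := L + last xs + Suc i, 5 := 2 ^ Suc i, 9 := S + 1 - 2 ^ i)"
    have pos: "S + 1 - 2 ^ i \<noteq> 0" using not_bitlen[of i S] Suc.prems by simp
    have r27: "r2 7 = S + 1" "r2 8 = 0" "r2 1 = 1" using r by (auto simp: r2_def r1_def)
    have g1: "reach P 1 (44, ?r) (45, ?r1)" using reach_straight[OF code2(2), of ?r] r27 by simp
    have g2: "reach P 1 (45, ?r1) (46, ?r1)" using reach_jz[OF code2(3), of ?r1] pos by simp
    have "fold instr_effect [IAdd 5 5 5, IAdd 3 3 1] ?r1 = ?r2" using r27 by (auto simp: fun_eq_iff)
    then have g3: "reach P 2 (46, ?r1) (48, ?r2)" by (rule reach_straightI[OF code2(4)]) simp_all
    have g4: "reach P 1 (48, ?r2) (44, ?r2)" using reach_jz[OF code2(5), of ?r2] r27 by simp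
    have "reach P (i * 5 + (1 + (1 + (2 + 1)))) (44, r2) (44, ?r2)"
      by (rule reach_trans[OF q reach_trans[OF g1 reach_trans[OF g2 reach_trans[OF g3 g4]]]])
    moreover have "i * 5 + (1 + (1 + (2 + 1))) = Suc i * 5" by simp
    ultimately have "reach P (Suc i * 5) (44, r2) (44, ?r2)" by (simp only:)
    then show ?case by blast
  qed
  from loop2[of "bitlen S"] obtain q where
    q: "reach P (bitlen S * 5) (44, r2) (44, r2(3 := N, 5 := 2 ^ bitlen S, 9 := q))"
    unfolding N_def S_def L_def by blast
  let ?r = "r2(3 := N, 5 := 2 ^ bitlen S, 9 := q)"
  let ?r3 = "r2(3 := N, 5 := 2 ^ bitlen S, 9 := 0)"
  have r27: "r2 7 = S + 1" "r2 8 = 0" "r2 1 = 1" using r by (auto simp: r2_def r1_def)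
  have g1: "reach P 1 (44, ?r) (45, ?r3)" using reach_straight[OF code2(2), of ?r] r27 bitlen_gt[of S] by simp
  have g2: "reach P 1 (45, ?r3) (49, ?r3)" using reach_jz[OF code2(3), of ?r3] by simp
  have g3: "reach P 1 (49, ?r3) (50, ?r3(0 := 0))" using reach_straight[OF code2(6), of ?r3] by simp
  have "reach P (31 + (L * 11 + (1 + (1 + (2 + (bitlen S * 5 + (1 + (1 + 1)))))))) (init_conf xs) (50, ?r3(0 := 0))"
    by (rule reach_trans[OF start reach_trans[OF r(1) reach_trans[OF f1 reach_trans[OF f2 reach_trans[OF f3 
          reach_trans[OF q reach_trans[OF g1 reach_trans[OF g2 g3]]]]]]]])
  then have "reach P (36 + 16 * N) (init_conf xs) (50, ?r3(0 := 0))"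
    by (rule reach_mono) (use L in \<open>auto simp: N_def L_def S_def\<close>)
  moreover have "good H N (?r3(0 := 0))" using r by (simp add: good_def r2_def r1_def)
  moreover have "hext H 0 r (?r3(0 := 0))" using H10 by (auto simp: hext_def r2_def r1_def)
  then have "rep H (?r3(0 := 0)) (tov ys) (r 4)" by (rule rep_hext[OF _ r(9)])
  then have "rep H (?r3(0 := 0)) (tov ys) ((?r3(0 := 0)) 4)" by (simp add: r2_def r1_def)
  ultimately show ?thesis by blast
qed

section \<open>Writing the output\<close>

fun cells :: "nat \<Rightarrow> (nat \<Rightarrow> nat) \<Rightarrow> nat list \<Rightarrow> nat \<Rightarrow> bool" where
  "cells H r [] p \<longleftrightarrow> True"
| "cells H r (x # xs) p \<longleftrightarrow> H \<le> p \<and> r p = x \<and> cells H r xs (r (Suc p))"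

text \<open>\<open>rep\<close> refers to the heap pointer in register 2, which the epilogue reuses;
  \<open>cells\<close> is the part that survives changes of the low registers.\<close>

lemma rep_cells: "rep H r (tov (xs :: nat list)) p \<Longrightarrow> cells H r xs p"
  by (induction xs arbitrary: p) (auto simp: tov_nat_def)

lemma cells_cong: "cells H r xs p \<Longrightarrow> (\<And>a. H \<le> a \<Longrightarrow> r' a = r a) \<Longrightarrow> cells H r' xs p"
  by (induction xs arbitrary: p) auto

lemma epilogue_correct:
  fixes ws :: "nat list"
  assumes r: "good H N r" "rep H r (tov (length ws, rev (tl ws) @ [len, hd ws])) (r 4)"
    and code: "code_at P p (epilogue p)"
    and m: "5 \<le> length ws" "length ws < H" "len \<le> length ws"
  shows "\<exists>r'. reach P (23 + 8 * length ws) (p, r) (p + 29, r') \<and> output_of r' = take len ws"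
proof -
  define m where "m = length ws"
  define Z where "Z = rev (tl ws) @ [len, hd ws]"
  have m5: "5 \<le> m" "m < H" using m by (auto simp: m_def)
  have code0: "code_at P p [ILoad 3 4, IAdd 4 4 1, ILoad 2 4, IConst 5 5]" and
    code1: "code_at P (p + 4) [ISub 4 3 5]" "code_at P (p + 5) [IJz 4 (p + 12)]"
     "code_at P (p + 6) [ILoad 4 2, IStore 3 4, IAdd 2 2 1, ILoad 2 2, ISub 3 3 1]"
     "code_at P (p + 11) [IJz 0 (p + 4)]" and
    code2: "code_at P (p + 12) [IAdd 0 2 0, ILoad 5 0, IAdd 0 0 1, ILoad 0 0, ILoad 4 0, IAdd 0 0 1, ILoad 0 0,
      ILoad 3 0, IAdd 0 0 1, ILoad 0 0, ILoad 2 0, IAdd 0 0 1, ILoad 0 0,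
      IAdd 1 0 1, ILoad 1 1, ILoad 1 1, ILoad 0 0]"
    using code by (simp_all add: epilogue_def numeral_eq_Suc)
  have p4: "H \<le> r 4" "r (r 4) = m" "cells H r Z (r (Suc (r 4)))"
    using r(2) rep_cells[of H r Z] by (auto simp: tov_prod_def tov_nat_def m_def Z_def)
  define r1 where "r1 = fold instr_effect [ILoad 3 4, IAdd 4 4 1, ILoad 2 4, IConst 5 5] r"
  have s1: "reach P 4 (p, r) (p + 4, r1)" using reach_straight[OF code0, of r] by (simp add: r1_def numeral_eq_Suc)
  have H5: "5 < H" using m5 by simp
  have r1: "r1 0 = 0" "r1 1 = 1" "r1 2 = r (Suc (r 4))" "r1 3 = m" "r1 5 = 5"
    and r1H: "\<And>a. H \<le> a \<Longrightarrow> r1 a = r a" using p4 H5 r(1)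
    by (auto simp: r1_def good_def)
  have Znth: "Z ! i = ws ! (m - 1 - i)" if "i < m - 1" for i
    using that m5 by (auto simp: Z_def nth_append rev_nth nth_tl m_def Suc_diff_Suc)
  have Zlen: "length Z = m + 1" using m5 by (simp add: Z_def m_def)
  \<comment> \<open>The loop fills registers \<open>m\<close> down to 6; registers 0 to 5 are still
    needed as constants, pointer, counter and scratch.\<close>
  have loop: "i \<le> m - 5 \<Longrightarrow> \<exists>r'. reach P (i * 8) (p + 4, r1) (p + 4, r') \<and> r' 0 = 0 \<and> r' 1 = 1 \<and> r' 3 = m - i \<and>
     r' 5 = 5 \<and> cells H r' (drop i Z) (r' 2) \<and> (\<forall>a. m - i < a \<and> a \<le> m \<longrightarrow> r' a = ws ! (a - 1))" for i
  proof (induction i)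
    case 0
    show ?case using r1 cells_cong[OF p4(3) r1H] by (intro exI[of _ r1]) (auto simp: reach_refl)
  next
    case (Suc i)
    then obtain r' where r': "reach P (i * 8) (p + 4, r1) (p + 4, r')" "r' 0 = 0" "r' 1 = 1" "r' 3 = m - i"
     "r' 5 = 5" "cells H r' (drop i Z) (r' 2)" "\<forall>a. m - i < a \<and> a \<le> m \<longrightarrow> r' a = ws ! (a - 1)" by auto
    define r2 where "r2 = r'(4 := m - i - 5)"
    have g1: "reach P 1 (p + 4, r') (p + 5, r2)" using reach_straight[OF code1(1), of r'] r' by (simp add: r2_def ac_simps)
    have g2: "reach P 1 (p + 5, r2) (p + 6, r2)" by (rule reach_jz1[OF code1(2)]) (use Suc.prems in \<open>auto simp: r2_def\<close>)
    have dr: "drop i Z = ws ! (m - 1 - i) # drop (Suc i) Z"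
      using Suc.prems Znth[of i] Zlen by (simp add: Cons_nth_drop_Suc[symmetric])
    have c: "H \<le> r' 2" "r' (r' 2) = ws ! (m - 1 - i)" "cells H r' (drop (Suc i) Z) (r' (Suc (r' 2)))"
      using r'(6) unfolding dr by auto
    define r3 where "r3 = r'(4 := ws ! (m - 1 - i), m - i := ws ! (m - 1 - i), 2 := r' (Suc (r' 2)), 3 := m - Suc i)"
    define u where "u = m - i"
    have ne: "Suc (r' 2) \<noteq> u" "Suc (r' 2) \<noteq> 2" "Suc (r' 2) \<noteq> 4" "r' 2 \<noteq> 4" "u \<noteq> 1" "u \<noteq> 2" "u \<noteq> 3" "u \<noteq> 4"
      using c(1) H5 m5 Suc.prems by (auto simp: u_def)
    have "fold instr_effect [ILoad 4 2, IStore 3 4, IAdd 2 2 1, ILoad 2 2, ISub 3 3 1] r2 = r3"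
      unfolding r2_def r3_def u_def[symmetric] using ne c(2) r' by (simp add: u_def)
    then have g3: "reach P 5 (p + 6, r2) (p + 11, r3)" by (rule reach_straightI[OF code1(3)]) simp_all
    have g4: "reach P 1 (p + 11, r3) (p + 4, r3)" by (rule reach_jz0[OF code1(4)]) (use r' Suc.prems in \<open>auto simp: r3_def\<close>)
    have "reach P (i * 8 + (1 + (1 + (5 + 1)))) (p + 4, r1) (p + 4, r3)"
      by (rule reach_trans[OF r'(1) reach_trans[OF g1 reach_trans[OF g2 reach_trans[OF g3 g4]]]])
    then have "reach P (Suc i * 8) (p + 4, r1) (p + 4, r3)" by (simp add: add.commute)
    moreover have "r3 a = r' a" if "H \<le> a" for a using that H5 m5 by (auto simp: r3_def)
    then have "cells H r3 (drop (Suc i) Z) (r' (Suc (r' 2)))" by (rule cells_cong[OF c(3)])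
    then have "cells H r3 (drop (Suc i) Z) (r3 2)" using Suc.prems by (simp add: r3_def)
    moreover have "r3 a = ws ! (a - 1)" if "m - Suc i < a" "a \<le> m" for a
    proof (cases "a = m - i")
      case True
      then show ?thesis using Suc.prems by (auto simp: r3_def intro: arg_cong2[of _ _ _ _ "(!)"])
    next
      case False
      then have "m - i < a" using that by linarith
      then show ?thesis using r'(7) that Suc.prems by (auto simp: r3_def)
    qed
    moreover have "r3 0 = 0" "r3 1 = 1" "r3 3 = m - Suc i" "r3 5 = 5"
      using r' Suc.prems by (auto simp: r3_def)
    ultimately show ?case by blast
  qed
  from loop[of "m - 5"] m5 obtain r' where r': "reach P ((m - 5) * 8) (p + 4, r1) (p + 4, r')" "r' 0 = 0" "r' 1 = 1"
     "r' 3 = 5" "r' 5 = 5" "cells H r' (drop (m - 5) Z) (r' 2)" "\<forall>a. 5 < a \<and> a \<le> m \<longrightarrow> r' a = ws ! (a - 1)"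
    by auto
  define r2 where "r2 = r'(4 := 0)"
  have g1: "reach P 1 (p + 4, r') (p + 5, r2)" using reach_straight[OF code1(1), of r'] r' by (simp add: r2_def ac_simps)
  have g2: "reach P 1 (p + 5, r2) (p + 12, r2)" using reach_jz[OF code1(2), of r2] by (simp add: r2_def)
  obtain x1 x2 x3 x4 x5 us where ws: "ws = x1 # x2 # x3 # x4 # x5 # us"
    using m(1) by (auto simp: Suc_le_length_iff numeral_eq_Suc)
  \<comment> \<open>Register 1 holds the increment for stepping through the list, so registers 1 and
    0 come last: from the cell of \<open>len\<close>, register 1 fetches the entry behind it before
    register 0 is replaced by \<open>len\<close>.\<close>
  have "drop (m - 5) Z = [x5, x4, x3, x2, len, x1]"
    by (simp add: Z_def m_def ws)
  then have c: "cells H r' [x5, x4, x3, x2, len, x1] (r' 2)" using r'(6) by simp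
  define a0 where "a0 = r' 2"
  define a1 where "a1 = r' (Suc a0)"
  define a2 where "a2 = r' (Suc a1)"
  define a3 where "a3 = r' (Suc a2)"
  define a4 where "a4 = r' (Suc a3)"
  define a5 where "a5 = r' (Suc a4)"
  note a_defs = a0_def[symmetric] a1_def[symmetric] a2_def[symmetric] a3_def[symmetric] a4_def[symmetric] a5_def[symmetric]
  have big: "5 < a0" "5 < a1" "5 < a2" "5 < a3" "5 < a4" "5 < a5" and
    vals: "r' a0 = x5" "r' a1 = x4" "r' a2 = x3" "r' a3 = x2" "r' a4 = len" "r' a5 = x1"
    using c H5 by (auto simp: a_defs)
  have pop: "fold instr_effect [ILoad k 0, IAdd 0 0 1, ILoad 0 0] s = s(k := s (s 0), 0 := s (Suc (s 0)))"
    if "s 1 = 1" "5 < s 0" "2 \<le> k" "k \<le> 5" for s :: "nat \<Rightarrow> nat" and k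
  proof -
    have "k \<noteq> 1" "k \<noteq> 0" "Suc (s 0) \<noteq> k" using that by auto
    then show ?thesis using that by simp
  qed
  define s0 where "s0 = r2(0 := a0)"
  define s1 where "s1 = s0(5 := x5, 0 := a1)"
  define s2 where "s2 = s1(4 := x4, 0 := a2)"
  define s3 where "s3 = s2(3 := x3, 0 := a3)"
  define s4 where "s4 = s3(2 := x2, 0 := a4)"
  define r3 where "r3 = s4(1 := x1, 0 := len)"
  have hp: "r2 a0 = x5" "s0 a0 = x5" "s0 (Suc a0) = a1" "s1 a1 = x4" "s1 (Suc a1) = a2" "s2 a2 = x3" "s2 (Suc a2) = a3"
    "s3 a3 = x2" "s3 (Suc a3) = a4" "s4 a4 = len" "s4 (Suc a4) = a5" "s4 a5 = x1"
    using big vals by (simp_all add: r2_def s0_def s1_def s2_def s3_def s4_def a_defs)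
  have ones: "s0 1 = 1" "s1 1 = 1" "s2 1 = 1" "s3 1 = 1" "s4 1 = 1"
    and ptrs: "s0 0 = a0" "s1 0 = a1" "s2 0 = a2" "s3 0 = a3" "s4 0 = a4"
    using r' by (simp_all add: r2_def s0_def s1_def s2_def s3_def s4_def)
  have e0: "fold instr_effect [IAdd 0 2 0] r2 = s0" using r' by (simp add: r2_def s0_def a0_def)
  have e1: "fold instr_effect [ILoad 5 0, IAdd 0 0 1, ILoad 0 0] s0 = s1"
    using pop[of s0 5] ones ptrs hp big by (simp add: s1_def)
  have e2: "fold instr_effect [ILoad 4 0, IAdd 0 0 1, ILoad 0 0] s1 = s2"
    using pop[of s1 4] ones ptrs hp big by (simp add: s2_def)
  have e3: "fold instr_effect [ILoad 3 0, IAdd 0 0 1, ILoad 0 0] s2 = s3"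
    using pop[of s2 3] ones ptrs hp big by (simp add: s3_def)
  have e4: "fold instr_effect [ILoad 2 0, IAdd 0 0 1, ILoad 0 0] s3 = s4"
    using pop[of s3 2] ones ptrs hp big by (simp add: s4_def)
  have e5: "fold instr_effect [IAdd 1 0 1, ILoad 1 1, ILoad 1 1, ILoad 0 0] s4 = r3"
    using ones ptrs hp big by (simp add: r3_def)
  have "fold instr_effect ([IAdd 0 2 0] @ [ILoad 5 0, IAdd 0 0 1, ILoad 0 0] @ [ILoad 4 0, IAdd 0 0 1, ILoad 0 0] @
      [ILoad 3 0, IAdd 0 0 1, ILoad 0 0] @ [ILoad 2 0, IAdd 0 0 1, ILoad 0 0] @
      [IAdd 1 0 1, ILoad 1 1, ILoad 1 1, ILoad 0 0]) r2 = r3"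
    unfolding fold_append comp_apply e0 e1 e2 e3 e4 e5 ..
  then have "fold instr_effect [IAdd 0 2 0, ILoad 5 0, IAdd 0 0 1, ILoad 0 0, ILoad 4 0, IAdd 0 0 1, ILoad 0 0,
      ILoad 3 0, IAdd 0 0 1, ILoad 0 0, ILoad 2 0, IAdd 0 0 1, ILoad 0 0,
      IAdd 1 0 1, ILoad 1 1, ILoad 1 1, ILoad 0 0] r2 = r3" by (simp only: append.simps)
  then have g3: "reach P 17 (p + 12, r2) (p + 29, r3)" by (rule reach_straightI[OF code2]) simp_all
  have "reach P (4 + ((m - 5) * 8 + (1 + (1 + 17)))) (p, r) (p + 29, r3)"
    by (rule reach_trans[OF s1 reach_trans[OF r'(1) reach_trans[OF g1 reach_trans[OF g2 g3]]]])
  then have "reach P (23 + 8 * m) (p, r) (p + 29, r3)" by (rule reach_mono) simp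
  note fin = this
  have "r3 (Suc i) = ws ! i" if "i < m" for i
  proof (cases "i < 5")
    case True
    then consider "i = 0" | "i = 1" | "i = 2" | "i = 3" | "i = 4" by linarith
    then show ?thesis by cases (simp_all add: r3_def s4_def s3_def s2_def s1_def ws)
  next
    case False
    then show ?thesis using r'(7) that by (simp add: r3_def s4_def s3_def s2_def s1_def s0_def r2_def)
  qed
  moreover have "r3 0 = len" by (simp add: r3_def)
  ultimately have "output_of r3 = take len ws" using m(3)
    by (auto simp: output_of_def m_def intro!: nth_equalityI)
  then show ?thesis using fin unfolding m_def by blast
qed

text \<open>\<open>ws\<close> is the output padded to at least five entries, of which
  \<open>len\<close> are read back. \<open>length ws \<le> length xs\<close> keeps the output below
  the heap while it is written.\<close>

lemma ram_simulation:
  "\<exists>P A d. \<forall>xs ws len. 10 \<le> length xs \<and> xs ! 3 = z \<and> 5 \<le> length ws \<and> len \<le> length ws \<and> length ws \<le> length xs \<and>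
     ev (length xs + last xs + bitlen (sum_list xs)) f (tov (drop 9 xs @ take 9 xs))
        (tov (length ws, rev (tl ws) @ [len, hd ws])) \<longrightarrow>
     runs_within P xs (A * Suc (length xs + last xs + bitlen (sum_list xs)) ^ d) (take len ws)"
proof -
  define B where "B = regs f"
  define c where "c = compile 50 4 f"
  define P where "P = prologue z B @ c @ epilogue (50 + length c)"
  have lP: "length P = 50 + length c + 29" by (simp add: P_def length_prologue epilogue_def)
  have "code_at P 0 P" by (simp add: code_at_def)
  then have code: "code_at P 0 (prologue z B)" "code_at P 50 c" "code_at P (50 + length c) (epilogue (50 + length c))"
    unfolding P_def code_at_append by (simp_all add: length_prologue)
  obtain A d where Ad: "\<And>N. time N f \<le> A * Suc N ^ d" using time_poly by blast
  have main: "runs_within P xs ((59 + 24 + A) * Suc N ^ Suc d) (take len ws)"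
    if L: "10 \<le> length xs" and z: "xs ! 3 = z" and ws: "5 \<le> length ws" "len \<le> length ws" "length ws \<le> length xs" and
     N: "N = length xs + last xs + bitlen (sum_list xs)" and
     ev: "ev N f (tov (drop 9 xs @ take 9 xs)) (tov (length ws, rev (tl ws) @ [len, hd ws]))" for xs ws len N
  proof -
    define H where "H = length xs + 10 + B"
    obtain r where r: "reach P (36 + 16 * N) (init_conf xs) (50, r)" "good H N r"
       "rep H r (tov (drop 9 xs @ take 9 xs)) (r 4)"
      using prologue_correct[OF L z code(1)] unfolding N H_def by blast
    have "corr P H (time N f) 50 4 r (50 + length (compile 50 4 f)) (tov (length ws, rev (tl ws) @ [len, hd ws]))"
      by (rule compile_correct[OF ev]) (use code r in \<open>auto simp: c_def H_def B_def\<close>)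
    then obtain r1 where r1: "reach P (time N f) (50, r) (50 + length c, r1)" "hext H 4 r r1"
      "rep H r1 (tov (length ws, rev (tl ws) @ [len, hd ws])) (r1 4)" unfolding corr_def c_def by blast
    have "\<exists>r'. reach P (23 + 8 * length ws) (50 + length c, r1) (50 + length c + 29, r') \<and> output_of r' = take len ws"
      using ws by (intro epilogue_correct[OF good_hext[OF r(2) r1(2)] r1(3) code(3)]) (auto simp: H_def)
    then obtain r2 where r2: "reach P (23 + 8 * length ws) (50 + length c, r1) (length P, r2)" "output_of r2 = take len ws"
      unfolding lP by blast
    have "reach P (36 + 16 * N + (time N f + (23 + 8 * length ws))) (init_conf xs) (length P, r2)"
      by (rule reach_trans[OF r(1) reach_trans[OF r1(1) r2(1)]])
    moreover have "36 + 16 * N + (time N f + (23 + 8 * length ws)) \<le> (59 + 24 + A) * Suc N ^ Suc d"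
    proof -
      have p: "1 \<le> Suc N ^ d" by simp
      have "36 + 16 * N + (23 + 8 * length ws) \<le> 83 * Suc N" using ws N by simp
      also have "\<dots> = 83 * Suc N * 1" by simp
      also have "\<dots> \<le> 83 * Suc N * Suc N ^ d" by (rule mult_le_mono2[OF p])
      also have "\<dots> = 83 * Suc N ^ Suc d" by (simp only: power_Suc mult.assoc)
      finally have 1: "36 + 16 * N + (23 + 8 * length ws) \<le> 83 * Suc N ^ Suc d" .
      have "time N f \<le> A * Suc N ^ d" by (rule Ad)
      also have "\<dots> \<le> A * Suc N ^ Suc d" by simp
      finally have 2: "time N f \<le> A * Suc N ^ Suc d" .
      have "(59 + 24 + A) * Suc N ^ Suc d = 83 * Suc N ^ Suc d + A * Suc N ^ Suc d"
        by (simp only: distrib_right)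
      then show ?thesis using 1 2 by linarith
    qed
    ultimately have "reach P ((59 + 24 + A) * Suc N ^ Suc d) (init_conf xs) (length P, r2)" by (rule reach_mono)
    then show ?thesis using r2(2) unfolding runs_within_def reach_def by fastforce
  qed
  show ?thesis
    by (intro exI[of _ P] exI[of _ "59 + 24 + A"] exI[of _ "Suc d"] allI impI, elim conjE)
      (rule main[OF _ _ _ _ _ refl]; assumption)
qed

section \<open>Functions computable in polynomial time\<close>

text \<open>The first argument of \<open>f\<close> is the truncation bound \<open>N ^ D\<close>.\<close>

definition pt :: "nat \<Rightarrow> (nat \<Rightarrow> 'a::valued \<Rightarrow> 'b::valued) \<Rightarrow> bool" where
  "pt D f \<longleftrightarrow> (\<exists>c. \<forall>N x. ev N c (tov x) (tov (f (N ^ D) x)))"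

lemma ptI: "(\<And>N x. ev N c (tov x) (tov (f (N ^ D) x))) \<Longrightarrow> pt D f"
  unfolding pt_def by blast

lemma ptE:
  assumes "pt D f"
  obtains c where "\<And>N x. ev N c (tov x) (tov (f (N ^ D) x))"
  using assms unfolding pt_def by blast

lemma pt_cong: "pt D f \<Longrightarrow> (\<And>W x. f W x = g W x) \<Longrightarrow> pt D g"
  unfolding pt_def by simp

lemma pt_id: "pt D (\<lambda>W x. x)"
  by (rule ptI[of FId]) (rule ev_Id)

lemma pt_compose: "pt D g \<Longrightarrow> pt D f \<Longrightarrow> pt D (\<lambda>W x. g W (f W x))"
  by (elim ptE) (rule ptI, rule ev_Comp, assumption+)

lemma pt_pair: "pt D f \<Longrightarrow> pt D g \<Longrightarrow> pt D (\<lambda>W x. (f W x, g W x))"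
  by (elim ptE) (rule ptI, simp add: tov_prod_def, rule ev_Pair, assumption+)

lemma pt_fst: "pt D f \<Longrightarrow> pt D (\<lambda>W x. fst (f W x))"
  by (rule pt_compose[of D "\<lambda>W x. fst x"], rule ptI[of FFst], simp add: tov_prod_def, rule ev_Fst)

lemma pt_snd: "pt D f \<Longrightarrow> pt D (\<lambda>W x. snd (f W x))"
  by (rule pt_compose[of D "\<lambda>W x. snd x"], rule ptI[of FSnd], simp add: tov_prod_def, rule ev_Snd)

lemma pt_const: "pt D (\<lambda>W x. k :: nat)"
  by (rule ptI[of "FConst k"], simp add: tov_nat_def, rule ev_Const)

lemma pt_True: "pt D (\<lambda>W x. True)" and pt_False: "pt D (\<lambda>W x. False)"
  by (rule ptI[of "FConst 1"], simp add: tov_bool_def, rule ev_Const)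
     (rule ptI[of "FConst 0"], simp add: tov_bool_def, rule ev_Const)

lemma pt_Nil: "pt D (\<lambda>W x. [])"
  by (rule ptI[of "FConst 0"], simp, rule ev_Const)

lemma pt_Cons: "pt D f \<Longrightarrow> pt D g \<Longrightarrow> pt D (\<lambda>W x. f W x # g W x)"
  by (elim ptE) (rule ptI, simp, rule ev_Pair, assumption+)

lemma pt_add: "pt D f \<Longrightarrow> pt D g \<Longrightarrow> pt D (\<lambda>W x. f W x + g W x :: nat)"
  by (elim ptE) (rule ptI, simp add: tov_nat_def, rule ev_Add, assumption+)

lemma pt_sub: "pt D f \<Longrightarrow> pt D g \<Longrightarrow> pt D (\<lambda>W x. f W x - g W x :: nat)"
  by (elim ptE) (rule ptI, simp add: tov_nat_def, rule ev_Sub, assumption+)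

lemma pt_Suc: "pt D f \<Longrightarrow> pt D (\<lambda>W x. Suc (f W x))"
  using pt_add[OF _ pt_const[of D 1], of f] by simp

lemma pt_if0:
  assumes "pt D n" "pt D f" "pt D g"
  shows "pt D (\<lambda>W x. if n W x = (0::nat) then f W x else g W x)"
proof -
  obtain a b c where c: "\<And>N x. ev N a (tov x) (tov (n (N ^ D) x))"
    "\<And>N x. ev N b (tov x) (tov (f (N ^ D) x))" "\<And>N x. ev N c (tov x) (tov (g (N ^ D) x))"
    using assms by (metis ptE)
  show ?thesis
  proof (rule ptI[of "FIf a c b"])
    fix N x show "ev N (FIf a c b) (tov x) (tov (if n (N ^ D) x = 0 then f (N ^ D) x else g (N ^ D) x))"
    proof (cases "n (N ^ D) x = 0")
      case True
      then show ?thesis using c(1)[of N x] c(2)[of N x] by (auto simp: tov_nat_def intro: ev_If0)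
    next
      case False
      then show ?thesis using ev_If1[OF c(1)[of N x] _ c(3)[of N x]] by (auto simp: tov_nat_def)
    qed
  qed
qed

lemma pt_if:
  assumes "pt D n" "pt D f" "pt D g"
  shows "pt D (\<lambda>W x. if n W x then f W x else g W x)"
proof -
  obtain a b c where c: "\<And>N x. ev N a (tov x) (tov (n (N ^ D) x))"
    "\<And>N x. ev N b (tov x) (tov (f (N ^ D) x))" "\<And>N x. ev N c (tov x) (tov (g (N ^ D) x))"
    using assms by (metis ptE)
  show ?thesis
  proof (rule ptI[of "FIf a b c"])
    fix N x show "ev N (FIf a b c) (tov x) (tov (if n (N ^ D) x then f (N ^ D) x else g (N ^ D) x))"
    proof (cases "n (N ^ D) x")
      case False
      then show ?thesis using c(1)[of N x] c(3)[of N x] by (auto simp: tov_bool_def intro: ev_If0)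
    next
      case True
      then show ?thesis using ev_If1[OF c(1)[of N x] _ c(2)[of N x]] by (auto simp: tov_bool_def)
    qed
  qed
qed

text \<open>A nonempty list has the same value as the pair of its head and tail, so taking it apart
  requires no conversion, and 0 as a condition means the empty list.\<close>

lemma pt_case_list:
  assumes "pt D l" "pt D f" "pt D (\<lambda>W y. g W (fst y) (fst (snd y)) (snd (snd y)))"
  shows "pt D (\<lambda>W x. case l W x of [] \<Rightarrow> f W x | h # t \<Rightarrow> g W x h t)"
proof -
  obtain a b c where c: "\<And>N x. ev N a (tov x) (tov (l (N ^ D) x))"
    "\<And>N x. ev N b (tov x) (tov (f (N ^ D) x))"
    "\<And>N y. ev N c (tov y) (tov (g (N ^ D) (fst y) (fst (snd y)) (snd (snd y))))"
    using assms(1)[unfolded pt_def] assms(2)[unfolded pt_def] assms(3)[unfolded pt_def] by blast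
  show ?thesis
  proof (rule ptI[of "FIf a (FComp (FPair FId a) c) b"])
    fix N x show "ev N (FIf a (FComp (FPair FId a) c) b) (tov x)
       (tov (case l (N ^ D) x of [] \<Rightarrow> f (N ^ D) x | h # t \<Rightarrow> g (N ^ D) x h t))"
    proof (cases "l (N ^ D) x")
      case Nil
      then show ?thesis using c(1)[of N x] c(2)[of N x] by (auto intro: ev_If0)
    next
      case (Cons h t)
      have "ev N (FPair FId a) (tov x) (VP (tov x) (tov (l (N ^ D) x)))"
        by (intro ev_Pair ev_Id c)
      also have "VP (tov x) (tov (l (N ^ D) x)) = tov (x, h, t)" by (simp add: Cons tov_prod_def)
      finally have "ev N (FComp (FPair FId a) c) (tov x) (tov (g (N ^ D) x h t))"
        using ev_Comp c(3)[of N "(x, h, t)"] by fastforce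
      then show ?thesis using ev_If1[OF c(1)[of N x]] Cons by auto
    qed
  qed
qed

lemma pt_let:
  assumes "pt D f" "pt D (\<lambda>W y. g W (fst y) (snd y))"
  shows "pt D (\<lambda>W x. let v = f W x in g W x v)"
  using pt_compose[OF assms(2) pt_pair[OF pt_id assms(1)]] by simp

text \<open>\<open>D\<close> nested basic loops make N ^ D rounds, the truncation bound in
  \<open>pt\<close>.\<close>

fun iter_fn :: "nat \<Rightarrow> fn \<Rightarrow> fn" where
  "iter_fn 0 f = f"
| "iter_fn (Suc D) f = FIter (iter_fn D f)"

lemma ev_iter_fn:
  assumes "\<And>k. ev N f (X k) (X (Suc k))"
  shows "ev N (iter_fn D f) (X j) (X (j + N ^ D))"
proof (induction D arbitrary: j)
  case 0 then show ?case using assms by simp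
next
  case (Suc D)
  have "ev N (FIter (iter_fn D f)) (X (j + 0 * N ^ D)) (X (j + N * N ^ D))"
    by (rule ev_Iter[of N _ "\<lambda>i. X (j + i * N ^ D)"]) (use Suc[of "j + _ * N ^ D"] in \<open>simp add: add_ac\<close>)
  then show ?case by simp
qed

lemma pt_iter:
  fixes f :: "nat \<Rightarrow> 'a::valued \<Rightarrow> 'b::valued \<Rightarrow> 'b"
  assumes "pt D (\<lambda>W y. f W (fst y) (snd y))" "pt D i"
  shows "pt D (\<lambda>W x. (f W x ^^ W) (i W x))"
proof -
  obtain c where c: "\<And>N y. ev N c (tov y) (tov (f (N ^ D) (fst y) (snd y)))"
    using assms(1)[unfolded pt_def] by blast
  \<comment> \<open>A loop body sees only its own state, so the input travels along in the first
    component.\<close>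
  have "pt D (\<lambda>W y. (fst y, (f W (fst y) ^^ W) (snd y)))"
  proof (rule ptI[of "iter_fn D (FPair FFst c)"])
    fix N :: nat and y :: "'a \<times> 'b"
    define X where "X k = tov (fst y, (f (N ^ D) (fst y) ^^ k) (snd y))" for k
    have "ev N (FPair FFst c) (X k) (X (Suc k))" for k
    proof -
      have "ev N FFst (X k) (tov (fst y))" by (simp add: X_def tov_prod_def ev_Fst)
      moreover have "ev N c (X k) (tov ((f (N ^ D) (fst y) ^^ Suc k) (snd y)))"
        using c[of N "(fst y, (f (N ^ D) (fst y) ^^ k) (snd y))"] by (simp add: X_def)
      ultimately show ?thesis unfolding X_def[of "Suc k"] by (simp add: tov_prod_def ev_Pair)
    qed
    from ev_iter_fn[of N _ X D 0, OF this]
    show "ev N (iter_fn D (FPair FFst c)) (tov y)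
       (tov (fst y, (f (N ^ D) (fst y) ^^ (N ^ D)) (snd y)))"
      by (simp add: X_def)
  qed
  from pt_snd[OF pt_compose[OF this pt_pair[OF pt_id assms(2)]]] show ?thesis by simp
qed

lemmas pt_basic = pt_id pt_pair pt_fst pt_snd pt_const pt_True pt_False pt_Nil pt_Cons pt_add pt_sub
  pt_Suc pt_if pt_let

lemma pt_le: "pt D f \<Longrightarrow> pt D g \<Longrightarrow> pt D (\<lambda>W x. f W x \<le> (g W x :: nat))"
  by (rule pt_cong[OF pt_if0[OF pt_sub pt_True pt_False, of D f g]]) auto

lemma pt_not: "pt D f \<Longrightarrow> pt D (\<lambda>W x. \<not> f W x)"
  by (rule pt_cong[OF pt_if[OF _ pt_False pt_True, of D f]]) auto

lemma pt_conj: "pt D f \<Longrightarrow> pt D g \<Longrightarrow> pt D (\<lambda>W x. f W x \<and> g W x)"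
  by (rule pt_cong[OF pt_if[OF _ _ pt_False, of D f g]]) auto

lemma pt_disj: "pt D f \<Longrightarrow> pt D g \<Longrightarrow> pt D (\<lambda>W x. f W x \<or> g W x)"
  by (rule pt_cong[OF pt_not[OF pt_conj[OF pt_not pt_not, of D f g]]]) auto

lemma pt_less: "pt D f \<Longrightarrow> pt D g \<Longrightarrow> pt D (\<lambda>W x. f W x < (g W x :: nat))"
  by (rule pt_cong[OF pt_not[OF pt_le, of D g f]]) auto

lemma pt_eq: "pt D f \<Longrightarrow> pt D g \<Longrightarrow> pt D (\<lambda>W x. f W x = (g W x :: nat))"
  by (rule pt_cong[OF pt_conj[OF pt_le[of D f g] pt_le[of D g f]]]) auto

lemma pt_max: "pt D f \<Longrightarrow> pt D g \<Longrightarrow> pt D (\<lambda>W x. max (f W x) (g W x :: nat))"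
  unfolding max_def by (intro pt_basic pt_le)

lemmas pt_arith = pt_basic pt_le pt_less pt_eq pt_not pt_conj pt_disj pt_max

section \<open>Truncated loops over lists and numbers\<close>

definition uncons_step :: "('a \<Rightarrow> 's \<Rightarrow> 's) \<Rightarrow> 'a list \<times> 's \<Rightarrow> 'a list \<times> 's" where
  "uncons_step f y = (case fst y of [] \<Rightarrow> y | h # t \<Rightarrow> (t, f h (snd y)))"

text \<open>Idling on the empty list turns a fixed number of rounds into a fold over at most that
  many elements.\<close>

lemma funpow_uncons_step: "(uncons_step f ^^ n) (xs, s) = (drop n xs, fold f (take n xs) s)"
proof (induction n arbitrary: xs s)
  case (Suc n)
  then show ?case by (cases xs) (auto simp: funpow_Suc_right uncons_step_def simp del: funpow.simps)
qed simp

lemma pt_fold: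
  assumes "pt D l" "pt D i" "pt D (\<lambda>W y. f W (fst y) (fst (snd y)) (snd (snd y)))"
  shows "pt D (\<lambda>W x. fold (\<lambda>a s. f W x a s) (take W (l W x)) (i W x))"
proof -
  have "pt D (\<lambda>W z. f W (fst (fst z)) (fst (snd z)) (snd (snd (fst z))))"
    by (rule pt_compose[OF assms(3), of "\<lambda>W z. (fst (fst z), fst (snd z), snd (snd (fst z)))", simplified])
      (intro pt_basic)
  then have "pt D (\<lambda>W y. uncons_step (f W (fst y)) (snd y))"
    unfolding uncons_step_def by (intro pt_basic pt_case_list)
  from pt_snd[OF pt_iter[OF this pt_pair[OF assms(1,2)]]] show ?thesis
    by (simp add: funpow_uncons_step)
qed

lemma pt_rev: "pt D l \<Longrightarrow> pt D (\<lambda>W x. rev (take W (l W x)))"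
proof -
  assume "pt D l"
  then have "pt D (\<lambda>W x. fold (\<lambda>a s. a # s) (take W (l W x)) [])" by (intro pt_fold pt_basic)
  then show ?thesis by (simp add: rev_conv_fold)
qed

lemma pt_foldr:
  assumes "pt D l" "pt D i" "pt D (\<lambda>W y. f W (fst y) (fst (snd y)) (snd (snd y)))"
  shows "pt D (\<lambda>W x. foldr (\<lambda>a s. f W x a s) (take W (l W x)) (i W x))"
  using pt_fold[OF pt_rev[OF assms(1)] assms(2,3)] by (simp add: foldr_conv_fold)

lemma pt_map:
  assumes "pt D l" "pt D (\<lambda>W y. f W (fst y) (snd y))"
  shows "pt D (\<lambda>W x. map (\<lambda>a. f W x a) (take W (l W x)))"
proof -
  have "pt D (\<lambda>W y. f W (fst y) (fst (snd y)))"
    by (rule pt_compose[OF assms(2), of "\<lambda>W z. (fst z, fst (snd z))", simplified]) (intro pt_basic)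
  then have "pt D (\<lambda>W x. foldr (\<lambda>a s. f W x a # s) (take W (l W x)) [])"
    using assms(1) by (intro pt_foldr pt_basic)
  moreover have "foldr (\<lambda>a s. g a # s) xs [] = map g xs" for g :: "'b \<Rightarrow> 'c" and xs
    by (induction xs) auto
  ultimately show ?thesis by simp
qed

lemma pt_filter:
  assumes "pt D l" "pt D (\<lambda>W y. f W (fst y) (snd y))"
  shows "pt D (\<lambda>W x. filter (\<lambda>a. f W x a) (take W (l W x)))"
proof -
  have "pt D (\<lambda>W y. f W (fst y) (fst (snd y)))"
    by (rule pt_compose[OF assms(2), of "\<lambda>W z. (fst z, fst (snd z))", simplified]) (intro pt_basic)
  then have "pt D (\<lambda>W x. foldr (\<lambda>a s. if f W x a then a # s else s) (take W (l W x)) [])"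
    using assms(1) by (intro pt_foldr pt_basic)
  moreover have "foldr (\<lambda>a s. if g a then a # s else s) xs [] = filter g xs" for g :: "'b \<Rightarrow> bool" and xs
    by (induction xs) auto
  ultimately show ?thesis by simp
qed

lemma pt_list_ex:
  assumes "pt D l" "pt D (\<lambda>W y. f W (fst y) (snd y))"
  shows "pt D (\<lambda>W x. list_ex (\<lambda>a. f W x a) (take W (l W x)))"
proof -
  have "pt D (\<lambda>W y. f W (fst y) (fst (snd y)))"
    by (rule pt_compose[OF assms(2), of "\<lambda>W z. (fst z, fst (snd z))", simplified]) (intro pt_basic)
  then have "pt D (\<lambda>W x. foldr (\<lambda>a s. f W x a \<or> s) (take W (l W x)) False)"
    using assms(1) by (intro pt_foldr pt_arith)
  moreover have "foldr (\<lambda>a s. g a \<or> s) xs False = list_ex g xs" for g :: "'b \<Rightarrow> bool" and xs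
    by (induction xs) auto
  ultimately show ?thesis by simp
qed

lemma foldr_Cons_append: "foldr (\<lambda>a s. a # s) xs ys = xs @ ys"
  by (induction xs) auto

lemma pt_append: "pt D l \<Longrightarrow> pt D m \<Longrightarrow> pt D (\<lambda>W x. take W (l W x) @ m W x)"
proof -
  assume "pt D l" "pt D m"
  then have "pt D (\<lambda>W x. foldr (\<lambda>a s. a # s) (take W (l W x)) (m W x))" by (intro pt_foldr pt_basic)
  then show ?thesis by (simp only: foldr_Cons_append)
qed

lemma foldr_append_take: "foldr (\<lambda>a s. take W a @ s) xs [] = concat (map (take W) xs)"
  by (induction xs) auto

lemma pt_concat:
  assumes "pt D l" shows "pt D (\<lambda>W x. concat (map (take W) (take W (l W x))))"
proof -
  have "pt D (\<lambda>W x. foldr (\<lambda>a s. take W a @ s) (take W (l W x)) [])"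
    using assms by (intro pt_foldr pt_basic pt_append)
  then show ?thesis by (simp only: foldr_append_take)
qed

definition dec_step :: "('s \<Rightarrow> 's) \<Rightarrow> nat \<times> 's \<Rightarrow> nat \<times> 's" where
  "dec_step f y = (if fst y = 0 then y else (fst y - 1, f (snd y)))"

lemma funpow_dec_step: "(dec_step f ^^ n) (k, s) = (k - n, (f ^^ min k n) s)"
proof (induction n arbitrary: k s)
  case (Suc n)
  then show ?case
    by (cases k) (auto simp: dec_step_def funpow_Suc_right funpow_swap1 simp del: funpow.simps(2))
qed simp

lemma pt_repeat:
  fixes f :: "nat \<Rightarrow> 'a::valued \<Rightarrow> 'b::valued \<Rightarrow> 'b"
  assumes "pt D k" "pt D i" "pt D (\<lambda>W y. f W (fst y) (snd y))"
  shows "pt D (\<lambda>W x. (f W x ^^ min (k W x) W) (i W x))"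
proof -
  have "pt D (\<lambda>W y. f W (fst y) (snd (snd y)))"
    by (rule pt_compose[OF assms(3), of "\<lambda>W z. (fst z, snd (snd z))", simplified]) (intro pt_basic)
  then have "pt D (\<lambda>W y. dec_step (f W (fst y)) (snd y))"
    unfolding dec_step_def by (intro pt_arith)
  from pt_snd[OF pt_iter[OF this pt_pair[OF assms(1,2)]]] show ?thesis
    by (simp add: funpow_dec_step)
qed

text \<open>Repeated addition with the second factor as counter: exact if \<open>b \<le> W\<close>,
  however large \<open>a\<close> is.\<close>

definition mulW :: "nat \<Rightarrow> nat \<Rightarrow> nat \<Rightarrow> nat" where "mulW W a b = a * min b W"

lemma pt_mul: "pt D f \<Longrightarrow> pt D g \<Longrightarrow> pt D (\<lambda>W x. mulW W (f W x) (g W x))"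
proof -
  assume a: "pt D f" "pt D g"
  have "pt D (\<lambda>W x. ((\<lambda>s. s + f W x) ^^ min (g W x) W) 0)"
    by (intro pt_repeat pt_basic a pt_compose[OF a(1)])
  moreover have "((\<lambda>s. s + a) ^^ n) 0 = a * n" for a n :: nat by (induction n) auto
  ultimately show ?thesis by (simp add: mulW_def)
qed

definition nthW :: "nat \<Rightarrow> nat list \<Rightarrow> nat \<Rightarrow> nat" where
  "nthW W xs i = (case drop (min i W) xs of [] \<Rightarrow> 0 | h # t \<Rightarrow> h)"

lemma nthW_eq: "i \<le> W \<Longrightarrow> i < length xs \<Longrightarrow> nthW W xs i = xs ! i"
  unfolding nthW_def by (simp add: Cons_nth_drop_Suc[symmetric])

lemma funpow_tl: "(tl ^^ n) xs = drop n xs"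
  by (induction n arbitrary: xs) (auto simp: drop_Suc funpow_Suc_right simp del: funpow.simps(2))

lemma pt_tl: "pt D l \<Longrightarrow> pt D (\<lambda>W x. tl (l W x))"
proof -
  assume "pt D l"
  then have "pt D (\<lambda>W x. case l W x of [] \<Rightarrow> [] | h # t \<Rightarrow> t)" by (intro pt_case_list pt_basic)
  then show ?thesis by (simp add: tl_def)
qed

lemma pt_drop: "pt D l \<Longrightarrow> pt D i \<Longrightarrow> pt D (\<lambda>W x. drop (min (i W x) W) (l W x))"
proof -
  assume "pt D l" "pt D i"
  then have "pt D (\<lambda>W x. ((\<lambda>l. tl l) ^^ min (i W x) W) (l W x))" by (intro pt_repeat pt_tl pt_basic)
  then show ?thesis by (simp add: funpow_tl)
qed

lemma pt_nth: "pt D l \<Longrightarrow> pt D i \<Longrightarrow> pt D (\<lambda>W x. nthW W (l W x) (i W x))"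
  unfolding nthW_def by (intro pt_case_list pt_basic pt_drop)

text \<open>The list is consed from \<open>n - 1\<close> downwards, so truncation cuts off its
  beginning.\<close>

definition uptW :: "nat \<Rightarrow> nat \<Rightarrow> nat list" where "uptW W n = [n - W..<n]"

lemma uptW_eq: "n \<le> W \<Longrightarrow> uptW W n = [0..<n]" by (simp add: uptW_def)

lemma pt_upt: "pt D n \<Longrightarrow> pt D (\<lambda>W x. uptW W (n W x))"
proof -
  assume a: "pt D n"
  define g where "g y = (if fst y = 0 then y else (fst y - 1, (fst y - 1) # snd y))" for y :: "nat \<times> nat list"
  have g: "(g ^^ k) (m, []) = (m - k, [m - k..<m])" for k m
  proof (induction k)
    case (Suc k)
    then show ?case by (cases "k < m") (auto simp: g_def upt_conv_Cons Suc_diff_Suc)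
  qed simp
  have "pt D (\<lambda>W y. g (snd y))" unfolding g_def by (intro pt_arith)
  from pt_snd[OF pt_iter[OF this pt_pair[OF a pt_Nil]]] show ?thesis by (simp add: g uptW_def)
qed

definition div_step :: "nat \<Rightarrow> nat \<times> nat \<Rightarrow> nat \<times> nat" where
  "div_step d y = (if d \<le> fst y then (fst y - d, snd y + 1) else y)"

text \<open>Repeated subtraction, exact if the quotient is at most \<open>W\<close>. The horizon M *
  \<delta> guarantees this for all times that are divided by \<delta>.\<close>

definition divW :: "nat \<Rightarrow> nat \<Rightarrow> nat \<Rightarrow> nat" where
  "divW W a d = snd ((div_step d ^^ W) (a, 0))"

lemma divW_eq: assumes "0 < d" "a div d \<le> W" shows "divW W a d = a div d"
proof -
  have "(div_step d ^^ k) (a, 0) = (a - min k (a div d) * d, min k (a div d))" for k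
  proof (induction k)
    case (Suc k)
    show ?case
    proof (cases "k < a div d")
      case True
      then have "Suc k * d \<le> a" using assms(1) by (metis Suc_leI less_eq_div_iff_mult_less_eq)
      then show ?thesis using Suc True by (auto simp: div_step_def min_def)
    next
      case False
      then have "a - a div d * d < d" using assms(1) by (simp add: minus_div_mult_eq_mod)
      then show ?thesis using Suc False by (auto simp: div_step_def min_def)
    qed
  qed simp
  then show ?thesis using assms(2) by (simp add: divW_def)
qed

lemma pt_div: "pt D f \<Longrightarrow> pt D g \<Longrightarrow> pt D (\<lambda>W x. divW W (f W x) (g W x))"
proof -
  assume a: "pt D f" "pt D g"
  have "pt D (\<lambda>W y. div_step (g W (fst y)) (snd y))"
    unfolding div_step_def using pt_compose[OF a(2), of "\<lambda>W y. fst y"] by (intro pt_arith pt_compose[OF a(2)])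
  from pt_snd[OF pt_iter[OF this pt_pair[OF a(1) pt_const]]] show ?thesis by (simp add: divW_def)
qed

definition eq_step :: "nat \<Rightarrow> bool \<times> nat list \<Rightarrow> bool \<times> nat list" where
  "eq_step a s = (case snd s of [] \<Rightarrow> (False, []) | h # t \<Rightarrow> (fst s \<and> a = h, t))"

definition eqW :: "nat \<Rightarrow> nat list \<Rightarrow> nat list \<Rightarrow> bool" where
  "eqW W xs ys = (let s = fold eq_step (take W xs) (True, ys)
     in fst s \<and> (case snd s of [] \<Rightarrow> True | h # t \<Rightarrow> False))"

lemma eqW_eq: "length xs \<le> W \<Longrightarrow> eqW W xs ys \<longleftrightarrow> xs = ys"
proof -
  have "(let s = fold eq_step xs (b, ys) in fst s \<and> (case snd s of [] \<Rightarrow> True | h # t \<Rightarrow> False)) \<longleftrightarrow> b \<and> xs = ys"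
    for b
  proof (induction xs arbitrary: b ys)
    case Nil
    then show ?case by (auto split: list.splits)
  next
    case (Cons x xs)
    have "fold eq_step xs (False, []) = (False, [])" for xs by (induction xs) (auto simp: eq_step_def)
    moreover have "eq_step a (b, []) = (False, [])" "eq_step a (b, h # t) = (b \<and> a = h, t)" for a b h t
      by (simp_all add: eq_step_def)
    ultimately show ?case using Cons[of "b \<and> x = hd ys" "tl ys"] by (cases ys) (auto simp: Let_def)
  qed
  then show "length xs \<le> W \<Longrightarrow> ?thesis" by (simp add: eqW_def)
qed

lemma pt_eqW: "pt D f \<Longrightarrow> pt D g \<Longrightarrow> pt D (\<lambda>W x. eqW W (f W x) (g W x))"
  unfolding eqW_def eq_step_def by (intro pt_arith pt_fold pt_case_list)

lemmas pt_intros = pt_arith pt_fold pt_rev pt_map pt_filter pt_list_ex pt_append pt_concat pt_mul pt_nth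
  pt_upt pt_div pt_eqW pt_tl pt_case_list

section \<open>The program\<close>

text \<open>\<open>pt\<close> speaks of one argument; several arguments are packed into nested
  pairs. Each function of the program is treated once in this form and then applied to computed
  arguments by \<open>pt2\<close> to \<open>pt5\<close>.\<close>

abbreviation "pt_2 D F \<equiv> pt D (\<lambda>W y. F W (fst y) (snd y))"
abbreviation "pt_3 D F \<equiv> pt D (\<lambda>W y. F W (fst y) (fst (snd y)) (snd (snd y)))"
abbreviation "pt_4 D F \<equiv> pt D (\<lambda>W y. F W (fst y) (fst (snd y)) (fst (snd (snd y))) (snd (snd (snd y))))"
abbreviation "pt_5 D F \<equiv> pt D (\<lambda>W y. F W (fst y) (fst (snd y)) (fst (snd (snd y))) (fst (snd (snd (snd y)))) (snd (snd (snd (snd y)))))"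

lemma pt2: "pt_2 D F \<Longrightarrow> pt D a \<Longrightarrow> pt D b \<Longrightarrow> pt D (\<lambda>W x. F W (a W x) (b W x))"
  using pt_compose[of D "\<lambda>W y. F W (fst y) (snd y)" "\<lambda>W x. (a W x, b W x)"] by (simp add: pt_pair)

lemma pt3: "pt_3 D F \<Longrightarrow> pt D a \<Longrightarrow> pt D b \<Longrightarrow> pt D c \<Longrightarrow>
    pt D (\<lambda>W x. F W (a W x) (b W x) (c W x))"
  using pt_compose[of D "\<lambda>W y. F W (fst y) (fst (snd y)) (snd (snd y))" "\<lambda>W x. (a W x, b W x, c W x)"]
  by (simp add: pt_pair)

lemma pt4: "pt_4 D F \<Longrightarrow>
    pt D a \<Longrightarrow> pt D b \<Longrightarrow> pt D c \<Longrightarrow> pt D d \<Longrightarrow> pt D (\<lambda>W x. F W (a W x) (b W x) (c W x) (d W x))"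
  using pt_compose[of D "\<lambda>W y. F W (fst y) (fst (snd y)) (fst (snd (snd y))) (snd (snd (snd y)))"
     "\<lambda>W x. (a W x, b W x, c W x, d W x)"] by (simp add: pt_pair)

lemma pt5: "pt_5 D F \<Longrightarrow>
    pt D a \<Longrightarrow> pt D b \<Longrightarrow> pt D c \<Longrightarrow> pt D d \<Longrightarrow> pt D e \<Longrightarrow>
    pt D (\<lambda>W x. F W (a W x) (b W x) (c W x) (d W x) (e W x))"
  using pt_compose[of D "\<lambda>W y. F W (fst y) (fst (snd y)) (fst (snd (snd y))) (fst (snd (snd (snd y)))) (snd (snd (snd (snd y))))"
     "\<lambda>W x. (a W x, b W x, c W x, d W x, e W x)"] by (simp add: pt_pair)

lemma pt_null: "pt D l \<Longrightarrow> pt D (\<lambda>W x. l W x = [])"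
  by (rule pt_cong[OF pt_case_list[OF _ pt_True pt_False, of D l]]) (auto split: list.splits)

text \<open>An entry consists of job, type (0 for the server, \<open>Suc c\<close> for cloud context \<open>c\<close>), server number
  (0 on the cloud) and completion time; a state consists of its cost and its entries, latest first.\<close>

type_synonym entry = "nat \<times> nat \<times> nat \<times> nat"
type_synonym pstate = "nat \<times> entry list"

abbreviation "e_job (e :: entry) \<equiv> fst e"
abbreviation "e_ty (e :: entry) \<equiv> fst (snd e)"
abbreviation "e_srv (e :: entry) \<equiv> fst (snd (snd e))"
abbreviation "e_C (e :: entry) \<equiv> snd (snd (snd e))"

definition edgeW :: "nat \<Rightarrow> nat list \<Rightarrow> nat \<Rightarrow> nat \<Rightarrow> bool" where
  "edgeW W xs i j \<longleftrightarrow> nthW W xs (6 + mulW W i (nthW W xs 0) + j) = 1"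

text \<open>After the header of length 6 come \<open>n\<close> rows of the adjacency matrix, the row
  of server times and one row per cloud context, so type \<open>ty\<close> is row
  \<open>n + ty\<close>.\<close>

definition ptimeW :: "nat \<Rightarrow> nat list \<Rightarrow> nat \<Rightarrow> nat \<Rightarrow> nat" where
  "ptimeW W xs ty j = nthW W xs (6 + mulW W (nthW W xs 0 + ty) (nthW W xs 0) + j)"

text \<open>Here \<open>k\<close> counts machine types, the server included;
  \<open>(n + k) * n\<close> skips the adjacency matrix and all processing times.\<close>

definition delayW :: "nat \<Rightarrow> nat list \<Rightarrow> nat \<Rightarrow> nat \<Rightarrow> nat \<Rightarrow> nat \<Rightarrow> nat" where
  "delayW W xs t1 t2 i j = (let n = nthW W xs 0; k = Suc (nthW W xs 4) in
     nthW W xs (6 + mulW W (n + k) n + mulW W (mulW W (mulW W t1 k + t2) n + i) n + j))"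

definition costW :: "nat \<Rightarrow> nat list \<Rightarrow> nat \<Rightarrow> nat \<Rightarrow> nat" where
  "costW W xs j ty = (if ty = 0 then 0 else let n = nthW W xs 0; k = Suc (nthW W xs 4) in
     nthW W xs (6 + mulW W (n + k) n + mulW W (mulW W (mulW W k k) n) n + mulW W j (nthW W xs 4) + (ty - 1)))"

definition schedW :: "nat \<Rightarrow> entry list \<Rightarrow> nat \<Rightarrow> bool" where
  "schedW W h j = list_ex (\<lambda>e. e_job e = j) (take W h)"

definition readyW :: "nat \<Rightarrow> nat list \<Rightarrow> entry list \<Rightarrow> nat \<Rightarrow> bool" where
  "readyW W xs h j \<longleftrightarrow> \<not> schedW W h j \<and>
     \<not> list_ex (\<lambda>i. edgeW W xs i j \<and> \<not> schedW W h i) (take W (uptW W (nthW W xs 0)))"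

definition liveW :: "nat \<Rightarrow> nat list \<Rightarrow> entry list \<Rightarrow> nat \<Rightarrow> bool" where
  "liveW W xs h j \<longleftrightarrow> list_ex (\<lambda>i. edgeW W xs j i \<and> \<not> schedW W h i) (take W (uptW W (nthW W xs 0)))"

text \<open>A predecessor on the same server is covered by the edge term, which is at least its
  completion time. Jobs are appended to a server and never put into a gap; this loses nothing, as a
  given schedule is rebuilt in order of start times.\<close>

definition startW :: "nat \<Rightarrow> nat list \<Rightarrow> entry list \<Rightarrow> nat \<Rightarrow> nat \<times> nat \<Rightarrow> nat" where
  "startW W xs h j l = fold (\<lambda>e s. max s
     (if edgeW W xs (e_job e) j then e_C e + delayW W xs (e_ty e) (fst l) (e_job e) j
      else if fst l = 0 \<and> e_ty e = 0 \<and> e_srv e = snd l then e_C e else 0)) (take W h) 0"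

definition extW :: "nat \<Rightarrow> nat list \<Rightarrow> pstate \<Rightarrow> nat \<Rightarrow> nat \<times> nat \<Rightarrow> pstate" where
  "extW W xs s j l = (fst s + costW W xs j (fst l),
     (j, fst l, snd l, startW W xs (snd s) j l + ptimeW W xs (fst l) j) # snd s)"

definition locsW :: "nat \<Rightarrow> nat \<Rightarrow> nat list \<Rightarrow> nat \<Rightarrow> (nat \<times> nat) list" where
  "locsW z W xs j = take W (map (\<lambda>m. (0, m)) (take W (uptW W z))) @
     (if j = nthW W xs 1 \<or> j = nthW W xs 2 then []
      else map (\<lambda>c. (Suc c, 0)) (take W (uptW W (nthW W xs 4))))"

text \<open>The values 0 and 1 separate unscheduled jobs from scheduled ones whose type no longer
  matters, so that the tags also determine the set of scheduled jobs.\<close>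

definition tagW :: "nat \<Rightarrow> nat list \<Rightarrow> entry list \<Rightarrow> nat \<Rightarrow> nat" where
  "tagW W xs h j = fold (\<lambda>e s. if e_job e = j then (if liveW W xs h j then Suc (Suc (e_ty e)) else 1) else s)
     (take W h) 0"

definition bucketW :: "nat \<Rightarrow> nat list \<Rightarrow> nat \<Rightarrow> entry list \<Rightarrow> nat \<Rightarrow> nat" where
  "bucketW W xs \<delta> h j = fold (\<lambda>e s. if e_job e = j \<and> liveW W xs h j then divW W (e_C e) \<delta> else s) (take W h) 0"

definition freeW :: "nat \<Rightarrow> entry list \<Rightarrow> nat \<Rightarrow> nat" where
  "freeW W h m = fold (\<lambda>e s. if e_ty e = 0 \<and> e_srv e = m then max s (e_C e) else s) (take W h) 0"

definition keyW :: "nat \<Rightarrow> nat \<Rightarrow> nat list \<Rightarrow> nat \<Rightarrow> entry list \<Rightarrow> nat list \<times> nat list \<times> nat list" where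
  "keyW z W xs \<delta> h = (map (\<lambda>j. tagW W xs h j) (take W (uptW W (nthW W xs 0))),
     map (\<lambda>j. bucketW W xs \<delta> h j) (take W (uptW W (nthW W xs 0))),
     map (\<lambda>m. divW W (freeW W h m) \<delta>) (take W (uptW W z)))"

definition sameW :: "nat \<Rightarrow> nat list \<times> nat list \<times> nat list \<Rightarrow> nat list \<times> nat list \<times> nat list \<Rightarrow> bool" where
  "sameW W a b \<longleftrightarrow> eqW W (fst a) (fst b) \<and> eqW W (fst (snd a)) (fst (snd b)) \<and> eqW W (snd (snd a)) (snd (snd b))"

definition insW :: "nat \<Rightarrow> nat \<Rightarrow> nat list \<Rightarrow> nat \<Rightarrow> pstate \<Rightarrow> pstate list \<Rightarrow> pstate list" where
  "insW z W xs \<delta> s L =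
    (if list_ex (\<lambda>t. sameW W (keyW z W xs \<delta> (snd t)) (keyW z W xs \<delta> (snd s)) \<and> fst t \<le> fst s) (take W L) then L
     else s # filter (\<lambda>t. \<not> sameW W (keyW z W xs \<delta> (snd t)) (keyW z W xs \<delta> (snd s))) (take W L))"

definition succsW :: "nat \<Rightarrow> nat \<Rightarrow> nat list \<Rightarrow> pstate \<Rightarrow> pstate list" where
  "succsW z W xs s = concat (map (take W) (take W (map (\<lambda>j. map (\<lambda>l. extW W xs s j l) (take W (locsW z W xs j)))
     (take W (filter (\<lambda>j. readyW W xs (snd s) j) (take W (uptW W (nthW W xs 0))))))))"

text \<open>Testing the latest entry suffices, since the older ones passed this test when they were
  added.\<close>

definition okW :: "nat \<Rightarrow> nat list \<Rightarrow> nat \<Rightarrow> pstate \<Rightarrow> bool" where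
  "okW W xs U s \<longleftrightarrow> fst s \<le> nthW W xs 5 \<and> (case snd s of [] \<Rightarrow> False | e # es \<Rightarrow> e_C e \<le> U)"

definition candsW :: "nat \<Rightarrow> nat \<Rightarrow> nat list \<Rightarrow> nat \<Rightarrow> pstate list \<Rightarrow> pstate list" where
  "candsW z W xs U L = filter (\<lambda>s. okW W xs U s)
     (take W (concat (map (take W) (take W (map (\<lambda>s. succsW z W xs s) (take W L))))))"

definition layerW :: "nat \<Rightarrow> nat \<Rightarrow> nat list \<Rightarrow> nat \<Rightarrow> nat \<Rightarrow> pstate list \<Rightarrow> pstate list" where
  "layerW z W xs \<delta> U L = fold (\<lambda>s a. insW z W xs \<delta> s a) (take W (candsW z W xs U L)) []"

definition dpW :: "nat \<Rightarrow> nat \<Rightarrow> nat list \<Rightarrow> nat \<Rightarrow> nat \<Rightarrow> pstate list" where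
  "dpW z W xs \<delta> U = fold (\<lambda>i L. layerW z W xs \<delta> U L) (take W (uptW W (nthW W xs 0))) [(0, [])]"

text \<open>The enclosing loop cannot be left early; a nonempty result freezes the state
  instead.\<close>

definition search_step :: "nat \<Rightarrow> nat \<Rightarrow> nat list \<Rightarrow> nat \<Rightarrow> nat \<times> nat \<times> pstate list \<Rightarrow> nat \<times> nat \<times> pstate list" where
  "search_step z W xs M st = (if snd (snd st) = [] then
     (let r = dpW z W xs (fst st) (mulW W (fst st) (fst (snd st))) in
      if r = [] then (if fst (snd st) < M then (fst st, Suc (fst (snd st)), []) else (fst st + fst st, 0, []))
      else (fst st, fst (snd st), r)) else st)"

definition horizonW :: "nat \<Rightarrow> nat list \<Rightarrow> nat \<Rightarrow> nat" where
  "horizonW W xs e = (let n = Suc (nthW W xs 0) in mulW W (n + n) e + n)"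

definition searchW :: "nat \<Rightarrow> nat \<Rightarrow> nat list \<Rightarrow> nat \<Rightarrow> nat \<times> nat \<times> pstate list" where
  "searchW z W xs e = (search_step z W xs (horizonW W xs e) ^^ W) (1, 0, [])"

definition complW :: "nat \<Rightarrow> entry list \<Rightarrow> nat \<Rightarrow> nat" where
  "complW W h j = fold (\<lambda>e s. if e_job e = j then e_C e else s) (take W h) 0"

text \<open>Type \<open>ty > 0\<close> is context \<open>ty - 1\<close>, whose code is 2 * (ty - 1)
  + 1 = ty + ty - 1.\<close>

definition codeW :: "nat \<Rightarrow> entry list \<Rightarrow> nat \<Rightarrow> nat" where
  "codeW W h j = fold (\<lambda>e s. if e_job e = j then (if e_ty e = 0 then e_srv e + e_srv e else e_ty e + e_ty e - 1) else s)
     (take W h) 0"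

definition outW :: "nat \<Rightarrow> nat list \<Rightarrow> entry list \<Rightarrow> nat list" where
  "outW W xs h = concat (map (take W) (take W (map (\<lambda>j. [complW W h j, codeW W h j]) (take W (uptW W (nthW W xs 0))))))"

text \<open>The format expected by \<open>epilogue\<close>; the five zeros provide an entry for each
  of the registers 1 to 5 even if the output is shorter.\<close>

definition packW :: "nat \<Rightarrow> nat list \<Rightarrow> nat \<times> nat list" where
  "packW W ys = (let ws = take W ys @ [0, 0, 0, 0, 0]; n = fold (\<lambda>y s. Suc s) (take W ys) 0
     in (n + 5, take W (rev (take W (tl ws))) @ [n, nthW W ws 0]))"

text \<open>Meant for the reversed input, where the nine displaced entries are in front: moving them
  to the end yields the reversal of the original list, whose head is \<open>e\<close>.\<close>

definition unrotateW :: "nat \<Rightarrow> nat list \<Rightarrow> nat list" where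
  "unrotateW W zs = take W (tl (tl (tl (tl (tl (tl (tl (tl (tl zs))))))))) @
     [nthW W zs 0, nthW W zs 1, nthW W zs 2, nthW W zs 3, nthW W zs 4, nthW W zs 5, nthW W zs 6, nthW W zs 7, nthW W zs 8]"

definition mainW :: "nat \<Rightarrow> nat \<Rightarrow> nat list \<Rightarrow> nat \<times> nat list" where
  "mainW z W ys = (let us = unrotateW W (rev (take W ys)); xs = rev (take W us);
     r = searchW z W xs (nthW W us 0)
     in packW W (case snd (snd r) of [] \<Rightarrow> [] | s # ss \<Rightarrow> outW W xs (snd s)))"

section \<open>Polynomial running time of the program\<close>

lemma pt_edgeW0: "pt_3 D edgeW"
  unfolding edgeW_def by (intro pt_intros)
lemmas pt_edgeW = pt3[OF pt_edgeW0]

lemma pt_ptimeW0: "pt_3 D ptimeW"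
  unfolding ptimeW_def by (intro pt_intros)
lemmas pt_ptimeW = pt3[OF pt_ptimeW0]

lemma pt_delayW0: "pt_5 D delayW"
  unfolding delayW_def by (intro pt_intros)
lemmas pt_delayW = pt5[OF pt_delayW0]

lemma pt_costW0: "pt_3 D costW"
  unfolding costW_def by (intro pt_intros)
lemmas pt_costW = pt3[OF pt_costW0]

lemma pt_schedW0: "pt_2 D schedW"
  unfolding schedW_def by (intro pt_intros)
lemmas pt_schedW = pt2[OF pt_schedW0]

lemma pt_readyW0: "pt_3 D readyW"
  unfolding readyW_def by (intro pt_intros pt_edgeW pt_schedW)
lemmas pt_readyW = pt3[OF pt_readyW0]

lemma pt_liveW0: "pt_3 D liveW"
  unfolding liveW_def by (intro pt_intros pt_edgeW pt_schedW)
lemmas pt_liveW = pt3[OF pt_liveW0]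

lemma pt_startW0: "pt_4 D startW"
  unfolding startW_def by (intro pt_intros pt_edgeW pt_delayW)
lemmas pt_startW = pt4[OF pt_startW0]

lemma pt_extW0: "pt_4 D extW"
  unfolding extW_def by (intro pt_intros pt_costW pt_startW pt_ptimeW)
lemmas pt_extW = pt4[OF pt_extW0]

lemma pt_locsW0: "pt_2 D (locsW z)"
  unfolding locsW_def by (intro pt_intros)
lemmas pt_locsW = pt2[OF pt_locsW0]

lemma pt_tagW0: "pt_3 D tagW"
  unfolding tagW_def by (intro pt_intros pt_liveW)
lemmas pt_tagW = pt3[OF pt_tagW0]

lemma pt_bucketW0: "pt_4 D bucketW"
  unfolding bucketW_def by (intro pt_intros pt_liveW)
lemmas pt_bucketW = pt4[OF pt_bucketW0]

lemma pt_freeW0: "pt_2 D freeW"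
  unfolding freeW_def by (intro pt_intros)
lemmas pt_freeW = pt2[OF pt_freeW0]

lemma pt_keyW0: "pt_3 D (keyW z)"
  unfolding keyW_def by (intro pt_intros pt_tagW pt_bucketW pt_freeW)
lemmas pt_keyW = pt3[OF pt_keyW0]

lemma pt_sameW0: "pt_2 D sameW"
  unfolding sameW_def by (intro pt_intros)
lemmas pt_sameW = pt2[OF pt_sameW0]

lemma pt_insW0: "pt_4 D (insW z)"
  unfolding insW_def by (intro pt_intros pt_sameW pt_keyW)
lemmas pt_insW = pt4[OF pt_insW0]

lemma pt_succsW0: "pt_2 D (succsW z)"
  unfolding succsW_def by (intro pt_intros pt_extW pt_readyW pt_locsW)
lemmas pt_succsW = pt2[OF pt_succsW0]

lemma pt_okW0: "pt_3 D okW"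
  unfolding okW_def by (intro pt_intros)
lemmas pt_okW = pt3[OF pt_okW0]

lemma pt_candsW0: "pt_3 D (candsW z)"
  unfolding candsW_def by (intro pt_intros pt_okW pt_succsW)
lemmas pt_candsW = pt3[OF pt_candsW0]

lemma pt_layerW0: "pt_4 D (layerW z)"
  unfolding layerW_def by (intro pt_intros pt_candsW pt_insW)
lemmas pt_layerW = pt4[OF pt_layerW0]

lemma pt_dpW0: "pt_3 D (dpW z)"
  unfolding dpW_def by (intro pt_intros pt_layerW)
lemmas pt_dpW = pt3[OF pt_dpW0]

lemma pt_search_step0: "pt_3 D (search_step z)"
  unfolding search_step_def by (intro pt_intros pt_dpW pt_null)
lemmas pt_search_step = pt3[OF pt_search_step0]

lemma pt_horizonW0: "pt_2 D horizonW"
  unfolding horizonW_def by (intro pt_intros)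
lemmas pt_horizonW = pt2[OF pt_horizonW0]

lemma pt_searchW0: "pt_2 D (searchW z)"
  unfolding searchW_def by (intro pt_intros pt_iter pt_horizonW pt_search_step)
lemmas pt_searchW = pt2[OF pt_searchW0]

lemma pt_complW0: "pt_2 D complW"
  unfolding complW_def by (intro pt_intros)
lemmas pt_complW = pt2[OF pt_complW0]

lemma pt_codeW0: "pt_2 D codeW"
  unfolding codeW_def by (intro pt_intros)
lemmas pt_codeW = pt2[OF pt_codeW0]

lemma pt_outW0: "pt_2 D outW"
  unfolding outW_def by (intro pt_intros pt_complW pt_codeW)
lemmas pt_outW = pt2[OF pt_outW0]

lemma pt_packW0: "pt D (\<lambda>W y. packW W y)"
  unfolding packW_def by (intro pt_intros)
lemmas pt_packW = pt_compose[OF pt_packW0]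

lemma pt_unrotateW0: "pt D (\<lambda>W y. unrotateW W y)"
  unfolding unrotateW_def by (intro pt_intros)
lemmas pt_unrotateW = pt_compose[OF pt_unrotateW0]

lemma pt_mainW: "pt D (\<lambda>W ys. mainW z W ys)"
  unfolding mainW_def by (intro pt_intros pt_packW pt_unrotateW pt_searchW pt_outW)

section \<open>Partial schedules\<close>

lemma length_concat_uniform:
  "(\<And>x. x \<in> set xs \<Longrightarrow> length (g x) = m) \<Longrightarrow> length (concat (map g xs)) = length xs * m"
  by (induction xs) auto

lemma nth_concat_uniform:
  "(\<And>x. x \<in> set xs \<Longrightarrow> length (g x) = m) \<Longrightarrow> i < length xs \<Longrightarrow> j < m \<Longrightarrow>
   concat (map g xs) ! (i * m + j) = g (xs ! i) ! j"
proof (induction xs arbitrary: i)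
  case (Cons x xs)
  show ?case
  proof (cases i)
    case 0
    then show ?thesis using Cons.prems by (simp add: nth_append)
  next
    case (Suc i')
    have "length (g x) = m" using Cons.prems by simp
    then show ?thesis using Cons.IH[of i'] Cons.prems Suc by (simp add: nth_append)
  qed
qed simp

lemma grid_less: "i < a \<Longrightarrow> j < b \<Longrightarrow> i * b + j < a * (b::nat)"
proof -
  assume "i < a" "j < b"
  then have "i * b + j < Suc i * b" by simp
  also have "\<dots> \<le> a * b" using \<open>i < a\<close> by (intro mult_le_mono1) simp
  finally show ?thesis .
qed

fun mty :: "nat \<Rightarrow> nat option" where
  "mty 0 = None" | "mty (Suc c) = Some c"

locale instance_input =
  fixes I :: inst and e W z :: nat and xs :: "nat list"
  assumes wf: "wf_inst I" and nz: "nz I = z" and xs: "xs = enc I @ [e]" and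
    lenW: "length xs \<le> W" and zkW: "z + nk I \<le> W" and e1: "1 \<le> e"
begin

abbreviation "n \<equiv> nj I"
abbreviation "k \<equiv> nk I"
abbreviation "E \<equiv> edges I"
abbreviation "edge \<equiv> edgeW W xs"
abbreviation "ptm \<equiv> ptimeW W xs"
abbreviation "delay \<equiv> delayW W xs"
abbreviation "price \<equiv> costW W xs"
abbreviation "ready \<equiv> readyW W xs"
abbreviation "live \<equiv> liveW W xs"
abbreviation "start \<equiv> startW W xs"
abbreviation "grow \<equiv> extW W xs"
abbreviation "locs \<equiv> locsW z W xs"
abbreviation "succs \<equiv> succsW z W xs"
abbreviation "free_at \<equiv> freeW W"

definition "header = [nj I, src I, snk I, nz I, nk I, bud I]"
definition "edge_part = [if (i, j) \<in> edges I then 1 else 0. i \<leftarrow> [0..<nj I], j \<leftarrow> [0..<nj I]]"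
definition "time_part = map (ps I) [0..<nj I] @
   [if j = src I \<or> j = snk I then 0 else pcl I c j. c \<leftarrow> [0..<nk I], j \<leftarrow> [0..<nj I]]"
definition "delay_part = [if (i, j) \<in> edges I then dly I m1 m2 i j else 0.
        m1 \<leftarrow> mtypes I, m2 \<leftarrow> mtypes I, i \<leftarrow> [0..<nj I], j \<leftarrow> [0..<nj I]]"
definition "cost_part = [if j = src I \<or> j = snk I then 0 else cst I j c. j \<leftarrow> [0..<nj I], c \<leftarrow> [0..<nk I]]"

lemma xs_parts: "xs = header @ edge_part @ time_part @ delay_part @ cost_part @ [e]"
  unfolding xs enc_def header_def edge_part_def time_part_def delay_part_def cost_part_def by simp

lemma len_header: "length header = 6" by (simp add: header_def)

lemma n_pos: "0 < n" using wf by (auto simp: wf_inst_def)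

lemma z_pos: "0 < z" using wf nz by (auto simp: wf_inst_def)

lemma len_mtypes: "length (mtypes I) = Suc k" by (simp add: mtypes_def)

lemma len_edge: "length edge_part = n * n"
  unfolding edge_part_def by (subst length_concat_uniform[where m = n]) auto

lemma len_time: "length time_part = Suc k * n"
  unfolding time_part_def length_append by (subst length_concat_uniform[where m = n]) auto

lemma len_delay: "length delay_part = Suc k * (Suc k * (n * n))"
  unfolding delay_part_def
  by (subst length_concat_uniform[where m = "Suc k * (n * n)"])
    (auto simp: len_mtypes length_concat_uniform[where m = "n * n"] length_concat_uniform[where m = n])

lemma len_cost: "length cost_part = n * k"
  unfolding cost_part_def by (subst length_concat_uniform[where m = k]) auto

lemma length_xs: "length xs = 6 + n * n + Suc k * n + Suc k * (Suc k * (n * n)) + n * k + 1"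
  unfolding xs_parts by (simp add: header_def len_edge len_time len_delay len_cost)

lemma n_le: "n \<le> W" and k_le: "Suc k \<le> W" and two_n: "2 * n + 5 \<le> length xs" and len10: "10 \<le> length xs"
proof -
  have 1: "n \<le> n * n" "Suc k \<le> Suc k * n" "1 \<le> n * n" "n \<le> Suc k * n" using n_pos mult_le_mono2[of 1 n "Suc k"] by simp_all
  have "1 * 1 \<le> Suc k * n" using n_pos by (intro mult_le_mono) auto
  moreover have "1 * (1 * 1) \<le> Suc k * (Suc k * (n * n))" using n_pos by (intro mult_le_mono) auto
  ultimately show "n \<le> W" "Suc k \<le> W" "2 * n + 5 \<le> length xs" "10 \<le> length xs"
    using 1 lenW length_xs by linarith+
qed

lemma z_le: "z \<le> W" using zkW by simp

lemma nthW_xs: "i < length xs \<Longrightarrow> nthW W xs i = xs ! i"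
  using lenW by (intro nthW_eq) auto

lemma header_nth: "nthW W xs 0 = n" "nthW W xs (Suc 0) = src I" "nthW W xs 2 = snk I" "xs ! 3 = z" "nthW W xs 4 = k" "nthW W xs 5 = bud I"
proof -
  have "i < 6 \<Longrightarrow> xs ! i = header ! i" for i unfolding xs_parts by (simp add: nth_append len_header)
  moreover have "i < 6 \<Longrightarrow> nthW W xs i = xs ! i" for i using length_xs by (intro nthW_xs) simp
  ultimately show "nthW W xs 0 = n" "nthW W xs (Suc 0) = src I" "nthW W xs 2 = snk I" "xs ! 3 = z" "nthW W xs 4 = k" "nthW W xs 5 = bud I"
    using nz by (simp_all add: header_def)
qed

lemma mulW_n: "mulW W a n = a * n" and mulW_k: "mulW W a k = a * k" and mulW_Suc_k: "mulW W a (Suc k) = a * Suc k"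
  using n_le k_le by (simp_all add: mulW_def min_absorb1)

lemma upt_n: "take W (uptW W n) = [0..<n]" using n_le by (simp add: uptW_eq)

lemma upt_k: "take W (uptW W k) = [0..<k]" using k_le by (simp add: uptW_eq)

lemma upt_z: "take W (uptW W z) = [0..<z]" using z_le by (simp add: uptW_eq)

lemma nth_part:
  assumes "i < length part" "xs = pre @ part @ post"
  shows "nthW W xs (length pre + i) = part ! i"
proof -
  have "nthW W xs (length pre + i) = xs ! (length pre + i)" by (rule nthW_xs) (use assms in simp)
  also have "\<dots> = part ! i" using assms(1) by (subst assms(2)) (simp add: nth_append)
  finally show ?thesis .
qed

lemma edgeW_iff: assumes "i < n" "j < n" shows "edge i j \<longleftrightarrow> (i, j) \<in> E"
proof -
  have "nthW W xs (length header + (i * n + j)) = edge_part ! (i * n + j)"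
    by (rule nth_part[OF _ xs_parts]) (simp add: len_edge grid_less assms)
  also have "\<dots> = (if (i, j) \<in> E then 1 else 0)"
    unfolding edge_part_def using assms by (subst nth_concat_uniform[where m = n]) auto
  finally have "nthW W xs (6 + i * n + j) = (if (i, j) \<in> E then 1 else 0)" by (simp only: len_header add.assoc)
  then show ?thesis unfolding edgeW_def header_nth mulW_n by simp
qed

lemma ptimeW_eq:
  assumes "ty \<le> k" "j < n"
  shows "ptm ty j = (if ty = 0 then ps I j else if j = src I \<or> j = snk I then 0 else pcl I (ty - 1) j)"
proof -
  have "ptm ty j = nthW W xs (length (header @ edge_part) + (ty * n + j))"
    unfolding ptimeW_def header_nth mulW_n
    by (rule arg_cong[of _ _ "nthW W xs"]) (simp add: len_header len_edge algebra_simps)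
  also have "nthW W xs (length (header @ edge_part) + (ty * n + j)) = time_part ! (ty * n + j)"
    by (rule nth_part) (use assms in \<open>simp_all add: len_time xs_parts grid_less del: mult_Suc\<close>)
  also have "\<dots> = (if ty = 0 then ps I j else if j = src I \<or> j = snk I then 0 else pcl I (ty - 1) j)"
  proof (cases ty)
    case 0 then show ?thesis using assms by (simp add: time_part_def nth_append)
  next
    case (Suc c)
    then have "time_part ! (ty * n + j) =
       [if j = src I \<or> j = snk I then 0 else pcl I c j. c \<leftarrow> [0..<nk I], j \<leftarrow> [0..<nj I]] ! (c * n + j)"
      by (simp add: time_part_def nth_append)
    also have "\<dots> = (if j = src I \<or> j = snk I then 0 else pcl I c j)"
      using assms Suc by (subst nth_concat_uniform[where m = n]) auto
    finally show ?thesis using Suc by simp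
  qed
  finally show ?thesis .
qed

lemma mtypes_nth: "t \<le> k \<Longrightarrow> mtypes I ! t = mty t"
  by (cases t) (auto simp: mtypes_def)

lemma delayW_eq:
  assumes "t1 \<le> k" "t2 \<le> k" "(i, j) \<in> E"
  shows "delay t1 t2 i j = dly I (mty t1) (mty t2) i j"
proof -
  have ij: "i < n" "j < n" using assms wf by (auto simp: wf_inst_def)
  \<comment> \<open>The position in the four-dimensional table as a mixed-radix number;
    \<open>b1\<close> to \<open>b3\<close> bound it digit by digit.\<close>
  define ix where "ix = t1 * (Suc k * (n * n)) + (t2 * (n * n) + (i * n + j))"
  have b1: "i * n + j < n * n" using ij by (rule grid_less)
  have b2: "t2 * (n * n) + (i * n + j) < Suc k * (n * n)" by (rule grid_less) (use assms b1 in auto)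
  have b3: "ix < Suc k * (Suc k * (n * n))" unfolding ix_def by (rule grid_less) (use assms b2 in auto)
  have "delay t1 t2 i j = nthW W xs (length (header @ edge_part @ time_part) + ix)"
    unfolding delayW_def header_nth mulW_n mulW_Suc_k Let_def
    by (rule arg_cong[of _ _ "nthW W xs"]) (simp add: len_header len_edge len_time ix_def algebra_simps)
  also have "nthW W xs (length (header @ edge_part @ time_part) + ix) = delay_part ! ix"
    by (rule nth_part) (use b3 in \<open>simp_all add: len_delay xs_parts del: mult_Suc\<close>)
  also have "\<dots> = dly I (mty t1) (mty t2) i j"
  proof -
    have l1: "length (map (\<lambda>j. if (i, j) \<in> E then dly I m1 m2 i j else 0) [0..<n]) = n" for m1 m2 i by simp
    have l2: "length [if (i, j) \<in> E then dly I m1 m2 i j else 0. i \<leftarrow> [0..<n], j \<leftarrow> [0..<n]] = n * n" for m1 m2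
      by (subst length_concat_uniform[where m = n]) auto
    have l3: "length [if (i, j) \<in> E then dly I m1 m2 i j else 0. m2 \<leftarrow> mtypes I, i \<leftarrow> [0..<n], j \<leftarrow> [0..<n]] = Suc k * (n * n)" for m1
      by (subst length_concat_uniform[where m = "n * n"]) (simp_all only: l2 len_mtypes)
    show ?thesis unfolding delay_part_def ix_def
      apply (subst nth_concat_uniform[OF l3 _ b2]) 
      subgoal using assms by (simp add: len_mtypes)
      apply (subst nth_concat_uniform[OF l2 _ b1]) 
      subgoal using assms by (simp add: len_mtypes)
      apply (subst nth_concat_uniform[OF l1])
      using assms ij by (auto simp: mtypes_nth)
  qed
  finally show ?thesis .
qed

lemma costW_eq:
  assumes "ty \<le> k" "j < n" "ty = 0 \<or> j \<noteq> src I \<and> j \<noteq> snk I"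
  shows "price j ty = (if ty = 0 then 0 else cst I j (ty - 1))"
proof (cases ty)
  case 0 then show ?thesis by (simp add: costW_def)
next
  case (Suc c)
  have "price j ty = nthW W xs (length (header @ edge_part @ time_part @ delay_part) + (j * k + c))"
    unfolding costW_def header_nth mulW_n mulW_k mulW_Suc_k Let_def using Suc
    by (simp add: len_header len_edge len_time len_delay algebra_simps)
  also have "nthW W xs (length (header @ edge_part @ time_part @ delay_part) + (j * k + c)) = cost_part ! (j * k + c)"
    by (rule nth_part) (use assms Suc in \<open>simp_all add: len_cost xs_parts grid_less\<close>)
  also have "\<dots> = cst I j c"
    unfolding cost_part_def using assms Suc by (subst nth_concat_uniform[where m = k]) auto
  finally show ?thesis using Suc by simp
qed

lemma locsW_set:
  "set (locs j) = {(0, m) |m. m < z} \<union> (if j = src I \<or> j = snk I then {} else {(Suc c, 0) |c. c < k})"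
  and length_locsW: "length (locs j) \<le> z + k"
  using z_le by (auto simp: locsW_def upt_z upt_k header_nth)

end

section \<open>Histories and the schedules they represent\<close>

lemma fold_max_le: "fold (\<lambda>e s. max s (g e)) h a \<le> B \<longleftrightarrow> a \<le> B \<and> (\<forall>e\<in>set h. g e \<le> (B::nat))"
  by (induction h arbitrary: a) auto

lemma fold_cond_max_le:
  "fold (\<lambda>e s. if p e then max s (g e) else s) h a \<le> B \<longleftrightarrow> a \<le> B \<and> (\<forall>e\<in>set h. p e \<longrightarrow> g e \<le> (B::nat))"
  by (induction h arbitrary: a) auto

lemma fold_lookup_none: "j \<notin> fst ` set h \<Longrightarrow> fold (\<lambda>e s. if fst e = j \<and> Q then g e else s) h a = a"
  by (induction h arbitrary: a) auto

lemma fold_lookup: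
  assumes "distinct (map fst h)" "e \<in> set h"
  shows "fold (\<lambda>e' s. if fst e' = fst e \<and> Q then g e' else s) h a = (if Q then g e else a)"
  using assms
proof (induction h arbitrary: a)
  case (Cons x h)
  show ?case
  proof (cases "x = e")
    case True
    then have "fst e \<notin> fst ` set h" using Cons.prems by auto
    then show ?thesis using True fold_lookup_none[of "fst e" h Q g] by simp
  next
    case False
    then have "e \<in> set h" "fst x \<noteq> fst e" using Cons.prems by (auto simp: image_iff)
    then show ?thesis using Cons by simp
  qed
qed simp

context instance_input
begin

text \<open>Extension alone, without pruning, budget or horizon: that the output is a valid schedule
  rests on this invariant and on all jobs being present.\<close>

inductive hist :: "entry list \<Rightarrow> bool" where
  hist_Nil: "hist []"
| hist_Cons: "hist h \<Longrightarrow> j < n \<Longrightarrow> ready h j \<Longrightarrow> l \<in> set (locs j) \<Longrightarrow>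
    hist ((j, fst l, snd l, start h j l + ptm (fst l) j) # h)"

abbreviation jobs :: "entry list \<Rightarrow> nat set" where "jobs h \<equiv> fst ` set h"

lemma E_bounds: "(i, j) \<in> E \<Longrightarrow> i < n \<and> j < n"
  using wf by (auto simp: wf_inst_def)

lemma schedW_iff: "length h \<le> W \<Longrightarrow> schedW W h j \<longleftrightarrow> j \<in> jobs h"
  by (auto simp: schedW_def list_ex_iff image_iff)

lemma readyW_iff:
  "length h \<le> W \<Longrightarrow> j < n \<Longrightarrow> ready h j \<longleftrightarrow> j \<notin> jobs h \<and> (\<forall>i. (i, j) \<in> E \<longrightarrow> i \<in> jobs h)"
  unfolding readyW_def header_nth upt_n
  using E_bounds by (auto simp: schedW_iff list_ex_iff edgeW_iff)

lemma liveW_iff: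
  "length h \<le> W \<Longrightarrow> j < n \<Longrightarrow> live h j \<longleftrightarrow> (\<exists>i. (j, i) \<in> E \<and> i \<notin> jobs h)"
  unfolding liveW_def header_nth upt_n
  using E_bounds by (fastforce simp: schedW_iff list_ex_iff edgeW_iff)

lemma hist_basic: "hist h \<Longrightarrow> distinct (map fst h) \<and> jobs h \<subseteq> {0..<n} \<and> length h \<le> n"
proof (induction rule: hist.induct)
  case (hist_Cons h j l)
  then have "j \<notin> jobs h" using n_le by (subst (asm) readyW_iff) auto
  then have d: "distinct (map fst ((j, fst l, snd l, start h j l + ptm (fst l) j) # h))"
    and s: "jobs ((j, fst l, snd l, start h j l + ptm (fst l) j) # h) \<subseteq> {0..<n}"
    using hist_Cons by auto
  have "length ((j, fst l, snd l, start h j l + ptm (fst l) j) # h) \<le> n"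
    using distinct_card[OF d] card_mono[OF _ s] by simp
  then show ?case using d s by blast
qed simp

lemma hist_len: "hist h \<Longrightarrow> length h \<le> W" using hist_basic n_le by fastforce

lemma hist_card: "hist h \<Longrightarrow> card (jobs h) = length h"
  using hist_basic distinct_card by fastforce

lemma hist_ready: "hist h \<Longrightarrow> j < n \<Longrightarrow> ready h j \<longleftrightarrow> j \<notin> jobs h \<and> (\<forall>i. (i, j) \<in> E \<longrightarrow> i \<in> jobs h)"
  using hist_len readyW_iff by blast

lemma hist_closed: "hist h \<Longrightarrow> j \<in> jobs h \<Longrightarrow> (i, j) \<in> E \<Longrightarrow> i \<in> jobs h"
proof (induction rule: hist.induct)
  case (hist_Cons h j' l)
  then show ?case using hist_ready[of h j'] by auto
qed simp

lemma locs_props: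
  "l \<in> set (locs j) \<Longrightarrow> fst l \<le> k \<and> (fst l = 0 \<longrightarrow> snd l < z) \<and> (fst l \<noteq> 0 \<longrightarrow> j \<noteq> src I \<and> j \<noteq> snk I)"
  unfolding locsW_set by (auto split: if_splits)

lemma hist_loc:
  "hist h \<Longrightarrow> e' \<in> set h \<Longrightarrow> e_ty e' \<le> k \<and> (e_ty e' = 0 \<longrightarrow> e_srv e' < z) \<and>
     (e_ty e' \<noteq> 0 \<longrightarrow> e_job e' \<noteq> src I \<and> e_job e' \<noteq> snk I)"
proof (induction rule: hist.induct)
  case (hist_Cons h j l)
  then show ?case using locs_props[of l j] by auto
qed simp

lemma startW_le:
  "length h \<le> W \<Longrightarrow> start h j l \<le> B \<longleftrightarrow> (\<forall>e'\<in>set h.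
     (if edge (e_job e') j then e_C e' + delay (e_ty e') (fst l) (e_job e') j
      else if fst l = 0 \<and> e_ty e' = 0 \<and> e_srv e' = snd l then e_C e' else 0) \<le> B)"
  unfolding startW_def by (simp add: fold_max_le)

lemma freeW_le:
  "length h \<le> W \<Longrightarrow> free_at h m \<le> B \<longleftrightarrow> (\<forall>e'\<in>set h. e_ty e' = 0 \<and> e_srv e' = m \<longrightarrow> e_C e' \<le> B)"
  unfolding freeW_def by (simp add: fold_cond_max_le)

lemma start_edge:
  assumes "hist h" "e' \<in> set h" "(e_job e', j) \<in> E" "l \<in> set (locs j)"
  shows "e_C e' + dly I (mty (e_ty e')) (mty (fst l)) (e_job e') j \<le> start h j l"
proof -
  have l: "fst l \<le> k" using assms(4) locs_props by blast
  have "edge (e_job e') j" using assms(3) E_bounds edgeW_iff by blast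
  moreover have "delay (e_ty e') (fst l) (e_job e') j = dly I (mty (e_ty e')) (mty (fst l)) (e_job e') j"
    using delayW_eq[OF _ l assms(3)] hist_loc[OF assms(1,2)] by blast
  ultimately show ?thesis
    using startW_le[OF hist_len[OF assms(1)], of j l "start h j l"] assms(2) by fastforce
qed

lemma dly_same: "dly I m m i j = 0" using wf by (auto simp: wf_inst_def)

lemma start_server:
  assumes "hist h" "e' \<in> set h" "l \<in> set (locs j)" "fst l = 0" "e_ty e' = 0" "e_srv e' = snd l"
  shows "e_C e' \<le> start h j l"
  using startW_le[OF hist_len[OF assms(1)], of j l "start h j l"] assms(2,4-)
  by (auto split: if_splits dest!: bspec[of _ _ e'])

lemma hist_edge:
  "hist h \<Longrightarrow> a \<in> set h \<Longrightarrow> b \<in> set h \<Longrightarrow> (e_job a, e_job b) \<in> E \<Longrightarrow>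
     e_C a + dly I (mty (e_ty a)) (mty (e_ty b)) (e_job a) (e_job b) + ptm (e_ty b) (e_job b) \<le> e_C b"
proof (induction rule: hist.induct)
  case (hist_Cons h j l)
  let ?new = "(j, fst l, snd l, start h j l + ptm (fst l) j)"
  have r: "j \<notin> jobs h" "\<And>i. (i, j) \<in> E \<Longrightarrow> i \<in> jobs h" using hist_ready[of h j] hist_Cons.hyps by auto
  consider "a \<in> set h" "b \<in> set h" | "a \<in> set h" "b = ?new" | "a = ?new" using hist_Cons.prems by auto
  then show ?case
  proof cases
    case 1 then show ?thesis using hist_Cons by blast
  next
    case 2
    then show ?thesis using start_edge[of h a j l] hist_Cons by auto
  next
    case 3
    \<comment> \<open>No edge leads from the new job into a scheduled one, because scheduled sets
      are closed under predecessors.\<close>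
    have "e_job b \<in> jobs h" using r(2)[of j] r(1) hist_Cons.prems 3 by auto
    then have "j \<in> jobs h" using hist_closed[of h "e_job b" j] hist_Cons.hyps hist_Cons.prems 3 by auto
    then show ?thesis using r by blast
  qed
qed simp

lemma hist_server:
  "hist h \<Longrightarrow> a \<in> set h \<Longrightarrow> b \<in> set h \<Longrightarrow> e_job a \<noteq> e_job b \<Longrightarrow> e_ty a = 0 \<Longrightarrow> e_ty b = 0 \<Longrightarrow> e_srv a = e_srv b \<Longrightarrow>
     e_C a + ptm 0 (e_job b) \<le> e_C b \<or> e_C b + ptm 0 (e_job a) \<le> e_C a"
proof (induction rule: hist.induct)
  case (hist_Cons h j l)
  let ?new = "(j, fst l, snd l, start h j l + ptm (fst l) j)"
  consider "a \<in> set h" "b \<in> set h" | "a \<in> set h" "b = ?new" | "a = ?new" "b \<in> set h" using hist_Cons.prems by auto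
  then show ?case
  proof cases
    case 1 then show ?thesis using hist_Cons by blast
  next
    case 2
    then show ?thesis using start_server[of h a l j] hist_Cons by auto
  next
    case 3
    then show ?thesis using start_server[of h b l j] hist_Cons by auto
  qed
qed simp

lemma complW_eq: "hist h \<Longrightarrow> a \<in> set h \<Longrightarrow> complW W h (e_job a) = e_C a"
  using fold_lookup[of h a True e_C 0] hist_basic[of h] hist_len[of h] by (simp add: complW_def)

lemma codeW_eq:
  "hist h \<Longrightarrow> a \<in> set h \<Longrightarrow>
   codeW W h (e_job a) = (if e_ty a = 0 then e_srv a + e_srv a else e_ty a + e_ty a - 1)"
  using fold_lookup[of h a True "\<lambda>a. if e_ty a = 0 then e_srv a + e_srv a else e_ty a + e_ty a - 1" 0]
    hist_basic[of h] hist_len[of h] by (simp add: codeW_def)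

lemma outW_eq: "outW W xs h = concat (map (\<lambda>j. [complW W h j, codeW W h j]) [0..<n])"
proof -
  have "2 \<le> W" using len10 lenW by linarith
  then obtain w where w: "W = Suc (Suc w)" by (metis add_2_eq_Suc le_Suc_ex)
  have "map (take W) (take W (map (\<lambda>j. [complW W h j, codeW W h j]) [0..<n])) =
      map (\<lambda>j. [complW W h j, codeW W h j]) [0..<n]" using n_le by (simp add: w)
  then show ?thesis unfolding outW_def header_nth upt_n by simp
qed

lemma length_outW: "length (outW W xs h) = 2 * n"
  unfolding outW_eq by (subst length_concat_uniform[where m = 2]) auto

lemma outW_nth: "j < n \<Longrightarrow> outW W xs h ! (2 * j) = complW W h j" "j < n \<Longrightarrow> outW W xs h ! (2 * j + 1) = codeW W h j"
proof -
  assume j: "j < n"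
  have "outW W xs h ! (j * 2 + i) = [complW W h j, codeW W h j] ! i" if "i < 2" for i
    unfolding outW_eq using j that by (subst nth_concat_uniform[where m = 2]) auto
  from this[of 0] this[of 1] show "outW W xs h ! (2 * j) = complW W h j" "outW W xs h ! (2 * j + 1) = codeW W h j"
    by (simp_all add: mult.commute)
qed

definition hcost :: "entry list \<Rightarrow> nat" where
  "hcost h = sum_list (map (\<lambda>a. price (e_job a) (e_ty a)) h)"

lemma hist_output:
  assumes h: "hist h" and full: "jobs h = {0..<n}"
  defines "C \<equiv> fst (dec_sched (outW W xs h))" and "\<eta> \<equiv> snd (dec_sched (outW W xs h))"
  shows "valid_sched I C \<eta>" "sched_cost I \<eta> = hcost h" "\<exists>a\<in>set h. C (snk I) = e_C a"
proof -
  have ent: "\<exists>a\<in>set h. e_job a = j" if "j < n" for j using full that by (metis atLeastLessThan_iff imageE zero_le)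
  have bnd: "e_job a < n" if "a \<in> set h" for a using that full by (metis atLeastLessThan_iff image_eqI)
  have Ca: "C (e_job a) = e_C a" if "a \<in> set h" for a
    using bnd[OF that] complW_eq[OF h that] outW_nth(1)[of "e_job a" h] by (simp add: C_def dec_sched_def)
  have \<eta>a: "\<eta> (e_job a) = (if e_ty a = 0 then Server (e_srv a) else Cloud (e_ty a - 1))" if "a \<in> set h" for a
  proof -
    have "\<eta> (e_job a) = loc_of_code (if e_ty a = 0 then e_srv a + e_srv a else e_ty a + e_ty a - 1)"
      using bnd[OF that] codeW_eq[OF h that] outW_nth(2)[of "e_job a" h] by (simp add: \<eta>_def dec_sched_def)
    also have "\<dots> = (if e_ty a = 0 then Server (e_srv a) else Cloud (e_ty a - 1))"
    proof (cases "e_ty a")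
      case 0 then show ?thesis by (simp add: loc_of_code_def)
    next
      case (Suc c)
      then have "e_ty a + e_ty a - 1 = Suc (2 * c)" by simp
      then show ?thesis using Suc by (simp add: loc_of_code_def)
    qed
    finally show ?thesis .
  qed
  have lt: "ltype (\<eta> (e_job a)) = mty (e_ty a)" if "a \<in> set h" for a
    using \<eta>a[OF that] by (cases "e_ty a") auto
  have pt: "ptime I \<eta> (e_job a) = ptm (e_ty a) (e_job a)" if "a \<in> set h" for a
    using \<eta>a[OF that] hist_loc[OF h that] ptimeW_eq[of "e_ty a" "e_job a"] bnd[OF that]
    by (auto simp: ptime_def)
  have sn: "src I < n" "snk I < n" using wf by (auto simp: wf_inst_def)
  show "valid_sched I C \<eta>" unfolding valid_sched_def
  proof (intro conjI allI impI)
    fix j assume "j < n"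
    then obtain a where a: "a \<in> set h" "e_job a = j" using ent by blast
    show "case \<eta> j of Server m \<Rightarrow> m < nz I | Cloud c \<Rightarrow> c < nk I"
      using \<eta>a[OF a(1)] a(2) hist_loc[OF h a(1)] nz by (auto split: if_splits)
  next
    obtain a where a: "a \<in> set h" "e_job a = src I" using ent sn by blast
    show "is_server (\<eta> (src I))" using \<eta>a[OF a(1)] a(2) hist_loc[OF h a(1)] by (auto split: if_splits)
  next
    obtain a where a: "a \<in> set h" "e_job a = snk I" using ent sn by blast
    show "is_server (\<eta> (snk I))" using \<eta>a[OF a(1)] a(2) hist_loc[OF h a(1)] by (auto split: if_splits)
  next
    fix i j assume ij: "i < n" "j < n" and *: "i \<noteq> j \<and> \<eta> i = \<eta> j \<and> is_server (\<eta> i)"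
    obtain a where a: "a \<in> set h" "e_job a = i" using ent ij by blast
    obtain b where b: "b \<in> set h" "e_job b = j" using ent ij by blast
    have "e_ty a = 0" "e_ty b = 0" "e_srv a = e_srv b"
      using * \<eta>a[OF a(1)] \<eta>a[OF b(1)] a(2) b(2) by (auto split: if_splits)
    then have "e_C a + ps I j \<le> e_C b \<or> e_C b + ps I i \<le> e_C a"
      using hist_server[OF h a(1) b(1)] * a b ptimeW_eq[of 0 i] ptimeW_eq[of 0 j] ij by auto
    then show "int (C i) \<le> int (C j) - int (ps I j) \<or> int (C i) - int (ps I i) \<ge> int (C j)"
      using Ca[OF a(1)] Ca[OF b(1)] a b by auto
  next
    show "\<forall>(i, j)\<in>E. int (C i) + int (dly I (ltype (\<eta> i)) (ltype (\<eta> j)) i j) \<le> int (C j) - int (ptime I \<eta> j)"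
    proof (intro ballI, clarify)
      fix i j assume E: "(i, j) \<in> E"
      obtain a where a: "a \<in> set h" "e_job a = i" using ent E_bounds[OF E] by blast
      obtain b where b: "b \<in> set h" "e_job b = j" using ent E_bounds[OF E] by blast
      show "int (C i) + int (dly I (ltype (\<eta> i)) (ltype (\<eta> j)) i j) \<le> int (C j) - int (ptime I \<eta> j)"
        using hist_edge[OF h a(1) b(1)] E a b Ca[OF a(1)] Ca[OF b(1)] lt[OF a(1)] lt[OF b(1)] pt[OF b(1)] by auto
    qed
  qed
  have "hcost h = (\<Sum>a\<in>set h. price (e_job a) (e_ty a))"
    unfolding hcost_def using hist_basic[OF h] by (subst sum_list_distinct_conv_sum_set) (auto simp: distinct_map)
  also have "\<dots> = (\<Sum>a\<in>set h. case \<eta> (e_job a) of Cloud c \<Rightarrow> cst I (e_job a) c | Server _ \<Rightarrow> 0)"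
  proof (rule sum.cong[OF refl])
    fix a assume a: "a \<in> set h"
    show "price (e_job a) (e_ty a) = (case \<eta> (e_job a) of Cloud c \<Rightarrow> cst I (e_job a) c | Server _ \<Rightarrow> 0)"
      using \<eta>a[OF a] hist_loc[OF h a] costW_eq[of "e_ty a" "e_job a"] bnd[OF a] by auto
  qed
  also have "\<dots> = (\<Sum>j\<in>{0..<n}. case \<eta> j of Cloud c \<Rightarrow> cst I j c | Server _ \<Rightarrow> 0)"
    unfolding full[symmetric] using hist_basic[OF h] by (subst sum.reindex) (auto simp: distinct_map)
  also have "\<dots> = sched_cost I \<eta>" unfolding sched_cost_def
    by (rule sum.mono_neutral_right) (auto split: loc.splits)
  finally show "sched_cost I \<eta> = hcost h" by simp
  obtain a where a: "a \<in> set h" "e_job a = snk I" using ent sn by blast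
  then show "\<exists>a\<in>set h. C (snk I) = e_C a" using Ca[OF a(1)] by auto
qed

end

section \<open>The number of keys\<close>

text \<open>A set of at most \<open>p\<close> elements can be read off from a list of exactly
  \<open>p\<close> options, with \<open>None\<close> as padding.\<close>

lemma card_small_subsets_le:
  assumes "finite U"
  shows "finite {X. X \<subseteq> U \<and> card X \<le> p}" "card {X. X \<subseteq> U \<and> card X \<le> p} \<le> (card U + 1) ^ p"
proof -
  show fin: "finite {X. X \<subseteq> U \<and> card X \<le> p}" using assms by (rule_tac finite_subset[of _ "Pow U"]) auto
  define Os where "Os = insert None (Some ` U)"
  define Ls where "Ls = {ys. set ys \<subseteq> Os \<and> length ys = p}"
  have Os: "finite Os" "card Os = card U + 1" using assms by (auto simp: Os_def card_image)
  have sub: "{X. X \<subseteq> U \<and> card X \<le> p} \<subseteq> (\<lambda>ys. {x. Some x \<in> set ys}) ` Ls"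
  proof
    fix X assume X: "X \<in> {X. X \<subseteq> U \<and> card X \<le> p}"
    then obtain ws where ws: "set ws = X" "distinct ws" using assms finite_subset finite_distinct_list by (metis mem_Collect_eq)
    then have "length ws \<le> p" using X distinct_card by fastforce
    then have "map Some ws @ replicate (p - length ws) None \<in> Ls" using X ws by (auto simp: Ls_def Os_def)
    moreover have "{x. Some x \<in> set (map Some ws @ replicate (p - length ws) None)} = X" using ws by auto
    ultimately show "X \<in> (\<lambda>ys. {x. Some x \<in> set ys}) ` Ls" by blast
  qed
  have Ls: "finite Ls" "card Ls = (card U + 1) ^ p"
    using Os finite_lists_length_eq card_lists_length_eq[of Os p] by (auto simp: Ls_def)
  show "card {X. X \<subseteq> U \<and> card X \<le> p} \<le> (card U + 1) ^ p"
    using card_mono[OF finite_imageI[OF Ls(1)] sub] card_image_le[OF Ls(1), of "\<lambda>ys. {x. Some x \<in> set ys}"] Ls(2) by linarith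
qed

lemma fold_ignore: "fold (\<lambda>i a. f a) ys a = (f ^^ length ys) a"
  by (induction ys arbitrary: a) (auto simp: funpow_swap1)

lemma div_eq_le: "x div d = y div d \<Longrightarrow> 0 < d \<Longrightarrow> x \<le> y + (d - 1 :: nat)"
proof -
  assume a: "x div d = y div d" "0 < d"
  have "x = x div d * d + x mod d" "y = y div d * d + y mod d" by simp_all
  moreover have "x mod d < d" "x div d * d = y div d * d" using a by simp_all
  ultimately show ?thesis by linarith
qed

text \<open>\<open>KW\<close> bounds the longest list the program handles: the number of keys times
  the n * (z + k) ways to extend one state by a job and a location.\<close>

locale fptas_input = instance_input +
  fixes \<phi> M :: nat
  assumes cut: "cut_phi I \<le> \<phi>" and
    KW: "(nj I * (nj I * (Suc (nk I) * Suc M)) + 1) ^ \<phi> * Suc M ^ z * (nj I * (z + nk I)) \<le> W" and MW: "M \<le> W"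
begin

definition "Kb = (n * (n * (Suc k * Suc M)) + 1) ^ \<phi> * Suc M ^ z"

lemma Kb_pos: "1 \<le> Kb" unfolding Kb_def by simp

lemma branch_pos: "1 \<le> n * (z + k)" using n_pos z_pos by simp

lemma Kb_branch: "Kb * (n * (z + k)) \<le> W" using KW by (simp add: Kb_def)

lemma Kb_le: "Kb \<le> W"
  using mult_le_mono2[OF branch_pos, of Kb] Kb_branch by linarith

lemma branch_le: "n * (z + k) \<le> W"
  using mult_le_mono1[OF Kb_pos, of "n * (z + k)"] Kb_branch by linarith

lemma finE: "finite E"
  using wf finite_subset[of E "{0..<n} \<times> {0..<n}"] by (auto simp: wf_inst_def)

lemma wfE: "Wellfounded.wf E" "Wellfounded.wf (E\<inverse>)"
  using finite_acyclic_wf[OF finE] finite_acyclic_wf_converse[OF finE] wf by (auto simp: wf_inst_def)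

lemma no_pred: "j < n \<Longrightarrow> (\<And>i. (i, j) \<notin> E) \<Longrightarrow> j = src I"
  using wf unfolding wf_inst_def by blast

lemma no_succ: "j < n \<Longrightarrow> (\<And>i. (j, i) \<notin> E) \<Longrightarrow> j = snk I"
  using wf unfolding wf_inst_def by blast

lemma src_in_hist: "hist h \<Longrightarrow> h \<noteq> [] \<Longrightarrow> src I \<in> jobs h"
proof (induction rule: hist.induct)
  case (hist_Cons h j l)
  show ?case
  proof (cases "h = []")
    case True
    then have "j = src I" using hist_ready[OF hist_Cons.hyps(1), of j] hist_Cons.hyps no_pred by auto
    then show ?thesis by simp
  next
    case False
    then show ?thesis using hist_Cons.IH by simp
  qed
qed simp

definition crossing :: "entry list \<Rightarrow> (nat \<times> nat) set" where
  "crossing h = {(a, b) \<in> E. a \<in> jobs h \<and> b \<notin> jobs h}"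

lemma crossing_card: assumes "hist h" "h \<noteq> []" shows "card (crossing h) \<le> \<phi>"
proof -
  have "jobs h \<in> dividing_sets I"
    using hist_basic[OF assms(1)] src_in_hist[OF assms] hist_closed[OF assms(1)] by (auto simp: dividing_sets_def)
  moreover have "finite (dividing_sets I)"
    by (rule finite_subset[of _ "Pow {0..<n}"]) (auto simp: dividing_sets_def)
  ultimately have "card (crossing h) \<le> cut_phi I" unfolding cut_phi_def crossing_def by (intro Max_ge) auto
  then show ?thesis using cut by simp
qed

text \<open>Following predecessors back from an unscheduled job must end at the source, which is
  scheduled, so the walk crosses into the scheduled set; the converse is closure under predecessors.
  Hence the crossing edges determine the scheduled jobs.\<close>

lemma unscheduled_iff:
  assumes "hist h" "h \<noteq> []" "j < n"
  shows "j \<notin> jobs h \<longleftrightarrow> (\<exists>(a, b) \<in> crossing h. (b, j) \<in> E\<^sup>*)"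
proof
  assume "j \<notin> jobs h"
  with assms(3) show "\<exists>(a, b) \<in> crossing h. (b, j) \<in> E\<^sup>*"
  proof (induction j rule: wf_induct_rule[OF wfE(1)])
    case (1 j)
    have "j \<noteq> src I" using src_in_hist[OF assms(1,2)] 1 by auto
    then obtain i where i: "(i, j) \<in> E" using no_pred 1 by blast
    show ?case
    proof (cases "i \<in> jobs h")
      case True
      then have "(i, j) \<in> crossing h" using i 1 by (auto simp: crossing_def)
      then show ?thesis by blast
    next
      case False
      then obtain a b where "(a, b) \<in> crossing h" "(b, i) \<in> E\<^sup>*" using 1(1)[OF i] E_bounds[OF i] by blast
      then show ?thesis using i by (meson case_prodI rtrancl.rtrancl_into_rtrancl bexI)
    qed
  qed
next
  assume "\<exists>(a, b) \<in> crossing h. (b, j) \<in> E\<^sup>*"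
  then obtain a b where ab: "(a, b) \<in> crossing h" "(b, j) \<in> E\<^sup>*" by blast
  have "j \<in> jobs h \<Longrightarrow> b \<in> jobs h" using ab(2)
    by (induction rule: converse_rtrancl_induct) (auto intro: hist_closed[OF assms(1)])
  then show "j \<notin> jobs h" using ab(1) by (auto simp: crossing_def)
qed

end

section \<open>Keys for a fixed width and horizon\<close>

locale dp_run = fptas_input +
  fixes \<delta> U :: nat
  assumes \<delta>_pos: "0 < \<delta>" and UM: "U \<le> M * \<delta>"
begin

definition bounded :: "entry list \<Rightarrow> bool" where
  "bounded h \<longleftrightarrow> hist h \<and> (\<forall>a\<in>set h. e_C a \<le> U)"

abbreviation key :: "entry list \<Rightarrow> nat list \<times> nat list \<times> nat list" where
  "key h \<equiv> keyW z W xs \<delta> h"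

lemma bucket_le: assumes "x \<le> U" shows "x div \<delta> \<le> M"
proof -
  have "x div \<delta> \<le> (M * \<delta>) div \<delta>" by (rule div_le_mono) (use UM assms in simp)
  then show ?thesis using \<delta>_pos by simp
qed

lemma divW_bounded: "x \<le> U \<Longrightarrow> divW W x \<delta> = x div \<delta>"
  using bucket_le[of x] MW \<delta>_pos by (intro divW_eq) auto

lemma free_bounded: "bounded h \<Longrightarrow> free_at h m \<le> U"
  using freeW_le[OF hist_len, of h m U] by (auto simp: bounded_def)

lemma tagW_eq:
  assumes "hist h"
  shows "a \<in> set h \<Longrightarrow> tagW W xs h (e_job a) = (if live h (e_job a) then Suc (Suc (e_ty a)) else 1)"
    and "j \<notin> jobs h \<Longrightarrow> tagW W xs h j = 0"
proof -
  assume a: "a \<in> set h"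
  show "tagW W xs h (e_job a) = (if live h (e_job a) then Suc (Suc (e_ty a)) else 1)"
    using fold_lookup[of h a True "\<lambda>b. if live h (e_job a) then Suc (Suc (e_ty b)) else 1" 0] a
      hist_basic[OF assms] hist_len[OF assms] by (simp add: tagW_def)
next
  assume "j \<notin> jobs h"
  then show "tagW W xs h j = 0"
    using fold_lookup_none[of j h True "\<lambda>b. if live h j then Suc (Suc (e_ty b)) else 1" 0]
      hist_len[OF assms] by (simp add: tagW_def)
qed

lemma bucketW_eq:
  assumes "bounded h"
  shows "a \<in> set h \<Longrightarrow> bucketW W xs \<delta> h (e_job a) = (if live h (e_job a) then e_C a div \<delta> else 0)"
    and "j \<notin> jobs h \<Longrightarrow> bucketW W xs \<delta> h j = 0"
proof -
  have h: "hist h" using assms by (simp add: bounded_def)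
  {
    assume a: "a \<in> set h"
    show "bucketW W xs \<delta> h (e_job a) = (if live h (e_job a) then e_C a div \<delta> else 0)"
      using fold_lookup[of h a "live h (e_job a)" "\<lambda>b. divW W (e_C b) \<delta>" 0] a
        hist_basic[OF h] hist_len[OF h] divW_bounded[of "e_C a"] assms by (simp add: bucketW_def bounded_def)
  next
    assume "j \<notin> jobs h"
    then show "bucketW W xs \<delta> h j = 0"
      using fold_lookup_none[of j h "live h j" "\<lambda>b. divW W (e_C b) \<delta>" 0]
        hist_len[OF h] by (simp add: bucketW_def)
  }
qed

lemma key_eq:
  "key h = (map (tagW W xs h) [0..<n], map (bucketW W xs \<delta> h) [0..<n], map (\<lambda>m. divW W (free_at h m) \<delta>) [0..<z])"
  unfolding keyW_def header_nth upt_n upt_z by simp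

lemma same_iff: "sameW W (key h) (key h') \<longleftrightarrow> key h = key h'"
proof -
  have "length (fst (key g)) \<le> W" "length (fst (snd (key g))) \<le> W" "length (snd (snd (key g))) \<le> W" for g
    using n_le z_le by (simp_all add: key_eq)
  then show ?thesis by (simp add: sameW_def eqW_eq prod_eq_iff)
qed

text \<open>The price of replacing one history by another with the same key: numbers in one bucket
  differ by at most \<delta> - 1. Nothing is claimed about jobs whose successors are all scheduled,
  since their times affect later jobs only through the servers.\<close>

lemma key_agree:
  assumes "bounded h" "bounded h'" "key h = key h'"
  shows "jobs h = jobs h'"
    "\<And>a a'. a \<in> set h \<Longrightarrow> a' \<in> set h' \<Longrightarrow> e_job a = e_job a' \<Longrightarrow> \<exists>i. (e_job a, i) \<in> E \<and> i \<notin> jobs h \<Longrightarrow>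
      e_ty a = e_ty a' \<and> e_C a' \<le> e_C a + (\<delta> - 1)"
    "\<And>m. m < z \<Longrightarrow> free_at h' m \<le> free_at h m + (\<delta> - 1)"
proof -
  have h: "hist h" "hist h'" using assms by (auto simp: bounded_def)
  have tags: "tagW W xs h j = tagW W xs h' j" "bucketW W xs \<delta> h j = bucketW W xs \<delta> h' j" if "j < n" for j
    using assms(3) that by (auto simp: key_eq)
  have frees: "divW W (free_at h m) \<delta> = divW W (free_at h' m) \<delta>" if "m < z" for m
    using assms(3) that by (auto simp: key_eq)
  have jb: "j \<in> jobs g \<longleftrightarrow> tagW W xs g j \<noteq> 0" if "hist g" for g j
    using tagW_eq[OF that] by (cases "j \<in> jobs g") auto
  show J: "jobs h = jobs h'"
  proof -
    have "j \<in> jobs h \<longleftrightarrow> j \<in> jobs h'" if "j < n" for j using jb[OF h(1)] jb[OF h(2)] tags(1)[OF that] by simp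
    moreover have "j < n" if "j \<in> jobs h \<or> j \<in> jobs h'" for j
      using that hist_basic[OF h(1)] hist_basic[OF h(2)] by auto
    ultimately show ?thesis by blast
  qed
  show "e_ty a = e_ty a' \<and> e_C a' \<le> e_C a + (\<delta> - 1)"
    if a: "a \<in> set h" "a' \<in> set h'" "e_job a = e_job a'" "\<exists>i. (e_job a, i) \<in> E \<and> i \<notin> jobs h" for a a'
  proof -
    have jn: "e_job a < n" using a(1) hist_basic[OF h(1)] by auto
    have l: "live h (e_job a)" "live h' (e_job a)"
      using liveW_iff[OF hist_len[OF h(1)] jn] liveW_iff[OF hist_len[OF h(2)] jn] a(4) J by auto
    have "e_ty a = e_ty a'" using tags(1)[OF jn] tagW_eq(1)[OF h(1) a(1)] tagW_eq(1)[OF h(2) a(2)] l a(3) by simp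
    moreover have "e_C a' div \<delta> = e_C a div \<delta>"
      using tags(2)[OF jn] bucketW_eq(1)[OF assms(1) a(1)] bucketW_eq(1)[OF assms(2) a(2)] l a(3) by simp
    ultimately show ?thesis using div_eq_le[OF _ \<delta>_pos] by blast
  qed
  show "free_at h' m \<le> free_at h m + (\<delta> - 1)" if "m < z" for m
  proof -
    have "free_at h' m div \<delta> = free_at h m div \<delta>"
      using frees[OF that] divW_bounded[OF free_bounded[OF assms(1)]] divW_bounded[OF free_bounded[OF assms(2)]] by simp
    then show ?thesis using div_eq_le[OF _ \<delta>_pos] by blast
  qed
qed

text \<open>Crossing edges decorated with the remembered data of their tails: a set of at most
  \<phi> elements from a polynomial universe, which is easier to count than keys.\<close>

definition trace :: "entry list \<Rightarrow> (nat \<times> nat \<times> nat \<times> nat) set" where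
  "trace h = {(e_job a, b, e_ty a, e_C a div \<delta>) |a b. a \<in> set h \<and> (e_job a, b) \<in> crossing h}"

text \<open>Dropping the decoration gives back the crossing edges and with them the scheduled jobs.
  A scheduled job is live exactly if it is the tail of a crossing edge, and then its type and bucket
  are in the decoration.\<close>

lemma trace_inj:
  assumes h: "bounded h" "bounded h'" "h \<noteq> []" "h' \<noteq> []" and t: "trace h = trace h'"
    and f: "map (\<lambda>m. divW W (free_at h m) \<delta>) [0..<z] = map (\<lambda>m. divW W (free_at h' m) \<delta>) [0..<z]"
  shows "key h = key h'"
proof -
  have hh: "hist h" "hist h'" using h by (auto simp: bounded_def)
  have cr: "crossing g = (\<lambda>(a, b, _). (a, b)) ` trace g" for g
  proof
    show "crossing g \<subseteq> (\<lambda>(a, b, _). (a, b)) ` trace g"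
    proof
      fix ab assume "ab \<in> crossing g"
      moreover obtain a b where ab: "ab = (a, b)" by (cases ab)
      ultimately have "a \<in> jobs g" by (auto simp: crossing_def)
      then obtain e' where "e' \<in> set g" "e_job e' = a" by blast
      note * = \<open>ab \<in> crossing g\<close>[unfolded ab] ab this
      then have "(a, b, e_ty e', e_C e' div \<delta>) \<in> trace g" unfolding trace_def by blast
      then show "ab \<in> (\<lambda>(a, b, _). (a, b)) ` trace g" using * by force
    qed
    show "(\<lambda>(a, b, _). (a, b)) ` trace g \<subseteq> crossing g" by (auto simp: trace_def)
  qed
  have c: "crossing h = crossing h'" using cr t by metis
  have J: "j \<in> jobs h \<longleftrightarrow> j \<in> jobs h'" if "j < n" for j
    using unscheduled_iff[OF hh(1) h(3) that] unscheduled_iff[OF hh(2) h(4) that] c by blast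
  have live: "live g j \<longleftrightarrow> (\<exists>b. (j, b) \<in> crossing g)" if "hist g" "j \<in> jobs g" for g j
  proof -
    have "j < n" using that hist_basic[OF that(1)] by auto
    then show ?thesis using liveW_iff[OF hist_len[OF that(1)], of j] that(2) by (auto simp: crossing_def)
  qed
  have "tagW W xs h j = tagW W xs h' j \<and> bucketW W xs \<delta> h j = bucketW W xs \<delta> h' j" if jn: "j < n" for j
  proof (cases "j \<in> jobs h")
    case False
    then show ?thesis using J[OF jn] tagW_eq(2) bucketW_eq(2) hh h by auto
  next
    case True
    then obtain a a' where a: "a \<in> set h" "e_job a = j" "a' \<in> set h'" "e_job a' = j" using J[OF jn] by auto
    have l: "live h j \<longleftrightarrow> live h' j" using live hh True J[OF jn] c by blast
    have "e_ty a = e_ty a' \<and> e_C a div \<delta> = e_C a' div \<delta>" if lv: "live h j"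
    proof -
      obtain b where "(j, b) \<in> crossing h" using lv live[OF hh(1) True] by blast
      then have "(e_job a, b, e_ty a, e_C a div \<delta>) \<in> trace h"
        unfolding trace_def by (intro CollectI exI[of _ a] exI[of _ b]) (simp add: a)
      then have "(j, b, e_ty a, e_C a div \<delta>) \<in> trace h'" using t a(2) by simp
      then obtain a2 where a2: "a2 \<in> set h'" "e_job a2 = j" "e_ty a2 = e_ty a" "e_C a2 div \<delta> = e_C a div \<delta>"
        unfolding trace_def by auto
      have "inj_on fst (set h')" using hist_basic[OF hh(2)] by (simp add: distinct_map)
      then have "a2 = a'" using a(3,4) a2(1,2) by (simp add: inj_onD)
      then show ?thesis using a2 by simp
    qed
    then show ?thesis
      using tagW_eq(1)[OF hh(1) a(1)] tagW_eq(1)[OF hh(2) a(3)] bucketW_eq(1)[OF h(1) a(1)] bucketW_eq(1)[OF h(2) a(3)]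
        l a by auto
  qed
  then show ?thesis using f by (simp add: key_eq)
qed

lemma card_keys:
  "finite (key ` {h. bounded h \<and> h \<noteq> []})" "card (key ` {h. bounded h \<and> h \<noteq> []}) \<le> Kb"
proof -
  define UU where "UU = {0..<n} \<times> {0..<n} \<times> {0..<Suc k} \<times> {0..<Suc M}"
  define Xs where "Xs = {X. X \<subseteq> UU \<and> card X \<le> \<phi>}"
  define Fs where "Fs = {fl :: nat list. set fl \<subseteq> {0..<Suc M} \<and> length fl = z}"
  define g where "g h = (trace h, map (\<lambda>m. divW W (free_at h m) \<delta>) [0..<z])" for h
  have fU: "finite UU" "card UU = n * (n * (Suc k * Suc M))" by (simp_all add: UU_def)
  have fX: "finite Xs" "card Xs \<le> (n * (n * (Suc k * Suc M)) + 1) ^ \<phi>"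
    using card_small_subsets_le[OF fU(1), of \<phi>] fU(2) by (auto simp: Xs_def)
  have fF: "finite Fs" "card Fs = Suc M ^ z"
    unfolding Fs_def using finite_lists_length_eq[of "{0..<Suc M}" z] card_lists_length_eq[of "{0..<Suc M}" z] by auto
  have sub: "g h \<in> Xs \<times> Fs" if h: "bounded h" "h \<noteq> []" for h
  proof -
    have hh: "hist h" using h by (simp add: bounded_def)
    have "trace h \<subseteq> UU"
    proof
      fix x assume "x \<in> trace h"
      then obtain a b where ab: "x = (e_job a, b, e_ty a, e_C a div \<delta>)" "a \<in> set h" "(e_job a, b) \<in> E"
        by (auto simp: trace_def crossing_def)
      have "e_C a \<le> U" using ab(2) h(1) by (simp add: bounded_def)
      then show "x \<in> UU" using ab(1) hist_loc[OF hh ab(2)] bucket_le[of "e_C a"] E_bounds[OF ab(3)]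
        by (simp add: UU_def less_Suc_eq_le)
    qed
    moreover have "card (trace h) \<le> \<phi>"
    proof -
      \<comment> \<open>A job has only one entry, so each crossing edge receives at most one
        decoration.\<close>
      have "trace h \<subseteq> (\<lambda>(a, b). let r = the (map_of h a) in (a, b, fst r, snd (snd r) div \<delta>)) ` crossing h"
      proof
        fix x assume "x \<in> trace h"
        then obtain a b where ab: "x = (e_job a, b, e_ty a, e_C a div \<delta>)" "a \<in> set h" "(e_job a, b) \<in> crossing h"
          by (auto simp: trace_def)
        have "map_of h (e_job a) = Some (snd a)" using ab(2) hist_basic[OF hh] by (intro map_of_is_SomeI) auto
        then show "x \<in> (\<lambda>(a, b). let r = the (map_of h a) in (a, b, fst r, snd (snd r) div \<delta>)) ` crossing h"
          using ab by (intro image_eqI[of _ _ "(e_job a, b)"]) (auto simp: Let_def)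
      qed
      moreover have "finite (crossing h)" by (rule finite_subset[OF _ finE]) (auto simp: crossing_def)
      ultimately have "card (trace h) \<le> card (crossing h)" by (meson card_image_le card_mono finite_imageI le_trans)
      then show ?thesis using crossing_card[OF hh h(2)] by simp
    qed
    moreover have "map (\<lambda>m. divW W (free_at h m) \<delta>) [0..<z] \<in> Fs"
      using divW_bounded free_bounded[OF h(1)] bucket_le by (auto simp: Fs_def less_Suc_eq_le)
    ultimately show ?thesis by (simp add: g_def Xs_def)
  qed
  have inj: "key h = key h'" if "bounded h" "h \<noteq> []" "bounded h'" "h' \<noteq> []" "g h = g h'" for h h'
    using trace_inj[of h h'] that by (simp add: g_def)
  \<comment> \<open>By \<open>inj\<close> the key is a function of \<open>g h\<close>, so there are
    no more keys than possible values of \<open>g\<close>.\<close>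
  define G where "G y = key (SOME h. bounded h \<and> h \<noteq> [] \<and> g h = y)" for y
  have "key h = G (g h)" if "bounded h" "h \<noteq> []" for h
  proof -
    define h' where "h' = (SOME h'. bounded h' \<and> h' \<noteq> [] \<and> g h' = g h)"
    have "\<exists>h'. bounded h' \<and> h' \<noteq> [] \<and> g h' = g h" using that by blast
    then have "bounded h' \<and> h' \<noteq> [] \<and> g h' = g h" unfolding h'_def by (rule someI_ex)
    then show ?thesis unfolding G_def h'_def[symmetric] using inj[of h h'] that by simp
  qed
  then have img: "key ` {h. bounded h \<and> h \<noteq> []} \<subseteq> G ` (Xs \<times> Fs)" using sub by blast
  have fin: "finite (Xs \<times> Fs)" using fX fF by simp
  show "finite (key ` {h. bounded h \<and> h \<noteq> []})" using img fin finite_subset by blast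
  have "card (key ` {h. bounded h \<and> h \<noteq> []}) \<le> card (Xs \<times> Fs)"
    using card_mono[OF _ img] card_image_le[OF fin, of G] fin by (meson finite_imageI le_trans)
  also have "\<dots> \<le> Kb" using fX fF by (simp add: card_cartesian_product Kb_def)
  finally show "card (key ` {h. bounded h \<and> h \<noteq> []}) \<le> Kb" .
qed

end

section \<open>The layers of the dynamic program\<close>

context dp_run
begin

lemma insW_eq:
  assumes "length L \<le> W"
  shows "insW z W xs \<delta> s L = (if \<exists>t\<in>set L. key (snd t) = key (snd s) \<and> fst t \<le> fst s then L
     else s # filter (\<lambda>t. key (snd t) \<noteq> key (snd s)) L)"
  unfolding insW_def same_iff take_all[OF assms] list_ex_iff by (rule refl)

text \<open>The empty history lacks the source, so the cut bound does not cover it; it occurs only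
  in layer 0, which is not pruned.\<close>

definition keyset :: "(nat list \<times> nat list \<times> nat list) set" where
  "keyset = key ` {h. bounded h \<and> h \<noteq> []}"

definition pruned :: "pstate list \<Rightarrow> bool" where
  "pruned L \<longleftrightarrow> distinct (map (\<lambda>s. key (snd s)) L) \<and> (\<forall>s\<in>set L. key (snd s) \<in> keyset)"

lemma pruned_length: "pruned L \<Longrightarrow> length L \<le> Kb"
proof -
  assume L: "pruned L"
  have "card (set (map (\<lambda>s. key (snd s)) L)) \<le> card keyset"
    using L card_keys(1) by (intro card_mono) (auto simp: pruned_def keyset_def)
  then show ?thesis using distinct_card[of "map (\<lambda>s. key (snd s)) L"] L card_keys(2)
    by (simp add: pruned_def keyset_def)
qed

lemma ins_pruned:
  assumes "pruned L" "key (snd s) \<in> keyset"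
  shows "pruned (insW z W xs \<delta> s L)" "set (insW z W xs \<delta> s L) \<subseteq> insert s (set L)"
    "\<forall>t\<in>insert s (set L). \<exists>u\<in>set (insW z W xs \<delta> s L). key (snd u) = key (snd t) \<and> fst u \<le> fst t"
proof -
  have l: "length L \<le> W" using pruned_length[OF assms(1)] Kb_le by simp
  note eq = insW_eq[OF l, of s]
  define kf where "kf = (\<lambda>s :: pstate. key (snd s))"
  have "distinct (map kf (s # filter (\<lambda>t. kf t \<noteq> kf s) L))" if "distinct (map kf L)"
    using that by (auto simp: distinct_map_filter)
  then show "pruned (insW z W xs \<delta> s L)" using assms unfolding eq pruned_def kf_def by simp
  show "set (insW z W xs \<delta> s L) \<subseteq> insert s (set L)" unfolding eq by auto
  show "\<forall>t\<in>insert s (set L). \<exists>u\<in>set (insW z W xs \<delta> s L). key (snd u) = key (snd t) \<and> fst u \<le> fst t"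
  proof (cases "\<exists>t\<in>set L. key (snd t) = key (snd s) \<and> fst t \<le> fst s")
    case True
    then show ?thesis unfolding eq by auto
  next
    case notex: False
    show ?thesis
    proof
      fix t assume t: "t \<in> insert s (set L)"
      have e: "insW z W xs \<delta> s L = s # filter (\<lambda>t. key (snd t) \<noteq> key (snd s)) L" using eq notex by simp
      show "\<exists>u\<in>set (insW z W xs \<delta> s L). key (snd u) = key (snd t) \<and> fst u \<le> fst t"
      proof (cases "key (snd t) = key (snd s)")
        case True
        have "t = s \<or> t \<in> set L" using t by simp
        then have "fst s \<le> fst t" using True notex nat_le_linear by blast
        then show ?thesis using True e by auto
      next
        case False
        then have "t \<in> set (insW z W xs \<delta> s L)" using t e by auto
        then show ?thesis by blast
      qed
    qed
  qed
qed

abbreviation prune :: "pstate list \<Rightarrow> pstate list \<Rightarrow> pstate list" where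
  "prune cs L \<equiv> fold (\<lambda>s a. insW z W xs \<delta> s a) cs L"

lemma fold_ins:
  assumes "pruned L" "\<forall>s\<in>set cs. key (snd s) \<in> keyset"
  shows "pruned (prune cs L) \<and> set (prune cs L) \<subseteq> set cs \<union> set L \<and>
    (\<forall>t\<in>set cs \<union> set L. \<exists>u\<in>set (prune cs L). key (snd u) = key (snd t) \<and> fst u \<le> fst t)"
  using assms
proof (induction cs arbitrary: L)
  case Nil
  then show ?case by auto
next
  case (Cons s cs)
  let ?L = "insW z W xs \<delta> s L"
  let ?R = "prune cs ?L"
  have s: "key (snd s) \<in> keyset" using Cons.prems by simp
  note ip = ins_pruned[OF Cons.prems(1) s]
  have IH: "pruned ?R" "set ?R \<subseteq> set cs \<union> set ?L"
    "\<forall>t\<in>set cs \<union> set ?L. \<exists>u\<in>set ?R. key (snd u) = key (snd t) \<and> fst u \<le> fst t"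
    using Cons.IH[OF ip(1)] Cons.prems(2) by auto
  have "\<exists>u\<in>set ?R. key (snd u) = key (snd t) \<and> fst u \<le> fst t" if t: "t \<in> set (s # cs) \<union> set L" for t
  proof (cases "t \<in> set cs")
    case True then show ?thesis using IH(3) by blast
  next
    case False
    then have "t \<in> insert s (set L)" using t by auto
    then obtain u where u: "u \<in> set ?L" "key (snd u) = key (snd t)" "fst u \<le> fst t" using ip(3) by blast
    then obtain v where "v \<in> set ?R" "key (snd v) = key (snd u)" "fst v \<le> fst u" using IH(3) by blast
    then show ?thesis using u by (intro bexI[of _ v]) auto
  qed
  moreover have "set ?R \<subseteq> set (s # cs) \<union> set L" using IH(2) ip(2) by auto
  ultimately show ?case using IH(1) by simp
qed

definition state_inv :: "nat \<Rightarrow> pstate \<Rightarrow> bool" where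
  "state_inv i s \<longleftrightarrow> bounded (snd s) \<and> length (snd s) = i \<and> fst s = hcost (snd s) \<and> fst s \<le> bud I"

lemma length_concat_le: "(\<And>x. x \<in> set ys \<Longrightarrow> length (g x) \<le> b) \<Longrightarrow> length (concat (map g ys)) \<le> length ys * b"
proof (induction ys)
  case (Cons y ys)
  have "length (g y) \<le> b" "length (concat (map g ys)) \<le> length ys * b" using Cons by auto
  then show ?case by simp
qed simp

lemma succsW_eq:
  "succs s = concat (map (\<lambda>j. map (grow s j) (locs j)) (filter (ready (snd s)) [0..<n]))"
proof -
  have l: "take W (locs j) = locs j" for j using length_locsW[of j] zkW by simp
  have f: "length (filter (ready (snd s)) [0..<n]) \<le> W"
    using length_filter_le[of "ready (snd s)" "[0..<n]"] n_le by simp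
  define Y where "Y = map (\<lambda>j. map (grow s j) (locs j)) (filter (ready (snd s)) [0..<n])"
  have Y: "take W Y = Y" "map (take W) Y = Y" using f l by (simp_all add: Y_def take_map)
  show ?thesis unfolding succsW_def header_nth upt_n l take_all[OF f] Y_def[symmetric] Y by (rule refl)
qed

lemma length_succsW: "length (succs s) \<le> n * (z + k)"
proof -
  have "length (succs s) \<le> length (filter (ready (snd s)) [0..<n]) * (z + k)"
    unfolding succsW_eq by (rule length_concat_le) (simp add: length_locsW)
  also have "\<dots> \<le> n * (z + k)"
    using length_filter_le[of "ready (snd s)" "[0..<n]"] by (intro mult_le_mono1) simp
  finally show ?thesis .
qed

lemma candsW_eq:
  assumes "length L \<le> Kb"
  shows "take W (candsW z W xs U L) = filter (okW W xs U) (concat (map (succs) L))"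
proof -
  have L: "length L \<le> W" using assms Kb_le by simp
  have t: "take W (succs s) = succs s" for s using length_succsW[of s] branch_le by simp
  have "length (concat (map (succs) L)) \<le> length L * (n * (z + k))"
    by (rule length_concat_le) (rule length_succsW)
  also have "\<dots> \<le> Kb * (n * (z + k))" using assms by (rule mult_le_mono1)
  finally have c: "length (concat (map (succs) L)) \<le> W" using Kb_branch by simp
  have m: "map (take W) (map (succs) L) = map (succs) L" "take W (map (succs) L) = map (succs) L"
    using L by (simp_all add: t)
  have e: "candsW z W xs U L = filter (okW W xs U) (concat (map (succs) L))"
    unfolding candsW_def take_all[OF L] m take_all[OF c] by (rule refl)
  have "length (candsW z W xs U L) \<le> W" unfolding e using c length_filter_le le_trans by blast
  then show ?thesis unfolding e by simp
qed

lemma succ_inv: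
  assumes s: "state_inv i s" and t: "t \<in> set (succs s)" "okW W xs U t"
  shows "state_inv (Suc i) t"
proof -
  obtain j l where jl: "j < n" "ready (snd s) j" "l \<in> set (locs j)" "t = grow s j l"
    using t(1) unfolding succsW_eq by auto
  have h: "hist (snd t)" using hist_Cons[OF _ jl(1-3)] s by (simp add: jl(4) extW_def state_inv_def bounded_def)
  have ok: "fst t \<le> bud I" "\<forall>a\<in>set (snd t). e_C a \<le> U"
    using t(2) s by (auto simp: okW_def header_nth jl(4) extW_def state_inv_def bounded_def)
  show ?thesis using h ok s by (simp add: state_inv_def bounded_def jl(4) extW_def hcost_def)
qed

definition layer :: "nat \<Rightarrow> pstate list" where
  "layer i = (layerW z W xs \<delta> U ^^ i) [(0, [])]"

lemma dpW_layer: "dpW z W xs \<delta> U = layer n"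
  unfolding dpW_def header_nth upt_n layer_def by (simp add: fold_ignore)

definition cands :: "nat \<Rightarrow> pstate list" where
  "cands i = filter (okW W xs U) (concat (map (succs) (layer i)))"

lemma layer_Suc: "length (layer i) \<le> Kb \<Longrightarrow> layer (Suc i) = prune (cands i) []"
  using candsW_eq[of "layer i"] by (simp add: layer_def[of "Suc i"] layer_def[of i, symmetric] layerW_def cands_def)

lemma cands_inv:
  assumes "\<forall>s\<in>set (layer i). state_inv i s"
  shows "t \<in> set (cands i) \<Longrightarrow> state_inv (Suc i) t" "\<forall>s\<in>set (cands i). key (snd s) \<in> keyset"
proof -
  show inv: "state_inv (Suc i) t" if t: "t \<in> set (cands i)" for t
  proof -
    from t obtain s where s: "s \<in> set (layer i)" "t \<in> set (succs s)" "okW W xs U t"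
      by (simp add: cands_def) blast
    have "state_inv i s" using s(1) assms by blast
    then show ?thesis using s(2,3) by (rule succ_inv)
  qed
  show "\<forall>s\<in>set (cands i). key (snd s) \<in> keyset"
    using inv unfolding keyset_def state_inv_def by fastforce
qed

lemma pruned_Nil: "pruned []" by (simp add: pruned_def)

lemma layer_props: "(\<forall>s\<in>set (layer i). state_inv i s) \<and> length (layer i) \<le> Kb"
proof (induction i)
  case 0
  show ?case using Kb_pos by (simp add: layer_def state_inv_def bounded_def hist_Nil hcost_def)
next
  case (Suc i)
  then have "pruned (layer (Suc i)) \<and> set (layer (Suc i)) \<subseteq> set (cands i)"
    using fold_ins[OF pruned_Nil cands_inv(2), of i] layer_Suc[of i] by simp
  then show ?case using cands_inv(1) Suc pruned_length by blast
qed

text \<open>All that the tracking argument has to know about pruning: an admissible extension is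
  lost only to a state of equal key and no higher cost.\<close>

lemma layer_dominates:
  assumes "s \<in> set (layer i)" "j < n" "ready (snd s) j" "l \<in> set (locs j)" "okW W xs U (grow s j l)"
  shows "\<exists>t\<in>set (layer (Suc i)). key (snd t) = key (snd (grow s j l)) \<and> fst t \<le> fst (grow s j l)"
proof -
  have "grow s j l \<in> set (succs s)" unfolding succsW_eq using assms by auto
  then have "grow s j l \<in> set (cands i)" unfolding cands_def using assms by auto
  then show ?thesis using fold_ins[OF pruned_Nil cands_inv(2), of i] layer_props[of i] layer_Suc[of i] by simp
qed

end

section \<open>Tracking a given schedule\<close>

context fptas_input
begin

text \<open>Breaks ties between jobs of length 0, whose start and completion times need not increase
  along an edge; it also yields a topological order.\<close>

definition depth :: "nat \<Rightarrow> nat" where "depth j = card {i. (i, j) \<in> E\<^sup>+}"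

lemma depth_edge: assumes "(i, j) \<in> E" shows "depth i < depth j"
proof -
  have "{a. (a, j) \<in> E\<^sup>+} \<subseteq> {0..<n}" using E_bounds by (auto dest: tranclD)
  then have "finite {a. (a, j) \<in> E\<^sup>+}" using finite_subset by blast
  moreover have "acyclic E" using wf by (simp add: wf_inst_def)
  then have "{a. (a, i) \<in> E\<^sup>+} \<subset> {a. (a, j) \<in> E\<^sup>+}" using assms by (auto simp: acyclic_def)
  ultimately show ?thesis unfolding depth_def by (rule psubset_card_mono)
qed

end

text \<open>\<open>hor\<close> leaves room for \<open>n\<close> prunings, each of which may delay
  the stored history by \<delta> - 1.\<close>

locale sched_run = dp_run +
  fixes Co :: "nat \<Rightarrow> nat" and \<eta> :: "nat \<Rightarrow> loc"
  assumes valid: "valid_sched I Co \<eta>" and budget: "sched_cost I \<eta> \<le> bud I" and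
    hor: "Co (snk I) + n * (\<delta> - 1) \<le> U"
begin

definition S :: "nat \<Rightarrow> nat" where "S j = Co j - ptime I \<eta> j"

lemma edge_int: "(i, j) \<in> E \<Longrightarrow>
    int (Co i) + int (dly I (ltype (\<eta> i)) (ltype (\<eta> j)) i j) \<le> int (Co j) - int (ptime I \<eta> j)"
  using valid unfolding valid_sched_def by blast

text \<open>Makes the truncated subtraction in \<open>S\<close> exact. The edge constraint is over
  the integers and hence excludes a negative start; a job without predecessors is the source, which
  takes time 0 on a server.\<close>

lemma ptime_le: assumes "j < n" shows "ptime I \<eta> j \<le> Co j"
proof (cases "\<exists>i. (i, j) \<in> E")
  case True
  then show ?thesis using edge_int by fastforce
next
  case False
  then have "j = src I" using no_pred[OF assms] by blast
  moreover have "is_server (\<eta> (src I))" using valid by (simp add: valid_sched_def)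
  ultimately have "ptime I \<eta> j = 0" using wf by (cases "\<eta> (src I)") (auto simp: ptime_def wf_inst_def)
  then show ?thesis by simp
qed

lemma S_add: "j < n \<Longrightarrow> S j + ptime I \<eta> j = Co j" using ptime_le by (simp add: S_def)

lemma S_le: "S j \<le> Co j" by (simp add: S_def)

lemma edge_S: "(i, j) \<in> E \<Longrightarrow> Co i + dly I (ltype (\<eta> i)) (ltype (\<eta> j)) i j \<le> S j"
  using edge_int[of i j] S_add[of j] E_bounds[of i j] by linarith

lemma server_S: "i < n \<Longrightarrow> j < n \<Longrightarrow> i \<noteq> j \<Longrightarrow> \<eta> i = \<eta> j \<Longrightarrow> is_server (\<eta> i) \<Longrightarrow> Co i \<le> S j \<or> Co j \<le> S i"
proof -
  assume a: "i < n" "j < n" "i \<noteq> j" "\<eta> i = \<eta> j" "is_server (\<eta> i)"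
  obtain m where "\<eta> i = Server m" using a(5) by (cases "\<eta> i") auto
  then have "ptime I \<eta> i = ps I i" "ptime I \<eta> j = ps I j" using a(4) by (auto simp: ptime_def)
  moreover have "int (Co i) \<le> int (Co j) - int (ps I j) \<or> int (Co i) - int (ps I i) \<ge> int (Co j)"
    using valid a unfolding valid_sched_def by blast
  ultimately show ?thesis using S_add[OF a(1)] S_add[OF a(2)] by linarith
qed

text \<open>Start times alone do not order jobs of length 0. Comparing completion times puts such a
  job before a longer one starting with it, and \<open>depth\<close> orders chains of them at a
  single moment.\<close>

definition prec :: "nat \<Rightarrow> nat \<Rightarrow> bool" where
  "prec b a \<longleftrightarrow> S b < S a \<or> S b = S a \<and> (Co b < Co a \<or> Co b = Co a \<and> depth b < depth a)"

lemma prec_edge: assumes "(i, j) \<in> E" shows "prec i j"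
proof -
  have "S i \<le> Co i" "Co i \<le> S j" "S j \<le> Co j" using edge_S[OF assms] by (simp_all add: S_le)
  then show ?thesis using depth_edge[OF assms] unfolding prec_def by (cases "S i < S j"; cases "Co i < Co j") auto
qed

lemma prec_min: assumes "B \<noteq> {}" shows "\<exists>j\<in>B. \<forall>b\<in>B. \<not> prec b j"
proof -
  define R where "R = inv_image (less_than <*lex*> less_than <*lex*> less_than) (\<lambda>j. (S j, Co j, depth j))"
  have "Wellfounded.wf R" unfolding R_def by (intro wf_inv_image wf_lex_prod wf_less_than)
  then obtain j where "j \<in> B" "\<And>y. (y, j) \<in> R \<Longrightarrow> y \<notin> B" using wfE_min assms by (metis ex_in_conv)
  moreover have "(b, j) \<in> R" if "prec b j" for b using that by (auto simp: R_def prec_def)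
  ultimately show ?thesis by blast
qed

text \<open>The opposite order on the server without \<open>prec j i\<close> is possible only if
  both jobs have length 0 at the same moment, and then the claim holds as well.\<close>

lemma server_order:
  assumes "i < n" "j < n" "i \<noteq> j" "\<eta> i = \<eta> j" "is_server (\<eta> i)" "\<not> prec j i"
  shows "Co i \<le> S j"
proof (rule ccontr)
  assume "\<not> Co i \<le> S j"
  then have "Co j \<le> S i" using server_S[OF assms(1-5)] by blast
  moreover have "S j \<le> Co j" "S i \<le> Co i" by (simp_all add: S_le)
  ultimately show False using assms(6) \<open>\<not> Co i \<le> S j\<close> unfolding prec_def by (cases "S j < S i") auto
qed

lemma Co_le_snk: "j < n \<Longrightarrow> Co j \<le> Co (snk I)"
proof (induction j rule: wf_induct_rule[OF wfE(2)])
  case (1 j)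
  show ?case
  proof (cases "j = snk I")
    case False
    then obtain i where i: "(j, i) \<in> E" using no_succ 1(2) by blast
    then have "Co i \<le> Co (snk I)" using 1(1)[of i] E_bounds by auto
    then show ?thesis using edge_S[OF i] S_le[of i] by linarith
  qed simp
qed

definition lc :: "nat \<Rightarrow> nat \<times> nat" where
  "lc j = (case \<eta> j of Server m \<Rightarrow> (0, m) | Cloud c \<Rightarrow> (Suc c, 0))"

definition cc :: "nat \<Rightarrow> nat" where
  "cc j = (case \<eta> j of Server m \<Rightarrow> 0 | Cloud c \<Rightarrow> cst I j c)"

lemma lc_props:
  assumes "j < n"
  shows "lc j \<in> set (locs j)" "ptm (fst (lc j)) j = ptime I \<eta> j" "mty (fst (lc j)) = ltype (\<eta> j)"
    "price j (fst (lc j)) = cc j"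
proof -
  have v: "case \<eta> j of Server m \<Rightarrow> m < z | Cloud c \<Rightarrow> c < k" 
    using valid assms unfolding valid_sched_def nz by blast
  have s: "is_server (\<eta> (src I))" "is_server (\<eta> (snk I))" using valid by (simp_all add: valid_sched_def)
  have ne: "j \<noteq> src I \<and> j \<noteq> snk I" if "\<eta> j = Cloud c" for c using s that by auto
  show "lc j \<in> set (locs j)" unfolding locsW_set using v ne by (cases "\<eta> j") (auto simp: lc_def)
  show "ptm (fst (lc j)) j = ptime I \<eta> j"
    using v ne ptimeW_eq[OF _ assms, of "fst (lc j)"] by (cases "\<eta> j") (auto simp: lc_def ptime_def)
  show "mty (fst (lc j)) = ltype (\<eta> j)" by (cases "\<eta> j") (auto simp: lc_def)
  show "price j (fst (lc j)) = cc j"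
    using v ne costW_eq[OF _ assms, of "fst (lc j)"] by (cases "\<eta> j") (auto simp: lc_def cc_def)
qed

lemma sum_cc: "(\<Sum>j\<in>{0..<n}. cc j) \<le> bud I"
proof -
  have "(\<Sum>j\<in>{0..<n}. cc j) = sched_cost I \<eta>" unfolding sched_cost_def cc_def
    by (rule sum.mono_neutral_right) (auto split: loc.splits)
  then show ?thesis using budget by simp
qed

text \<open>\<open>d\<close> bounds how far the times of the stored history lag behind those of the given schedule.
  Only jobs with an unscheduled successor have to be compared: the others are forgotten by the key.\<close>

definition tracks :: "nat \<Rightarrow> nat set \<Rightarrow> pstate \<Rightarrow> bool" where
  "tracks d A s \<longleftrightarrow> jobs (snd s) = A \<and> fst s \<le> (\<Sum>j\<in>A. cc j) \<and>
     (\<forall>a\<in>set (snd s). (\<exists>b. (e_job a, b) \<in> E \<and> b \<notin> A) \<longrightarrow> e_ty a = fst (lc (e_job a)) \<and> e_C a \<le> Co (e_job a) + d) \<and>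
     (\<forall>m<z. \<forall>b. b < n \<and> b \<notin> A \<and> \<eta> b = Server m \<longrightarrow> free_at (snd s) m \<le> S b + d)"

definition initial :: "nat set \<Rightarrow> bool" where
  "initial A \<longleftrightarrow> A \<subseteq> {0..<n} \<and> (\<forall>a\<in>A. \<forall>b. b < n \<and> b \<notin> A \<longrightarrow> \<not> prec b a)"

text \<open>Extension adds no lag: the earliest start is a maximum over predecessors and the chosen
  server, and each of these terms exceeds the start in the given schedule by at most
  \<open>d\<close>.\<close>

lemma tracks_ext:
  assumes s: "bounded (snd s)" and A: "initial A" and t: "tracks d A s" and d: "d \<le> n * (\<delta> - 1)"
    and j: "j < n" "j \<notin> A" and mn: "\<forall>b. b < n \<and> b \<notin> A \<longrightarrow> \<not> prec b j"
  defines "s' \<equiv> grow s j (lc j)"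
  shows "ready (snd s) j" "okW W xs U s'" "bounded (snd s')" "tracks d (insert j A) s'" "initial (insert j A)"
proof -
  have h: "hist (snd s)" using s by (simp add: bounded_def)
  have J: "jobs (snd s) = A" using t by (simp add: tracks_def)
  note lp = lc_props[OF j(1)]
  have preds: "i \<in> A" if "(i, j) \<in> E" for i
    using mn prec_edge[OF that] E_bounds[OF that] by blast
  show r: "ready (snd s) j" using hist_ready[OF h j(1)] J preds j(2) by blast
  have st: "start (snd s) j (lc j) \<le> S j + d"
    unfolding startW_le[OF hist_len[OF h]]
  proof
    fix a assume a: "a \<in> set (snd s)"
    show "(if edge (e_job a) j then e_C a + delay (e_ty a) (fst (lc j)) (e_job a) j
      else if fst (lc j) = 0 \<and> e_ty a = 0 \<and> e_srv a = snd (lc j) then e_C a else 0) \<le> S j + d"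
    proof (cases "edge (e_job a) j")
      case True
      have an: "e_job a < n" using a hist_basic[OF h] by auto
      then have E: "(e_job a, j) \<in> E" using True edgeW_iff j by blast
      then have ac: "e_ty a = fst (lc (e_job a))" "e_C a \<le> Co (e_job a) + d" using t a j(2) unfolding tracks_def by blast+
      have "delay (e_ty a) (fst (lc j)) (e_job a) j = dly I (ltype (\<eta> (e_job a))) (ltype (\<eta> j)) (e_job a) j"
        using delayW_eq[OF _ _ E, of "e_ty a" "fst (lc j)"] hist_loc[OF h a] locs_props[OF lp(1)] lp(3) lc_props(3)[OF an] ac(1)
        by simp
      then show ?thesis using True ac(2) edge_S[OF E] by simp
    next
      case False
      show ?thesis
      proof (cases "fst (lc j) = 0 \<and> e_ty a = 0 \<and> e_srv a = snd (lc j)")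
        case True
        then have "\<eta> j = Server (snd (lc j))" by (cases "\<eta> j") (auto simp: lc_def)
        moreover have "snd (lc j) < z" using locs_props[OF lp(1)] True by simp
        ultimately have "free_at (snd s) (snd (lc j)) \<le> S j + d" using t j unfolding tracks_def by blast
        then have "e_C a \<le> S j + d" using freeW_le[OF hist_len[OF h]] a True by blast
        then show ?thesis using False by simp
      qed (use False in auto)
    qed
  qed
  define c where "c = start (snd s) j (lc j) + ptm (fst (lc j)) j"
  have s': "snd s' = (j, fst (lc j), snd (lc j), c) # snd s" "fst s' = fst s + cc j"
    using lp(4) by (simp_all add: s'_def extW_def c_def)
  have cC: "c \<le> Co j + d" using st lp(2) S_add[OF j(1)] by (simp add: c_def)
  have cU: "c \<le> U" using cC Co_le_snk[OF j(1)] d hor by linarith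
  have h': "hist (snd s')" unfolding s'(1) c_def by (rule hist_Cons[OF h j(1) r lp(1)])
  show "bounded (snd s')" using h' s cU by (auto simp: bounded_def s'(1))
  have An: "A \<subseteq> {0..<n}" "finite A" using A finite_subset by (auto simp: initial_def)
  have cost: "fst s' \<le> (\<Sum>i\<in>insert j A. cc i)" using t j(2) An(2) by (simp add: s'(2) tracks_def)
  also have "\<dots> \<le> (\<Sum>i\<in>{0..<n}. cc i)" using An j(1) by (intro sum_mono2) auto
  finally have "fst s' \<le> bud I" using sum_cc by linarith
  then show "okW W xs U s'" using cU by (simp add: okW_def header_nth s'(1))
  show "initial (insert j A)" using A mn j(1) unfolding initial_def by auto
  have "jobs (snd s') = insert j A" using J by (simp add: s'(1))
  moreover have "e_ty a = fst (lc (e_job a)) \<and> e_C a \<le> Co (e_job a) + d"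
    if a: "a \<in> set (snd s')" and b: "(e_job a, b) \<in> E" "b \<notin> insert j A" for a b
  proof (cases "a \<in> set (snd s)")
    case True
    then show ?thesis using t b unfolding tracks_def by blast
  next
    case False
    then show ?thesis using a cC by (simp add: s'(1))
  qed
  moreover have "free_at (snd s') m \<le> S b + d" if m: "m < z" and b: "b < n" "b \<notin> insert j A" "\<eta> b = Server m" for m b
    unfolding freeW_le[OF hist_len[OF h']]
  proof (intro ballI impI)
    fix a assume a: "a \<in> set (snd s')" "e_ty a = 0 \<and> e_srv a = m"
    show "e_C a \<le> S b + d"
    proof (cases "a \<in> set (snd s)")
      case True
      have "free_at (snd s) m \<le> S b + d" using t m b unfolding tracks_def by blast
      then show ?thesis using freeW_le[OF hist_len[OF h]] True a(2) by blast
    next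
      case False
      then have an: "a = (j, fst (lc j), snd (lc j), c)" using a(1) by (simp add: s'(1))
      then have "\<eta> j = Server m" using a(2) by (cases "\<eta> j") (auto simp: lc_def)
      \<comment> \<open>Jobs still missing on this server do not precede \<open>j\<close>, so in the
        given schedule they start after \<open>j\<close> completes.\<close>
      then have "Co j \<le> S b" using server_order[OF j(1) b(1)] b mn by auto
      then show ?thesis using cC an by simp
    qed
  qed
  ultimately show "tracks d (insert j A) s'" using cost unfolding tracks_def by blast
qed

text \<open>The only source of lag. The servers enter through their free times alone, so the two
  histories may have distributed the forgotten jobs differently.\<close>

lemma tracks_key:
  assumes s: "bounded (snd s)" "bounded (snd t)" and key: "key (snd t) = key (snd s)" and le: "fst t \<le> fst s"
    and tr: "tracks d A s"
  shows "tracks (d + (\<delta> - 1)) A t"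
proof -
  note ka = key_agree[OF s key[symmetric]]
  have J: "jobs (snd s) = A" "jobs (snd t) = A" using tr ka(1) by (auto simp: tracks_def)
  have "e_ty a = fst (lc (e_job a)) \<and> e_C a \<le> Co (e_job a) + (d + (\<delta> - 1))"
    if a: "a \<in> set (snd t)" and b: "(e_job a, b) \<in> E" "b \<notin> A" for a b
  proof -
    have "e_job a \<in> jobs (snd s)" using a J by blast
    then obtain a' where a': "a' \<in> set (snd s)" "e_job a' = e_job a" by force
    have "e_ty a' = fst (lc (e_job a)) \<and> e_C a' \<le> Co (e_job a) + d"
      using tr a' b unfolding tracks_def by (metis (no_types))
    moreover have "e_ty a' = e_ty a \<and> e_C a \<le> e_C a' + (\<delta> - 1)" using ka(2)[OF a'(1) a a'(2)] a'(2) b J by auto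
    ultimately show ?thesis by linarith
  qed
  moreover have "free_at (snd t) m \<le> S b + (d + (\<delta> - 1))" if "m < z" "b < n" "b \<notin> A" "\<eta> b = Server m" for m b
  proof -
    have "free_at (snd s) m \<le> S b + d" using tr that unfolding tracks_def by blast
    then show ?thesis using ka(3)[OF that(1)] by linarith
  qed
  moreover have "fst t \<le> (\<Sum>j\<in>A. cc j)" using le tr unfolding tracks_def by linarith
  ultimately show ?thesis using J unfolding tracks_def by blast
qed

lemma tracked_layer:
  "i \<le> n \<Longrightarrow> \<exists>A s. initial A \<and> card A = i \<and> s \<in> set (layer i) \<and> tracks (i * (\<delta> - 1)) A s"
proof (induction i)
  case 0
  have "tracks 0 {} (0, [])" by (simp add: tracks_def freeW_def)
  then show ?case by (intro exI[of _ "{}"] exI[of _ "(0, [])"]) (simp add: initial_def layer_def)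
next
  case (Suc i)
  then obtain A s where A: "initial A" "card A = i" and s: "s \<in> set (layer i)" "tracks (i * (\<delta> - 1)) A s" by auto
  have An: "A \<subseteq> {0..<n}" using A by (simp add: initial_def)
  have "{0..<n} - A \<noteq> {}"
  proof
    assume "{0..<n} - A = {}"
    then have "A = {0..<n}" using An by blast
    then show False using A(2) Suc.prems by simp
  qed
  from prec_min[OF this] obtain j where j: "j < n" "j \<notin> A" "\<forall>b. b < n \<and> b \<notin> A \<longrightarrow> \<not> prec b j"
    by auto
  have sb: "bounded (snd s)" using layer_props[of i] s(1) by (auto simp: state_inv_def)
  have d: "i * (\<delta> - 1) \<le> n * (\<delta> - 1)" using Suc.prems by (intro mult_le_mono1) simp
  note te = tracks_ext[OF sb A(1) s(2) d j]
  from layer_dominates[OF s(1) j(1) te(1) lc_props(1)[OF j(1)] te(2)] obtain t where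
    t: "t \<in> set (layer (Suc i))" "key (snd t) = key (snd (grow s j (lc j)))" "fst t \<le> fst (grow s j (lc j))" by blast
  have tb: "bounded (snd t)" using layer_props[of "Suc i"] t(1) by (auto simp: state_inv_def)
  have "tracks (i * (\<delta> - 1) + (\<delta> - 1)) (insert j A) t" by (rule tracks_key[OF te(3) tb t(2,3) te(4)])
  moreover have "card (insert j A) = Suc i" using A(2) j(2) An finite_subset[OF An] by simp
  ultimately show ?case using te(5) t(1) by (intro exI[of _ "insert j A"] exI[of _ t]) (simp add: add.commute)
qed

lemma dp_nonempty: "dpW z W xs \<delta> U \<noteq> []"
  unfolding dpW_layer using tracked_layer[OF order_refl] by (metis empty_iff empty_set)

end

section \<open>The search and its approximation ratio\<close>

lemma grid_div_mod:
  fixes a b m :: nat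
  assumes "b < m" shows "(a * m + b) div m = a" "(a * m + b) mod m = b"
  using assms by simp_all

context fptas_input
begin

text \<open>All jobs on one server in topological order: delays vanish between equal types and the
  cost is 0, so some schedule meets every budget. Its length bounds how often \<delta> has to be
  doubled.\<close>

lemma serial_schedule:
  "\<exists>C \<eta>. valid_sched I C \<eta> \<and> sched_cost I \<eta> \<le> bud I \<and> C (snk I) \<le> (\<Sum>j\<in>{0..<n}. ps I j)"
proof -
  \<comment> \<open>The jobs up to and including \<open>j\<close>, ordered by depth and then by
    number.\<close>
  define P where "P j = {i. i < n \<and> (depth i < depth j \<or> depth i = depth j \<and> i \<le> j)}" for j
  define C where "C j = (\<Sum>i\<in>P j. ps I i)" for j
  have fin: "finite (P j)" for j by (simp add: P_def)
  have ord: "C i + ps I j \<le> C j" if "j < n" "i \<noteq> j" "depth i < depth j \<or> depth i = depth j \<and> i \<le> j" for i j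
  proof -
    have "j \<notin> P i" "insert j (P i) \<subseteq> P j" using that by (auto simp: P_def)
    then have "(\<Sum>a\<in>insert j (P i). ps I a) \<le> C j" unfolding C_def by (intro sum_mono2 fin) auto
    then show ?thesis using \<open>j \<notin> P i\<close> fin by (simp add: C_def)
  qed
  have "valid_sched I C (\<lambda>_. Server 0)" unfolding valid_sched_def
  proof (intro conjI allI impI)
    show "case Server 0 of Server m \<Rightarrow> m < nz I | Cloud c \<Rightarrow> c < k" for j using nz z_pos by simp
    show "is_server (Server 0)" "is_server (Server 0)" by simp_all
    fix i j assume ij: "i < n" "j < n" "i \<noteq> j \<and> Server 0 = Server 0 \<and> is_server (Server 0)"
    have "C i + ps I j \<le> C j \<or> C j + ps I i \<le> C i" using ord[of j i] ord[of i j] ij by force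
    then show "int (C i) \<le> int (C j) - int (ps I j) \<or> int (C j) \<le> int (C i) - int (ps I i)" by linarith
  next
    show "\<forall>(i, j)\<in>E. int (C i) + int (dly I (ltype (Server 0)) (ltype (Server 0)) i j)
        \<le> int (C j) - int (ptime I (\<lambda>_. Server 0) j)"
    proof (intro ballI, clarify)
      fix i j assume E: "(i, j) \<in> E"
      have "C i + ps I j \<le> C j" using ord[of j i] depth_edge[OF E] E_bounds[OF E] by auto
      then show "int (C i) + int (dly I (ltype (Server 0)) (ltype (Server 0)) i j)
        \<le> int (C j) - int (ptime I (\<lambda>_. Server 0) j)" using dly_same by (simp add: ptime_def)
    qed
  qed
  moreover have "sched_cost I (\<lambda>_. Server 0) \<le> bud I" by (simp add: sched_cost_def)
  moreover have "C (snk I) \<le> (\<Sum>j\<in>{0..<n}. ps I j)" unfolding C_def by (rule sum_mono2) (auto simp: P_def)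
  ultimately show ?thesis by blast
qed

lemma sum_ps_le: "(\<Sum>j\<in>{0..<n}. ps I j) \<le> sum_list xs"
proof -
  have "(\<Sum>j\<in>{0..<n}. ps I j) = sum_list (map (ps I) [0..<n])" by (simp add: interv_sum_list_conv_sum_set_nat)
  also have "\<dots> \<le> sum_list xs" unfolding xs_parts time_part_def by simp
  finally show ?thesis .
qed

text \<open>The attempt number is read in base M + 1: its quotient counts the doublings, its
  remainder is the horizon in units of the width.\<close>

definition step_width :: "nat \<Rightarrow> nat" where "step_width t = 2 ^ (t div Suc M)"
definition horizon :: "nat \<Rightarrow> nat" where "horizon t = t mod Suc M"
definition attempt :: "nat \<Rightarrow> pstate list" where
  "attempt t = dpW z W xs (step_width t) (step_width t * horizon t)"

lemma horizon_le: "horizon t \<le> M" by (simp add: horizon_def less_Suc_eq_le[symmetric])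

lemma attempt_run: "dp_run I e W z xs \<phi> M (step_width t) (step_width t * horizon t)"
  using horizon_le[of t] by unfold_locales (auto simp: step_width_def mult.commute)

lemma attempt_complete:
  assumes "valid_sched I C \<eta>" "sched_cost I \<eta> \<le> bud I" "C (snk I) + n * (step_width t - 1) \<le> step_width t * horizon t"
  shows "attempt t \<noteq> []"
proof -
  interpret dp_run I e W z xs \<phi> M "step_width t" "step_width t * horizon t" by (rule attempt_run)
  interpret sched_run I e W z xs \<phi> M "step_width t" "step_width t * horizon t" C \<eta>
    using assms by unfold_locales
  show ?thesis unfolding attempt_def by (rule dp_nonempty)
qed

lemma attempt_sound:
  assumes "s \<in> set (attempt t)"
  shows "hist (snd s)" "jobs (snd s) = {0..<n}" "hcost (snd s) \<le> bud I" "\<forall>a\<in>set (snd s). e_C a \<le> step_width t * horizon t"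
proof -
  interpret dp_run I e W z xs \<phi> M "step_width t" "step_width t * horizon t" by (rule attempt_run)
  have s: "state_inv n s" using assms layer_props[of n] unfolding attempt_def dpW_layer by blast
  then show h: "hist (snd s)" "hcost (snd s) \<le> bud I" "\<forall>a\<in>set (snd s). e_C a \<le> step_width t * horizon t"
    by (auto simp: state_inv_def bounded_def)
  have "card (jobs (snd s)) = n" "jobs (snd s) \<subseteq> {0..<n}" using s hist_card[OF h(1)] hist_basic[OF h(1)] by (auto simp: state_inv_def)
  then show "jobs (snd s) = {0..<n}" by (intro card_subset_eq) auto
qed

lemma search_invariant:
  defines "st \<equiv> \<lambda>t. (search_step z W xs M ^^ t) (1, 0, [])"
  shows "st t = (step_width t, horizon t, []) \<and> (\<forall>u<t. attempt u = []) \<or>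
    (\<exists>u<t. attempt u \<noteq> [] \<and> (\<forall>v<u. attempt v = []) \<and> snd (snd (st t)) = attempt u)"
proof (induction t)
  case 0
  show ?case by (simp add: st_def step_width_def horizon_def)
next
  case (Suc t)
  have S: "st (Suc t) = search_step z W xs M (st t)" by (simp add: st_def)
  from Suc show ?case
  proof
    assume a: "st t = (step_width t, horizon t, []) \<and> (\<forall>u<t. attempt u = [])"
    have m: "mulW W (step_width t) (horizon t) = step_width t * horizon t"
      using horizon_le[of t] MW by (simp add: mulW_def)
    show ?case
    proof (cases "attempt t = []")
      case True
      have "st (Suc t) = (if horizon t < M then (step_width t, Suc (horizon t), []) else (step_width t + step_width t, 0, []))"
        using True a m by (simp add: S search_step_def attempt_def)
      also have "\<dots> = (step_width (Suc t), horizon (Suc t), [])"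
      proof (cases "horizon t < M")
        case True
        then show ?thesis by (simp add: step_width_def horizon_def mod_Suc div_Suc)
      next
        case False
        then have "t mod Suc M = M" using horizon_le[of t] unfolding horizon_def by linarith
        then show ?thesis by (simp add: step_width_def horizon_def mod_Suc div_Suc)
      qed
      finally show ?thesis using a True by (simp add: less_Suc_eq)
    next
      case False
      then have "snd (snd (st (Suc t))) = attempt t" using a m by (simp add: S search_step_def attempt_def)
      then show ?thesis using False a by blast
    qed
  next
    assume "\<exists>u<t. attempt u \<noteq> [] \<and> (\<forall>v<u. attempt v = []) \<and> snd (snd (st t)) = attempt u"
    then obtain u where u: "u < t" "attempt u \<noteq> []" "\<forall>v<u. attempt v = []" "snd (snd (st t)) = attempt u" by blast
    then have "st (Suc t) = st t" by (simp add: S search_step_def)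
    then show ?thesis using u less_SucI by metis
  qed
qed

text \<open>Only failures before \<open>u\<close> are used: the attempt just before
  \<open>u\<close>, which has the same width, and the last attempt with half that width. The initial
  width 1 has no predecessor but causes no error.\<close>

lemma first_attempt_ratio:
  assumes M: "M = 2 * Suc n * e + Suc n" and u: "\<forall>v<u. attempt v = []"
    and C: "valid_sched I C \<eta>" "sched_cost I \<eta> \<le> bud I"
  shows "e * (step_width u * horizon u) \<le> (e + 1) * C (snk I)"
proof (cases "horizon u = 0")
  case False
  define T where "T = C (snk I)"
  define d where "d = step_width u"
  define h where "h = horizon u"
  define q where "q = u div Suc M"
  have d1: "1 \<le> d" by (simp add: d_def step_width_def)
  have uq: "u = q * Suc M + h" 
    using div_mult_mod_eq[of u "Suc M"] by (simp only: q_def h_def horizon_def)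
  have hM: "h \<le> M" using horizon_le by (simp add: h_def)
  have fail: "step_width v * horizon v < T + n * (step_width v - 1)" if "v < u" for v
    using attempt_complete[OF C, of v] u that unfolding T_def by fastforce
  have "d * (h - 1) < T + n * (d - 1)"
  proof -
    have "u - 1 = q * Suc M + (h - 1)" using uq False by (simp add: h_def)
    moreover have "h - 1 < Suc M" using hM by simp
    ultimately have "(u - 1) div Suc M = q" "(u - 1) mod Suc M = h - 1"
      using grid_div_mod[of "h - 1" "Suc M" q] by (simp_all only:)
    then have "step_width (u - 1) = d" "horizon (u - 1) = h - 1"
      by (simp_all add: step_width_def horizon_def d_def q_def)
    moreover have "u - 1 < u" using uq False by (simp add: h_def)
    ultimately show ?thesis using fail by metis
  qed
  moreover have "d * h = d * (h - 1) + d" using False by (simp add: h_def algebra_simps)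
  \<comment> \<open>The failure is a strict inequality between integers, which saves 1: adding
    \<open>d\<close> to its left side gives T + n * (d - 1) + (d - 1).\<close>
  ultimately have A: "d * h \<le> T + Suc n * (d - 1)" using d1 by simp
  show ?thesis
  proof (cases "q = 0")
    case True
    then have "d = 1" by (simp add: d_def step_width_def q_def[symmetric])
    then have "d * h \<le> T" using A by simp
    then have "e * (d * h) \<le> e * T" by (rule mult_le_mono2)
    then have "e * (d * h) \<le> (e + 1) * T" unfolding distrib_right by linarith
    then show ?thesis unfolding d_def h_def T_def .
  next
    case False
    then obtain p where p: "q = Suc p" using not0_implies_Suc by blast
    define g where "g = (2::nat) ^ p"
    have g: "d = 2 * g" "1 \<le> g" by (simp_all add: d_def step_width_def q_def[symmetric] p g_def)
    \<comment> \<open>The last attempt before the width was doubled to \<open>d\<close>: width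
      \<open>g\<close>, horizon index \<open>M\<close>.\<close>
    define v where "v = p * Suc M + M"
    have v: "v < u" "v div Suc M = p" "v mod Suc M = M"
      using uq grid_div_mod[of M "Suc M" p] unfolding v_def p by simp_all
    have "g * M < T + n * (g - 1)" using fail[OF v(1)] v by (simp add: step_width_def horizon_def g_def)
    \<comment> \<open>The summand \<open>Suc n\<close> of \<open>M\<close> contributes g + n * g and
      so absorbs the loss n * (g - 1); the rest of \<open>M\<close> gives the bound on
      \<open>T\<close>.\<close>
    moreover have "g * M = Suc n * e * d + (g + n * g)" by (simp add: M g algebra_simps)
    moreover have "n * (g - 1) \<le> n * g" by simp
    ultimately have "Suc n * e * d \<le> T" by linarith
    moreover have "Suc n * e * (d - 1) \<le> Suc n * e * d" by (rule mult_le_mono2) simp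
    moreover have "e * (Suc n * (d - 1)) = Suc n * e * (d - 1)" by (simp only: ac_simps)
    ultimately have "e * (Suc n * (d - 1)) \<le> T" by linarith
    moreover have "e * (d * h) \<le> e * (T + Suc n * (d - 1))" using A by (rule mult_le_mono2)
    ultimately have "e * (d * h) \<le> e * T + T" by (simp only: distrib_left)
    then have "e * (d * h) \<le> (e + 1) * T" unfolding distrib_right by linarith
    then show ?thesis unfolding d_def h_def T_def .
  qed
qed simp

lemma search_finds:
  assumes M: "M = 2 * Suc n * e + Suc n" and WQ: "Suc (bitlen (sum_list xs)) * Suc M \<le> W" and eW: "e \<le> W"
  shows "\<exists>u. attempt u \<noteq> [] \<and> (\<forall>v<u. attempt v = []) \<and> snd (snd (searchW z W xs e)) = attempt u"
proof -
  have hz: "horizonW W xs e = M" unfolding horizonW_def header_nth Let_def using eW by (simp add: M mulW_def)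
  define Q where "Q = bitlen (sum_list xs)"
  \<comment> \<open>At width 2 ^ Q the horizon (n + 1) * 2 ^ Q suffices: 2 ^ Q for the serial
    schedule and less than n * 2 ^ Q + 1 for the lag of n * (2 ^ Q - 1).\<close>
  define t where "t = Q * Suc M + Suc n"
  have nM: "Suc n \<le> M" by (simp add: M)
  then have t: "step_width t = 2 ^ Q" "horizon t = Suc n" 
    using grid_div_mod[of "Suc n" "Suc M" Q] unfolding step_width_def horizon_def t_def by (simp_all only: less_Suc_eq_le)
  obtain C \<eta> where C: "valid_sched I C \<eta>" "sched_cost I \<eta> \<le> bud I" "C (snk I) \<le> (\<Sum>j\<in>{0..<n}. ps I j)"
    using serial_schedule by blast
  have "C (snk I) \<le> 2 ^ Q" using C(3) sum_ps_le bitlen_gt[of "sum_list xs"] unfolding Q_def by linarith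
  moreover have "n * (2 ^ Q - 1) \<le> n * (2 ^ Q)" by simp
  ultimately have "C (snk I) + n * (step_width t - 1) \<le> step_width t * horizon t" unfolding t by (simp add: algebra_simps)
  then have "attempt t \<noteq> []" using attempt_complete C by blast
  moreover have "t < W" using WQ nM unfolding t_def Q_def by simp
  ultimately have "\<not> (\<forall>u<W. attempt u = [])" by blast
  then show ?thesis using search_invariant[of W] unfolding searchW_def hz by blast
qed

end

section \<open>Unpacking the input and packing the output\<close>

context instance_input
begin

lemma unrotate: "unrotateW W (rev (drop 9 xs @ take 9 xs)) = rev xs"
proof -
  define zs where "zs = rev (drop 9 xs @ take 9 xs)"
  have l: "length zs = length xs" by (simp add: zs_def)
  then have "10 \<le> length zs" using len10 by simp
  then obtain a0 a1 a2 a3 a4 a5 a6 a7 a8 rest where zs: "zs = a0 # a1 # a2 # a3 # a4 # a5 # a6 # a7 # a8 # rest"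
    by (auto simp: Suc_le_length_iff numeral_eq_Suc)
  have nth: "nthW W zs i = zs ! i" if "i \<le> 8" for i
    using that l len10 lenW by (intro nthW_eq) auto
  have "unrotateW W zs = take W rest @ [a0, a1, a2, a3, a4, a5, a6, a7, a8]"
    unfolding unrotateW_def using nth[of 0] nth[of 1] nth[of 2] nth[of 3] nth[of 4] nth[of 5] nth[of 6] nth[of 7] nth[of 8]
    by (simp add: zs)
  also have "\<dots> = drop 9 zs @ take 9 zs" using l lenW by (simp add: zs)
  also have "\<dots> = rev xs"
  proof -
    have "zs = rev (take 9 xs) @ rev (drop 9 xs)" "length (rev (take 9 xs)) = 9" using len10 by (simp_all add: zs_def)
    then have "drop 9 zs = rev (drop 9 xs)" "take 9 zs = rev (take 9 xs)" by simp_all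
    then show ?thesis by (metis append_take_drop_id rev_append)
  qed
  finally show ?thesis by (simp add: zs_def)
qed

lemma packW_eq:
  assumes "length ys + 5 \<le> W" "ys \<noteq> []"
  shows "packW W ys = (length (ys @ [0,0,0,0,0]), rev (tl (ys @ [0,0,0,0,0])) @ [length ys, hd (ys @ [0,0,0,0,0])])"
proof -
  have c: "fold (\<lambda>y s. Suc s) vs a = a + length vs" for vs :: "nat list" and a by (induction vs arbitrary: a) auto
  have n: "nthW W (ys @ [0,0,0,0,0]) 0 = hd ys" using assms by (simp add: nthW_eq hd_conv_nth nth_append)
  show ?thesis unfolding packW_def Let_def using assms n by (simp add: c)
qed

lemma mainW_eq:
  assumes "snd (snd (searchW z W xs e)) = s # ss"
  shows "mainW z W (drop 9 xs @ take 9 xs) = (let ws = outW W xs (snd s) @ [0,0,0,0,0]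
     in (length ws, rev (tl ws) @ [2 * n, hd ws]))"
proof -
  have l: "length (drop 9 xs @ take 9 xs) \<le> W" "length (rev xs) \<le> W" using lenW by simp_all
  have e: "nthW W (rev xs) 0 = e" using lenW by (subst nthW_eq) (auto simp: xs)
  have "outW W xs (snd s) \<noteq> []" using length_outW[of "snd s"] n_pos by auto
  then have p: "packW W (outW W xs (snd s)) = (let ws = outW W xs (snd s) @ [0,0,0,0,0] in (length ws, rev (tl ws) @ [2 * n, hd ws]))"
    using packW_eq[of "outW W xs (snd s)"] two_n lenW by (simp add: length_outW Let_def)
  have "unrotateW W (rev (take W (drop 9 xs @ take 9 xs))) = rev xs" using unrotate take_all[OF l(1)] by simp
  moreover have "rev (take W (rev xs)) = xs" using take_all[OF l(2)] by simp
  ultimately show ?thesis unfolding mainW_def Let_def using e assms p by (simp add: Let_def)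
qed

end

section \<open>Size bounds and the approximation scheme\<close>

lemma bitlen_sum_list: "bitlen (sum_list xs) \<le> enc_size xs"
proof -
  have "sum_list xs < 2 ^ enc_size xs"
  proof (induction xs)
    case Nil
    then show ?case by (simp add: enc_size_def)
  next
    case (Cons x xs)
    define b where "b = bitlen x"
    define m where "m = enc_size xs"
    have "x < 2 ^ b" "sum_list xs < 2 ^ m" using bitlen_gt Cons by (auto simp: b_def m_def)
    moreover have "(2::nat) ^ b * 1 \<le> 2 ^ b * 2 ^ m" "(2::nat) ^ m * 1 \<le> 2 ^ m * 2 ^ b" by (intro mult_le_mono2; simp)+
    \<comment> \<open>The 1 that every entry adds to \<open>enc_size\<close> through the list length
      pays for the carry of one addition.\<close>
    moreover have "(2::nat) ^ enc_size (x # xs) = 2 ^ b * 2 ^ m + 2 ^ m * 2 ^ b"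
      by (simp add: enc_size_def b_def m_def power_add)
    moreover have "sum_list (x # xs) = x + sum_list xs" by simp
    ultimately show ?case by linarith
  qed
  then show ?thesis by (rule bitlen_le)
qed

text \<open>With \<open>Suc M \<le> N ^ 3\<close>, the sets of decorated crossing edges contribute 7
  * \<phi> to the exponent, the server times 3 * z and the extensions z + 3, in total 7 * \<phi> + 4
  * z + 3; the other bounds also fit below the chosen exponent.\<close>

lemma bounds_by_power:
  fixes n k e z \<phi> N Q M :: nat
  assumes N: "10 \<le> N" and n: "n + 2 \<le> N" and k: "Suc k \<le> N" and e: "e \<le> N" and Q: "Q < N" and M: "M = 2 * Suc n * e + Suc n"
  defines "W \<equiv> N ^ (7 * \<phi> + 4 * z + 8)"
  shows "N \<le> W" "z + k \<le> W" "(n * (n * (Suc k * Suc M)) + 1) ^ \<phi> * Suc M ^ z * (n * (z + k)) \<le> W" "M \<le> W"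
    "Suc Q * Suc M \<le> W"
proof -
  have pw: "N ^ i \<le> W" if "i \<le> 7 * \<phi> + 4 * z + 8" for i
    unfolding W_def using that N by (intro power_increasing) auto
  have M3: "Suc M \<le> N ^ 3"
  proof -
    have "Suc n * e \<le> N * N" using n e by (intro mult_le_mono) auto
    moreover have "Suc M = 2 * (Suc n * e) + (n + 2)" by (simp add: M algebra_simps)
    moreover have "N * 1 \<le> N * N" using N by (intro mult_le_mono2) simp
    ultimately have "Suc M \<le> 3 * (N * N)" using n by linarith
    also have "\<dots> \<le> N * (N * N)" using N by (intro mult_le_mono1) simp
    also have "\<dots> = N ^ 3" by (simp add: power3_eq_cube mult.assoc)
    finally show ?thesis .
  qed
  have zk: "z + k \<le> N ^ (z + 2)"
  proof -
    \<comment> \<open>Only the bit length of the input sum enters N, so N need not exceed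
      \<open>z\<close>; but \<open>z\<close> is fixed and may go into the exponent.\<close>
    have "z < 2 ^ z" by (rule less_exp)
    also have "(2::nat) ^ z \<le> N ^ z" using N by (intro power_mono) auto
    finally have "z \<le> N ^ z" by simp
    also have "N ^ z \<le> N ^ (z + 1)" using N by (intro power_increasing) auto
    finally have 1: "z \<le> N ^ (z + 1)" .
    have "k \<le> N ^ 1" using k by simp
    also have "N ^ 1 \<le> N ^ (z + 1)" using N by (intro power_increasing) auto
    finally have "z + k \<le> 2 * N ^ (z + 1)" using 1 by simp
    also have "\<dots> \<le> N * N ^ (z + 1)" using N by (intro mult_le_mono1) simp
    finally show ?thesis by simp
  qed
  show "N \<le> W" using pw[of 1] by simp
  show "z + k \<le> W" using zk pw[of "z + 2"] by simp
  show "M \<le> W" using M3 pw[of 3] by simp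
  have "Suc Q * Suc M \<le> N * N ^ 3" using M3 Q by (intro mult_le_mono) auto
  then show "Suc Q * Suc M \<le> W" using pw[of 4] by (simp add: numeral_eq_Suc)
  have "n * (n * (Suc k * Suc M)) \<le> N * (N * (N * N ^ 3))" using n k M3 by (intro mult_le_mono) auto
  also have "\<dots> = N ^ 6" by (simp add: numeral_eq_Suc)
  finally have "n * (n * (Suc k * Suc M)) + 1 \<le> N ^ 6 + N ^ 6" using N by (intro add_mono) auto
  also have "\<dots> = 2 * N ^ 6" by simp
  also have "\<dots> \<le> N * N ^ 6" using N by (intro mult_le_mono1) simp
  also have "\<dots> = N ^ 7" by (simp add: numeral_eq_Suc)
  finally have "(n * (n * (Suc k * Suc M)) + 1) ^ \<phi> \<le> (N ^ 7) ^ \<phi>" by (intro power_mono) auto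
  moreover have "Suc M ^ z \<le> (N ^ 3) ^ z" using M3 by (intro power_mono) auto
  moreover have "n * (z + k) \<le> N * N ^ (z + 2)" using n zk by (intro mult_le_mono) auto
  ultimately have "(n * (n * (Suc k * Suc M)) + 1) ^ \<phi> * Suc M ^ z * (n * (z + k)) \<le> (N ^ 7) ^ \<phi> * (N ^ 3) ^ z * (N * N ^ (z + 2))"
    by (rule mult_le_mono[OF mult_le_mono])
  also have "\<dots> = N ^ (7 * \<phi> + 4 * z + 3)"
    by (simp add: power_mult[symmetric] power_add[symmetric] power_Suc[symmetric] del: power_Suc)
       (simp add: algebra_simps numeral_eq_Suc)
  also have "\<dots> \<le> W" by (rule pw) simp
  finally show "(n * (n * (Suc k * Suc M)) + 1) ^ \<phi> * Suc M ^ z * (n * (z + k)) \<le> W" .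
qed

lemma runs_within_mono: "runs_within P xs T ys \<Longrightarrow> T \<le> T' \<Longrightarrow> runs_within P xs T' ys"
  unfolding runs_within_def using le_trans by blast

theorem theorem16:
  fixes \<phi> z :: nat
  shows "\<exists>P :: instr list. \<exists>c d :: nat. \<forall>I e.
     wf_inst I \<and> nz I = z \<and> cut_phi I \<le> \<phi> \<and> 1 \<le> e \<longrightarrow>
     (\<exists>ys. runs_within P (enc I @ [e]) (c * (enc_size (enc I) + e) ^ d + c) ys \<and>
           length ys = 2 * nj I \<and>
           valid_sched I (fst (dec_sched ys)) (snd (dec_sched ys)) \<and>
           sched_cost I (snd (dec_sched ys)) \<le> bud I \<and>
           (\<forall>C' \<eta>'. valid_sched I C' \<eta>' \<and> sched_cost I \<eta>' \<le> bud I \<longrightarrow>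
               real (makespan I (fst (dec_sched ys)))
                 \<le> (1 + 1 / real e) * real (makespan I C')))"
proof -
  \<comment> \<open>The exponent, and with it the program, depends on \<phi> and \<open>z\<close>
    only.\<close>
  define D where "D = 7 * \<phi> + 4 * z + 8"
  obtain f where f: "\<And>N x. ev N f (tov x) (tov (mainW z (N ^ D) x))"
    using pt_mainW[of D z] unfolding pt_def by blast
  obtain P A d where ram: "\<And>xs ws len. 10 \<le> length xs \<Longrightarrow> xs ! 3 = z \<Longrightarrow> 5 \<le> length ws \<Longrightarrow> len \<le> length ws \<Longrightarrow>
     length ws \<le> length xs \<Longrightarrow>
     ev (length xs + last xs + bitlen (sum_list xs)) f (tov (drop 9 xs @ take 9 xs))
        (tov (length ws, rev (tl ws) @ [len, hd ws])) \<Longrightarrow>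
     runs_within P xs (A * Suc (length xs + last xs + bitlen (sum_list xs)) ^ d) (take len ws)"
    using ram_simulation[of z f] by blast
  have "\<exists>ys. runs_within P (enc I @ [e]) (A * 5 ^ d * (enc_size (enc I) + e) ^ d + A * 5 ^ d) ys \<and>
           length ys = 2 * nj I \<and>
           valid_sched I (fst (dec_sched ys)) (snd (dec_sched ys)) \<and>
           sched_cost I (snd (dec_sched ys)) \<le> bud I \<and>
           (\<forall>C' \<eta>'. valid_sched I C' \<eta>' \<and> sched_cost I \<eta>' \<le> bud I \<longrightarrow>
               real (makespan I (fst (dec_sched ys)))
                 \<le> (1 + 1 / real e) * real (makespan I C'))"
    if wf: "wf_inst I" and nz: "nz I = z" and cut: "cut_phi I \<le> \<phi>" and e: "1 \<le> e" for I e
  proof -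
    define xs where "xs = enc I @ [e]"
    define Q where "Q = bitlen (sum_list xs)"
    define N where "N = length xs + last xs + Q"
    define W where "W = N ^ D"
    define M where "M = 2 * Suc (nj I) * e + Suc (nj I)"
    have le: "last xs = e" by (simp add: xs_def)
    \<comment> \<open>Only the encoding is needed here, so the size of the truncation bound is immaterial.\<close>
    interpret I0: instance_input I e "length xs + z + nk I" z xs
      by unfold_locales (use wf nz e in \<open>simp_all add: xs_def\<close>)
    have sz: "10 \<le> length xs" "2 * nj I + 5 \<le> length xs" by (rule I0.len10, rule I0.two_n)
    have "Suc (nk I) * 1 \<le> Suc (nk I) * nj I" using I0.n_pos by (intro mult_le_mono2) simp
    moreover have "Suc (nk I) * nj I \<le> length xs" unfolding I0.length_xs by simp
    ultimately have "Suc (nk I) * 1 \<le> length xs" by (rule le_trans)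
    then have kl: "Suc (nk I) \<le> length xs" by simp
    have N10: "10 \<le> N" "nj I + 2 \<le> N" "Suc (nk I) \<le> N" "e \<le> N" "Q < N" "length xs \<le> N"
      using sz kl le by (auto simp: N_def)
    note bnd = bounds_by_power[OF N10(1-5) M_def, where z = z and \<phi> = \<phi>, folded D_def, folded W_def]
    have lW: "length xs \<le> W" and eW: "e \<le> W" using N10 bnd(1) by linarith+
    interpret I1: fptas_input I e W z xs \<phi> M
      by unfold_locales (rule wf nz xs_def lW bnd e cut)+
    obtain u where u: "I1.attempt u \<noteq> []" "\<forall>v<u. I1.attempt v = []" "snd (snd (searchW z W xs e)) = I1.attempt u"
      using I1.search_finds[OF M_def bnd(5)[unfolded Q_def] eW] by blast
    obtain s ss where s: "I1.attempt u = s # ss" using u(1) by (cases "I1.attempt u") auto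
    have sin: "s \<in> set (I1.attempt u)" using s by simp
    note snd = I1.attempt_sound[OF sin]
    define ys where "ys = outW W xs (snd s)"
    define ws where "ws = ys @ [0, 0, 0, 0, 0 :: nat]"
    have lys: "length ys = 2 * nj I" unfolding ys_def by (rule I1.length_outW)
    have "mainW z W (drop 9 xs @ take 9 xs) = (length ws, rev (tl ws) @ [2 * nj I, hd ws])"
      using I1.mainW_eq[of s ss] u(3) s by (simp add: ws_def ys_def Let_def)
    then have "ev N f (tov (drop 9 xs @ take 9 xs)) (tov (length ws, rev (tl ws) @ [2 * nj I, hd ws]))"
      using f[of N "drop 9 xs @ take 9 xs"] by (simp add: W_def)
    moreover have "xs ! 3 = z" by (rule I0.header_nth)
    ultimately have "runs_within P xs (A * Suc N ^ d) (take (2 * nj I) ws)"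
      using ram[of xs ws "2 * nj I"] sz lys unfolding N_def Q_def ws_def by simp
    then have r0: "runs_within P xs (A * Suc N ^ d) ys" using lys by (simp add: ws_def)
    have "A * Suc N ^ d \<le> A * 5 ^ d * (enc_size (enc I) + e) ^ d + A * 5 ^ d"
    proof -
      have "bitlen e \<le> e" by (rule bitlen_le) (rule less_exp)
      moreover have "Q \<le> enc_size xs" unfolding Q_def by (rule bitlen_sum_list)
      moreover have "enc_size xs = enc_size (enc I) + 1 + bitlen e" by (simp add: xs_def enc_size_def)
      moreover have "length xs \<le> enc_size (enc I) + 1" by (simp add: xs_def enc_size_def)
      \<comment> \<open>With s the encoding size, length, last entry and bit length are at most s +
        1, e and s + 1 + e, so Suc N \<le> 2 * s + 2 * e + 3, and 3 \<le> 3 * e.\<close>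
      ultimately have "Suc N \<le> 5 * (enc_size (enc I) + e)"
        using e unfolding N_def le by simp
      then have "A * Suc N ^ d \<le> A * (5 * (enc_size (enc I) + e)) ^ d" by (intro mult_le_mono2 power_mono) auto
      also have "\<dots> = A * 5 ^ d * (enc_size (enc I) + e) ^ d" by (simp only: power_mult_distrib mult.assoc)
      finally show ?thesis by (rule trans_le_add1)
    qed
    with r0 have run: "runs_within P xs (A * 5 ^ d * (enc_size (enc I) + e) ^ d + A * 5 ^ d) ys"
      by (rule runs_within_mono)
    note out = I1.hist_output[OF snd(1,2), folded ys_def]
    have "real (makespan I (fst (dec_sched ys))) \<le> (1 + 1 / real e) * real (makespan I C')"
      if C: "valid_sched I C' \<eta>'" "sched_cost I \<eta>' \<le> bud I" for C' \<eta>'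
    proof -
      have "makespan I (fst (dec_sched ys)) \<le> I1.step_width u * I1.horizon u"
        using out(3) snd(4) by (auto simp: makespan_def)
      then have "e * makespan I (fst (dec_sched ys)) \<le> e * (I1.step_width u * I1.horizon u)" by (rule mult_le_mono2)
      also have "\<dots> \<le> (e + 1) * makespan I C'"
        unfolding makespan_def by (rule I1.first_attempt_ratio[OF M_def u(2) C])
      finally have "real e * real (makespan I (fst (dec_sched ys))) \<le> (real e + 1) * real (makespan I C')"
        by (metis of_nat_1 of_nat_add of_nat_le_iff of_nat_mult)
      then show ?thesis using e by (simp add: field_simps)
    qed
    then show ?thesis using run lys out(1,2) snd(3) unfolding xs_def by (intro exI[of _ ys]) auto
  qed
  then show ?thesis by blast
qed

end
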